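(* Let $\mathfrak C$ be a small 2-category and let $E\colon \mathfrak C\to\mathfrak{Cat}$ and $W\colon \mathfrak C^{op}\to\mathfrak{Cat}$ be pseudo-functors. For every small category $\mathscr X$, the functors \[ \Phi\colon \mathfrak{Cat}(E\star W,\mathscr X)\to \mathrm{Hom}(\mathfrak C^{op},\mathfrak{Cat})(W,\mathfrak{Cat}(E,\mathscr X)),\qquad \Psi\colon \mathrm{Hom}(\mathfrak C^{op},\mathfrak{Cat})(W,\mathfrak{Cat}(E,\mathscr X))\to\mathfrak{Cat}(E\star W,\mathscr X) \] defined in the context are mutually inverse. In particular $E\star W=\pi_0\Delta(E,W)[\Sigma^{-1}]$ is the pseudo-colimit of $E$ weighted by $W$, in the sense that $\Phi$ and $\Psi$ provide an isomorphism of categories \[ \mathfrak{Cat}(\pi_0\Delta(E,W)[\Sigma^{-1}],\mathscr X)\cong \mathrm{Hom}(\mathfrak C^{op},\mathfrak{Cat})(W,\mathfrak{Cat}(E,\mathscr X)) \] for every small category $\mathscr X$.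
   Context: $\mathfrak{Cat}$ is the 2-category of small categories, functors and natural transformations. $\mathfrak C^{op}$ reverses 1-cells only. All pseudo-functors are assumed normalized (identity 1-cells are preserved strictly). For $f\colon C\to D$ and $\alpha\colon f\Rightarrow g$ in $\mathfrak C$, write $f_!\colon EC\to ED$, $\alpha_!\colon f_!\Rightarrow g_!$ for their images under $E$, and $f^*\colon WD\to WC$, $\alpha^*\colon f^*\Rightarrow g^*$ for their images under $W$. $\mathrm{Hom}(\mathfrak K,\mathfrak L)$ is the 2-category of pseudo-functors, pseudo-natural transformations (with invertible coherence cells $\theta_f\colon \theta_B\circ Ff\Rightarrow Gf\circ\theta_A$ for $f\colon A\to B$) and modifications. $\mathfrak{Cat}(E,\mathscr X)\colon\mathfrak C^{op}\to\mathfrak{Cat}$ is $C\mapsto \mathfrak{Cat}(EC,\mathscr X)$, acting on $f$ by precomposition with $f_!$. The pseudo-colimit of $E$ weighted by $W$ is a category $L$ with a pseudo-natural transformation $\xi\colon W\to\mathfrak{Cat}(E,L)$ inducing an isomorphism $\mathfrak{Cat}(L,\mathscr X)\cong\mathrm{Hom}(\mathfrak C^{op},\mathfrak{Cat})(W,\mathfrak{Cat}(E,\mathscr X))$ for all small $\mathscr X$. $\Delta(E,W)$ is the following 2-category. Objects: triples $(C,X,Y)$ with $C\in\mathfrak C_0$, $X\in EC$, $Y\in WC$. Arrows $(C,X,Y)\to(D,A,B)$: triples $(f,u,v)$ with $f\colon C\to D$, $u\colon f_!X\to A$ in $ED$, $v\colon Y\to f^*B$ in $WC$. The composite of $(f,u,v)$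 with $(g,x,y)\colon (D,A,B)\to(D',A',B')$ is $gf$ together with $(gf)_!X\cong g_!f_!X\xrightarrow{g_!u}g_!A\xrightarrow{x}A'$ and $Y\xrightarrow{v}f^*B\xrightarrow{f^*y}f^*g^*B'\cong(gf)^*B'$; identities are $(1,1,1)$. A 2-cell $(f,u,v)\Rightarrow(g,x,y)$ between arrows $(C,X,Y)\to(D,A,B)$ is $\alpha\colon f\Rightarrow g$ in $\mathfrak C$ with $x\circ(\alpha_!)_X=u$ and $(\alpha^* )_B\circ v=y$. An arrow $(f,u,v)$ is cartesian if $u,v$ are invertible. $\pi_0\mathfrak A$ is the 1-category with the objects of $\mathfrak A$ and hom-sets the connected components of the hom-categories of $\mathfrak A$. $\Sigma$ is the set of images of cartesian arrows in $\pi_0\Delta(E,W)$; $E\star W:=\pi_0\Delta(E,W)[\Sigma^{-1}]$ is the category of fractions inverting $\Sigma$. The image in $E\star W$ of an arrow of $\Delta(E,W)$ is denoted by the same triple. Definition of $\Phi$. For a functor $F\colon E\star W\to\mathscr X$, $\Phi(F)$ has components $\Phi(F)_C\colon WC\to\mathfrak{Cat}(EC,\mathscr X)$ given by $\Phi(F)_C(Y)(X)=F(C,X,Y)$, $\Phi(F)_C(Y)(u)=F(1_C,u,1_Y)$ for $u\colon X\to Z$ in $EC$, and $\Phi(F)_C(v)_X=F(1_C,1_X,v)$ for $v\colon Y\to Z$ in $WC$; for $f\colon C\to D$, its coherence cell $\Phi(F)_C\circ f^*\Rightarrow (f_!)^*\circ\Phi(F)_D$ (where $(f_!)^*$ is precomposition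 with $f_!$) has component at $Y\in WD$, $X\in EC$ the image under $F$ of $(f,1,1)\colon(C,X,f^*Y)\to(D,f_!X,Y)$. For a natural transformation $\alpha\colon F\Rightarrow G$, $\Phi(\alpha)$ is the modification with $\Phi(\alpha)_{C,Y,X}=\alpha_{(C,X,Y)}$. Definition of $\Psi$. For a pseudo-natural transformation $\theta\colon W\to\mathfrak{Cat}(E,\mathscr X)$, with coherence cells $\theta_f\colon\theta_C\circ f^*\Rightarrow(f_!)^*\circ\theta_D$ for $f\colon C\to D$, $\Psi(\theta)$ is the functor on $E\star W$ induced by $(C,X,Y)\mapsto\theta_C(Y)(X)$ on objects and by sending $(f,u,v)\colon(C,X,Y)\to(D,U,V)$ to the composite \[ \theta_C(Y)(X)\xrightarrow{\theta_C(v)_X}\theta_C(f^*V)(X)\xrightarrow{\theta_{f,V,X}}\theta_D(V)(f_!X)\xrightarrow{\theta_D(V)(u)}\theta_D(V)(U). \] For a modification $m\colon\theta\Rrightarrow\gamma$, $\Psi(m)_{(C,X,Y)}=m_{C,Y,X}\colon\theta_C(Y)(X)\to\gamma_C(Y)(X)$. *)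

theory Defs
  imports "HOL-Library.FuncSet"
begin

section \<open>Categories, functors, natural transformations\<close>

text \<open>
  A small category consists of carrier sets inside HOL types. Functors and natural transformations
  record their source and target and are extensional outside the relevant carriers, so that HOL
  equality is equality of functors (of natural transformations). Composition is written in
  applicative order.
\<close>

record ('o, 'a) cat =
  Ob :: "'o set"
  Ar :: "'a set"
  Src :: "'a \<Rightarrow> 'o"
  Tgt :: "'a \<Rightarrow> 'o"
  Idt :: "'o \<Rightarrow> 'a"
  Cmp :: "'a \<Rightarrow> 'a \<Rightarrow> 'a"  (infixl \<open>\<cdot>\<index>\<close> 70)

definition Hom :: "('o, 'a) cat \<Rightarrow> 'o \<Rightarrow> 'o \<Rightarrow> 'a set" where
  "Hom A a b = {f \<in> Ar A. Src A f = a \<and> Tgt A f = b}"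

locale category =
  fixes A :: "('o, 'a) cat"
  assumes ends: "f \<in> Ar A \<Longrightarrow> Src A f \<in> Ob A \<and> Tgt A f \<in> Ob A"
    and idt: "a \<in> Ob A \<Longrightarrow> Idt A a \<in> Hom A a a"
    and cmp: "f \<in> Hom A a b \<Longrightarrow> g \<in> Hom A b c \<Longrightarrow> g \<cdot>\<^bsub>A\<^esub> f \<in> Hom A a c"
    and idt_right: "f \<in> Hom A a b \<Longrightarrow> f \<cdot>\<^bsub>A\<^esub> Idt A a = f"
    and idt_left: "f \<in> Hom A a b \<Longrightarrow> Idt A b \<cdot>\<^bsub>A\<^esub> f = f"
    and assoc: "f \<in> Hom A a b \<Longrightarrow> g \<in> Hom A b c \<Longrightarrow> h \<in> Hom A c d \<Longrightarrow>
                  (h \<cdot>\<^bsub>A\<^esub> g) \<cdot>\<^bsub>A\<^esub> f = h \<cdot>\<^bsub>A\<^esub> (g \<cdot>\<^bsub>A\<^esub> f)"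

definition inverses :: "('o, 'a) cat \<Rightarrow> 'a \<Rightarrow> 'a \<Rightarrow> bool" where
  "inverses A f g \<longleftrightarrow> f \<in> Ar A \<and> g \<in> Hom A (Tgt A f) (Src A f) \<and>
     g \<cdot>\<^bsub>A\<^esub> f = Idt A (Src A f) \<and> f \<cdot>\<^bsub>A\<^esub> g = Idt A (Tgt A f)"

definition invertible :: "('o, 'a) cat \<Rightarrow> 'a \<Rightarrow> bool" where
  "invertible A f \<longleftrightarrow> (\<exists>g. inverses A f g)"

definition Inv :: "('o, 'a) cat \<Rightarrow> 'a \<Rightarrow> 'a" where
  "Inv A f = (THE g. inverses A f g)"

record ('o, 'a, 'p, 'b) fnct =
  FDom :: "('o, 'a) cat"
  FCod :: "('p, 'b) cat"
  FOb :: "'o \<Rightarrow> 'p"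
  FAr :: "'a \<Rightarrow> 'b"

locale is_functor =
  fixes F :: "('o, 'a, 'p, 'b) fnct"
  assumes dom: "category (FDom F)"
    and cod: "category (FCod F)"
    and ob: "FOb F \<in> Ob (FDom F) \<rightarrow>\<^sub>E Ob (FCod F)"
    and ar_ext: "FAr F \<in> extensional (Ar (FDom F))"
    and ar: "f \<in> Hom (FDom F) a b \<Longrightarrow> FAr F f \<in> Hom (FCod F) (FOb F a) (FOb F b)"
    and idt: "a \<in> Ob (FDom F) \<Longrightarrow> FAr F (Idt (FDom F) a) = Idt (FCod F) (FOb F a)"
    and cmp: "f \<in> Hom (FDom F) a b \<Longrightarrow> g \<in> Hom (FDom F) b c \<Longrightarrow>
                FAr F (g \<cdot>\<^bsub>FDom F\<^esub> f) = FAr F g \<cdot>\<^bsub>FCod F\<^esub> FAr F f"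

definition Functors :: "('o, 'a) cat \<Rightarrow> ('p, 'b) cat \<Rightarrow> ('o, 'a, 'p, 'b) fnct set" where
  "Functors A B = {F. is_functor F \<and> FDom F = A \<and> FCod F = B}"

definition id_functor :: "('o, 'a) cat \<Rightarrow> ('o, 'a, 'o, 'a) fnct" where
  "id_functor A = \<lparr>FDom = A, FCod = A, FOb = (\<lambda>a\<in>Ob A. a), FAr = (\<lambda>f\<in>Ar A. f)\<rparr>"

definition fcomp :: "('p, 'b, 'q, 'c) fnct \<Rightarrow> ('o, 'a, 'p, 'b) fnct \<Rightarrow> ('o, 'a, 'q, 'c) fnct"
    (infixl \<open>\<circ>\<^sub>F\<close> 70) where
  "G \<circ>\<^sub>F F = \<lparr>FDom = FDom F, FCod = FCod G,
             FOb = (\<lambda>a\<in>Ob (FDom F). FOb G (FOb F a)),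
             FAr = (\<lambda>f\<in>Ar (FDom F). FAr G (FAr F f))\<rparr>"

record ('o, 'a, 'p, 'b) nt =
  NDom :: "('o, 'a, 'p, 'b) fnct"
  NCod :: "('o, 'a, 'p, 'b) fnct"
  NC :: "'o \<Rightarrow> 'b"

locale is_nt =
  fixes \<alpha> :: "('o, 'a, 'p, 'b) nt"
  assumes dom: "is_functor (NDom \<alpha>)"
    and cod: "is_functor (NCod \<alpha>)"
    and par_dom: "FDom (NCod \<alpha>) = FDom (NDom \<alpha>)"
    and par_cod: "FCod (NCod \<alpha>) = FCod (NDom \<alpha>)"
    and ext: "NC \<alpha> \<in> extensional (Ob (FDom (NDom \<alpha>)))"
    and comp: "a \<in> Ob (FDom (NDom \<alpha>)) \<Longrightarrow>
                 NC \<alpha> a \<in> Hom (FCod (NDom \<alpha>)) (FOb (NDom \<alpha>) a) (FOb (NCod \<alpha>) a)"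
    and natural: "f \<in> Hom (FDom (NDom \<alpha>)) a b \<Longrightarrow>
                 NC \<alpha> b \<cdot>\<^bsub>FCod (NDom \<alpha>)\<^esub> FAr (NDom \<alpha>) f =
                 FAr (NCod \<alpha>) f \<cdot>\<^bsub>FCod (NDom \<alpha>)\<^esub> NC \<alpha> a"

definition nt_id :: "('o, 'a, 'p, 'b) fnct \<Rightarrow> ('o, 'a, 'p, 'b) nt" where
  "nt_id F = \<lparr>NDom = F, NCod = F, NC = (\<lambda>a\<in>Ob (FDom F). Idt (FCod F) (FOb F a))\<rparr>"

definition nt_vcomp :: "('o, 'a, 'p, 'b) nt \<Rightarrow> ('o, 'a, 'p, 'b) nt \<Rightarrow> ('o, 'a, 'p, 'b) nt"
    (infixl \<open>\<bullet>\<^sub>N\<close> 65) where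
  "\<beta> \<bullet>\<^sub>N \<alpha> = \<lparr>NDom = NDom \<alpha>, NCod = NCod \<beta>,
             NC = (\<lambda>a\<in>Ob (FDom (NDom \<alpha>)). NC \<beta> a \<cdot>\<^bsub>FCod (NDom \<alpha>)\<^esub> NC \<alpha> a)\<rparr>"

text \<open>Horizontal composition; whiskering with \<open>F\<close> is composition with \<open>nt_id F\<close>.\<close>

definition nt_hcomp :: "('p, 'b, 'q, 'c) nt \<Rightarrow> ('o, 'a, 'p, 'b) nt \<Rightarrow> ('o, 'a, 'q, 'c) nt"
    (infixl \<open>\<star>\<^sub>N\<close> 70) where
  "\<beta> \<star>\<^sub>N \<alpha> = \<lparr>NDom = NDom \<beta> \<circ>\<^sub>F NDom \<alpha>, NCod = NCod \<beta> \<circ>\<^sub>F NCod \<alpha>,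
             NC = (\<lambda>a\<in>Ob (FDom (NDom \<alpha>)).
                     NC \<beta> (FOb (NCod \<alpha>) a) \<cdot>\<^bsub>FCod (NDom \<beta>)\<^esub> FAr (NDom \<beta>) (NC \<alpha> a))\<rparr>"

definition FunCat :: "('o, 'a) cat \<Rightarrow> ('p, 'b) cat \<Rightarrow>
    (('o, 'a, 'p, 'b) fnct, ('o, 'a, 'p, 'b) nt) cat" where
  "FunCat A X = \<lparr>Ob = Functors A X,
                 Ar = {\<alpha>. is_nt \<alpha> \<and> NDom \<alpha> \<in> Functors A X},
                 Src = NDom, Tgt = NCod, Idt = nt_id, Cmp = nt_vcomp\<rparr>"

definition mutually_inverse ::
    "('o, 'a) cat \<Rightarrow> ('p, 'b) cat \<Rightarrow> ('o, 'a, 'p, 'b) fnct \<Rightarrow> ('p, 'b, 'o, 'a) fnct \<Rightarrow> bool" where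
  "mutually_inverse A B F G \<longleftrightarrow> F \<in> Functors A B \<and> G \<in> Functors B A \<and>
     G \<circ>\<^sub>F F = id_functor A \<and> F \<circ>\<^sub>F G = id_functor B"

text \<open>The functor \<open>H \<mapsto> H \<circ> F\<close> between functor categories, natural in \<open>F\<close>.\<close>

definition precomp :: "('p, 'b) cat \<Rightarrow> ('o, 'a, 'q, 'c) fnct \<Rightarrow>
    (('q, 'c, 'p, 'b) fnct, ('q, 'c, 'p, 'b) nt, ('o, 'a, 'p, 'b) fnct, ('o, 'a, 'p, 'b) nt) fnct" where
  "precomp X F = \<lparr>FDom = FunCat (FCod F) X, FCod = FunCat (FDom F) X,
                  FOb = (\<lambda>H\<in>Ob (FunCat (FCod F) X). H \<circ>\<^sub>F F),
                  FAr = (\<lambda>\<sigma>\<in>Ar (FunCat (FCod F) X). \<sigma> \<star>\<^sub>N nt_id F)\<rparr>"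

definition precomp_nt :: "('p, 'b) cat \<Rightarrow> ('o, 'a, 'q, 'c) nt \<Rightarrow>
    (('q, 'c, 'p, 'b) fnct, ('q, 'c, 'p, 'b) nt, ('o, 'a, 'p, 'b) fnct, ('o, 'a, 'p, 'b) nt) nt" where
  "precomp_nt X \<alpha> = \<lparr>NDom = precomp X (NDom \<alpha>), NCod = precomp X (NCod \<alpha>),
                     NC = (\<lambda>H\<in>Ob (FunCat (FCod (NDom \<alpha>)) X). nt_id H \<star>\<^sub>N \<alpha>)\<rparr>"

text \<open>The functor \<open>H \<mapsto> F \<circ> H\<close> on functors out of \<open>A\<close>, natural in \<open>F\<close>.\<close>

definition postcomp :: "('o, 'a) cat \<Rightarrow> ('q, 'c, 'p, 'b) fnct \<Rightarrow>
    (('o, 'a, 'q, 'c) fnct, ('o, 'a, 'q, 'c) nt, ('o, 'a, 'p, 'b) fnct, ('o, 'a, 'p, 'b) nt) fnct" where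
  "postcomp A F = \<lparr>FDom = FunCat A (FDom F), FCod = FunCat A (FCod F),
                   FOb = (\<lambda>H\<in>Ob (FunCat A (FDom F)). F \<circ>\<^sub>F H),
                   FAr = (\<lambda>\<sigma>\<in>Ar (FunCat A (FDom F)). nt_id F \<star>\<^sub>N \<sigma>)\<rparr>"

definition postcomp_nt :: "('o, 'a) cat \<Rightarrow> ('q, 'c, 'p, 'b) nt \<Rightarrow>
    (('o, 'a, 'q, 'c) fnct, ('o, 'a, 'q, 'c) nt, ('o, 'a, 'p, 'b) fnct, ('o, 'a, 'p, 'b) nt) nt" where
  "postcomp_nt A \<alpha> = \<lparr>NDom = postcomp A (NDom \<alpha>), NCod = postcomp A (NCod \<alpha>),
                      NC = (\<lambda>H\<in>Ob (FunCat A (FDom (NDom \<alpha>))). \<alpha> \<star>\<^sub>N nt_id H)\<rparr>"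


section \<open>2-categories and pseudo-functors\<close>

record ('c, 'f, 't) two_cat =
  Ob0 :: "'c set"
  Ar1 :: "'f set"
  Dom1 :: "'f \<Rightarrow> 'c"
  Cod1 :: "'f \<Rightarrow> 'c"
  Id1 :: "'c \<Rightarrow> 'f"
  Comp1 :: "'f \<Rightarrow> 'f \<Rightarrow> 'f"  (infixl \<open>\<odot>\<index>\<close> 70)
  Ar2 :: "'t set"
  Dom2 :: "'t \<Rightarrow> 'f"
  Cod2 :: "'t \<Rightarrow> 'f"
  Id2 :: "'f \<Rightarrow> 't"
  VComp :: "'t \<Rightarrow> 't \<Rightarrow> 't"  (infixl \<open>\<bullet>\<index>\<close> 65)
  HComp :: "'t \<Rightarrow> 't \<Rightarrow> 't"  (infixl \<open>\<star>\<index>\<close> 70)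

definition cat1 :: "('c, 'f, 't) two_cat \<Rightarrow> ('c, 'f) cat" where
  "cat1 K = \<lparr>Ob = Ob0 K, Ar = Ar1 K, Src = Dom1 K, Tgt = Cod1 K, Idt = Id1 K, Cmp = Comp1 K\<rparr>"

text \<open>The disjoint union of the hom-categories.\<close>

definition vcat :: "('c, 'f, 't) two_cat \<Rightarrow> ('f, 't) cat" where
  "vcat K = \<lparr>Ob = Ar1 K, Ar = Ar2 K, Src = Dom2 K, Tgt = Cod2 K, Idt = Id2 K, Cmp = VComp K\<rparr>"

definition hcat :: "('c, 'f, 't) two_cat \<Rightarrow> ('c, 't) cat" where
  "hcat K = \<lparr>Ob = Ob0 K, Ar = Ar2 K, Src = (\<lambda>\<alpha>. Dom1 K (Dom2 K \<alpha>)), Tgt = (\<lambda>\<alpha>. Cod1 K (Dom2 K \<alpha>)),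
             Idt = (\<lambda>A. Id2 K (Id1 K A)), Cmp = HComp K\<rparr>"

definition Hom1 :: "('c, 'f, 't) two_cat \<Rightarrow> 'c \<Rightarrow> 'c \<Rightarrow> 'f set" where
  "Hom1 K A B = Hom (cat1 K) A B"

definition Hom2 :: "('c, 'f, 't) two_cat \<Rightarrow> 'f \<Rightarrow> 'f \<Rightarrow> 't set" where
  "Hom2 K f g = Hom (vcat K) f g"

locale two_category =
  fixes K :: "('c, 'f, 't) two_cat"
  assumes cat1: "category (cat1 K)"
    and vcat: "category (vcat K)"
    and hcat: "category (hcat K)"
    and globular: "\<alpha> \<in> Ar2 K \<Longrightarrow> Dom1 K (Dom2 K \<alpha>) = Dom1 K (Cod2 K \<alpha>) \<and>
                                 Cod1 K (Dom2 K \<alpha>) = Cod1 K (Cod2 K \<alpha>)"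
    and hcomp: "f \<in> Hom1 K A B \<Longrightarrow> g \<in> Hom1 K B C \<Longrightarrow> \<alpha> \<in> Hom2 K f f' \<Longrightarrow> \<beta> \<in> Hom2 K g g' \<Longrightarrow>
                  \<beta> \<star>\<^bsub>K\<^esub> \<alpha> \<in> Hom2 K (g \<odot>\<^bsub>K\<^esub> f) (g' \<odot>\<^bsub>K\<^esub> f')"
    and hcomp_id: "f \<in> Hom1 K A B \<Longrightarrow> g \<in> Hom1 K B C \<Longrightarrow> Id2 K g \<star>\<^bsub>K\<^esub> Id2 K f = Id2 K (g \<odot>\<^bsub>K\<^esub> f)"
    and interchange: "f \<in> Hom1 K A B \<Longrightarrow> g \<in> Hom1 K B C \<Longrightarrow>
                  \<alpha> \<in> Hom2 K f f' \<Longrightarrow> \<alpha>' \<in> Hom2 K f' f'' \<Longrightarrow> \<beta> \<in> Hom2 K g g' \<Longrightarrow> \<beta>' \<in> Hom2 K g' g'' \<Longrightarrow>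
                  (\<beta>' \<bullet>\<^bsub>K\<^esub> \<beta>) \<star>\<^bsub>K\<^esub> (\<alpha>' \<bullet>\<^bsub>K\<^esub> \<alpha>) = (\<beta>' \<star>\<^bsub>K\<^esub> \<alpha>') \<bullet>\<^bsub>K\<^esub> (\<beta> \<star>\<^bsub>K\<^esub> \<alpha>)"

definition op1 :: "('c, 'f, 't) two_cat \<Rightarrow> ('c, 'f, 't) two_cat" where
  "op1 K = K\<lparr>Dom1 := Cod1 K, Cod1 := Dom1 K,
             Comp1 := (\<lambda>g f. f \<odot>\<^bsub>K\<^esub> g), HComp := (\<lambda>\<beta> \<alpha>. \<alpha> \<star>\<^bsub>K\<^esub> \<beta>)\<rparr>"

definition Cat :: "(('o, 'a) cat, ('o, 'a, 'o, 'a) fnct, ('o, 'a, 'o, 'a) nt) two_cat" where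
  "Cat = \<lparr>Ob0 = {A. category A},
          Ar1 = {F. is_functor F}, Dom1 = FDom, Cod1 = FCod, Id1 = id_functor, Comp1 = fcomp,
          Ar2 = {\<alpha>. is_nt \<alpha>}, Dom2 = NDom, Cod2 = NCod, Id2 = nt_id, VComp = nt_vcomp,
          HComp = nt_hcomp\<rparr>"

text \<open>
  The field \<open>PC\<close> holds the comparison cells \<open>PC F g f : F g \<circ> F f \<Rightarrow> F (g \<circ> f)\<close>. Pseudo-functors are
  normalized: the unit comparison is the identity, so the unit coherence axioms say that
  \<open>PC F f 1\<close> and \<open>PC F 1 f\<close> are identities.
\<close>

record ('c, 'f, 't, 'd, 'g, 's) psf =
  P0 :: "'c \<Rightarrow> 'd"
  P1 :: "'f \<Rightarrow> 'g"
  P2 :: "'t \<Rightarrow> 's"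
  PC :: "'f \<Rightarrow> 'f \<Rightarrow> 's"

locale pseudofunctor =
  fixes K :: "('c, 'f, 't) two_cat"
    and L :: "('d, 'g, 's) two_cat"
    and F :: "('c, 'f, 't, 'd, 'g, 's) psf"
  assumes ob: "A \<in> Ob0 K \<Longrightarrow> P0 F A \<in> Ob0 L"
    and ar: "f \<in> Hom1 K A B \<Longrightarrow> P1 F f \<in> Hom1 L (P0 F A) (P0 F B)"
    and cell: "\<alpha> \<in> Hom2 K f g \<Longrightarrow> P2 F \<alpha> \<in> Hom2 L (P1 F f) (P1 F g)"
    and cell_id: "f \<in> Ar1 K \<Longrightarrow> P2 F (Id2 K f) = Id2 L (P1 F f)"
    and cell_vcomp: "\<alpha> \<in> Hom2 K f g \<Longrightarrow> \<beta> \<in> Hom2 K g h \<Longrightarrow>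
                       P2 F (\<beta> \<bullet>\<^bsub>K\<^esub> \<alpha>) = P2 F \<beta> \<bullet>\<^bsub>L\<^esub> P2 F \<alpha>"
    and normal: "A \<in> Ob0 K \<Longrightarrow> P1 F (Id1 K A) = Id1 L (P0 F A)"
    and comparison: "f \<in> Hom1 K A B \<Longrightarrow> g \<in> Hom1 K B C \<Longrightarrow>
                       PC F g f \<in> Hom2 L (P1 F g \<odot>\<^bsub>L\<^esub> P1 F f) (P1 F (g \<odot>\<^bsub>K\<^esub> f)) \<and>
                       invertible (vcat L) (PC F g f)"
    and comparison_natural: "f \<in> Hom1 K A B \<Longrightarrow> g \<in> Hom1 K B C \<Longrightarrow>
                       \<alpha> \<in> Hom2 K f f' \<Longrightarrow> \<beta> \<in> Hom2 K g g' \<Longrightarrow>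
                       PC F g' f' \<bullet>\<^bsub>L\<^esub> (P2 F \<beta> \<star>\<^bsub>L\<^esub> P2 F \<alpha>) = P2 F (\<beta> \<star>\<^bsub>K\<^esub> \<alpha>) \<bullet>\<^bsub>L\<^esub> PC F g f"
    and comparison_assoc: "f \<in> Hom1 K A B \<Longrightarrow> g \<in> Hom1 K B C \<Longrightarrow> h \<in> Hom1 K C D \<Longrightarrow>
                       PC F h (g \<odot>\<^bsub>K\<^esub> f) \<bullet>\<^bsub>L\<^esub> (Id2 L (P1 F h) \<star>\<^bsub>L\<^esub> PC F g f) =
                       PC F (h \<odot>\<^bsub>K\<^esub> g) f \<bullet>\<^bsub>L\<^esub> (PC F h g \<star>\<^bsub>L\<^esub> Id2 L (P1 F f))"
    and comparison_unit: "f \<in> Hom1 K A B \<Longrightarrow>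
                       PC F f (Id1 K A) = Id2 L (P1 F f) \<and> PC F (Id1 K B) f = Id2 L (P1 F f)"

type_synonym ('c, 'f, 't, 'o, 'a) cat_psf =
  "('c, 'f, 't, ('o, 'a) cat, ('o, 'a, 'o, 'a) fnct, ('o, 'a, 'o, 'a) nt) psf"

text \<open>
  \<open>CatInto E X\<close> is \<open>Cat(E, X)\<close>, a pseudo-functor on the opposite \<open>op1 K\<close> of the domain of \<open>E\<close>. The
  composite of \<open>f\<close> after \<open>g\<close> in \<open>op1 K\<close> is \<open>g \<circ> f\<close> in \<open>K\<close>, whence the swap of arguments in \<open>PC\<close>.
\<close>

definition CatInto :: "('c, 'f, 't, 'o, 'a) cat_psf \<Rightarrow> ('p, 'b) cat \<Rightarrow>
    ('c, 'f, 't, ('o, 'a, 'p, 'b) fnct, ('o, 'a, 'p, 'b) nt) cat_psf" where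
  "CatInto E X = \<lparr>P0 = (\<lambda>C. FunCat (P0 E C) X),
                  P1 = (\<lambda>f. precomp X (P1 E f)),
                  P2 = (\<lambda>\<alpha>. precomp_nt X (P2 E \<alpha>)),
                  PC = (\<lambda>f g. precomp_nt X (PC E g f))\<rparr>"


section \<open>Pseudo-natural transformations and modifications\<close>

text \<open>
  These are defined for \<open>Cat\<close>-valued pseudo-functors \<open>V\<close>, \<open>W\<close> whose values may live in different HOL
  types, as is the case for \<open>W\<close> and \<open>Cat(E, X)\<close>; hence the axioms use the polymorphic operations on
  functors and natural transformations in place of the fields of \<open>Cat\<close>.
\<close>

record ('c, 'f, 'o, 'a, 'p, 'b) pnat =
  TOb :: "'c \<Rightarrow> ('o, 'a, 'p, 'b) fnct"
  TCell :: "'f \<Rightarrow> ('o, 'a, 'p, 'b) nt"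

locale is_pnat =
  fixes K :: "('c, 'f, 't) two_cat"
    and W :: "('c, 'f, 't, 'o, 'a) cat_psf"
    and V :: "('c, 'f, 't, 'p, 'b) cat_psf"
    and \<theta> :: "('c, 'f, 'o, 'a, 'p, 'b) pnat"
  assumes ob_ext: "TOb \<theta> \<in> extensional (Ob0 K)"
    and cell_ext: "TCell \<theta> \<in> extensional (Ar1 K)"
    and ob: "A \<in> Ob0 K \<Longrightarrow> TOb \<theta> A \<in> Functors (P0 W A) (P0 V A)"
    and cell: "f \<in> Hom1 K A B \<Longrightarrow>
                 TCell \<theta> f \<in> Hom (FunCat (P0 W A) (P0 V B)) (TOb \<theta> B \<circ>\<^sub>F P1 W f) (P1 V f \<circ>\<^sub>F TOb \<theta> A) \<and>
                 invertible (FunCat (P0 W A) (P0 V B)) (TCell \<theta> f)"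
    and natural: "f \<in> Hom1 K A B \<Longrightarrow> \<alpha> \<in> Hom2 K f g \<Longrightarrow>
                 TCell \<theta> g \<bullet>\<^sub>N (nt_id (TOb \<theta> B) \<star>\<^sub>N P2 W \<alpha>) =
                 (P2 V \<alpha> \<star>\<^sub>N nt_id (TOb \<theta> A)) \<bullet>\<^sub>N TCell \<theta> f"
    and unit: "A \<in> Ob0 K \<Longrightarrow> TCell \<theta> (Id1 K A) = nt_id (TOb \<theta> A)"
    and comp: "f \<in> Hom1 K A B \<Longrightarrow> g \<in> Hom1 K B C \<Longrightarrow>
                 TCell \<theta> (g \<odot>\<^bsub>K\<^esub> f) \<bullet>\<^sub>N (nt_id (TOb \<theta> C) \<star>\<^sub>N PC W g f) =
                 (PC V g f \<star>\<^sub>N nt_id (TOb \<theta> A)) \<bullet>\<^sub>N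
                 ((nt_id (P1 V g) \<star>\<^sub>N TCell \<theta> f) \<bullet>\<^sub>N (TCell \<theta> g \<star>\<^sub>N nt_id (P1 W f)))"

record ('c, 'f, 'o, 'a, 'p, 'b) modif =
  MDom :: "('c, 'f, 'o, 'a, 'p, 'b) pnat"
  MCod :: "('c, 'f, 'o, 'a, 'p, 'b) pnat"
  MC :: "'c \<Rightarrow> ('o, 'a, 'p, 'b) nt"

locale is_modif =
  fixes K :: "('c, 'f, 't) two_cat"
    and W :: "('c, 'f, 't, 'o, 'a) cat_psf"
    and V :: "('c, 'f, 't, 'p, 'b) cat_psf"
    and m :: "('c, 'f, 'o, 'a, 'p, 'b) modif"
  assumes dom: "is_pnat K W V (MDom m)"
    and cod: "is_pnat K W V (MCod m)"
    and ext: "MC m \<in> extensional (Ob0 K)"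
    and comp: "A \<in> Ob0 K \<Longrightarrow> MC m A \<in> Hom (FunCat (P0 W A) (P0 V A)) (TOb (MDom m) A) (TOb (MCod m) A)"
    and natural: "f \<in> Hom1 K A B \<Longrightarrow>
                    (nt_id (P1 V f) \<star>\<^sub>N MC m A) \<bullet>\<^sub>N TCell (MDom m) f =
                    TCell (MCod m) f \<bullet>\<^sub>N (MC m B \<star>\<^sub>N nt_id (P1 W f))"

text \<open>The hom-category of \<open>Hom(K, Cat)\<close> from \<open>W\<close> to \<open>V\<close>.\<close>

definition PsHom :: "('c, 'f, 't) two_cat \<Rightarrow> ('c, 'f, 't, 'o, 'a) cat_psf \<Rightarrow>
    ('c, 'f, 't, 'p, 'b) cat_psf \<Rightarrow>
    (('c, 'f, 'o, 'a, 'p, 'b) pnat, ('c, 'f, 'o, 'a, 'p, 'b) modif) cat" where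
  "PsHom K W V =
     \<lparr>Ob = {\<theta>. is_pnat K W V \<theta>},
      Ar = {m. is_modif K W V m},
      Src = MDom, Tgt = MCod,
      Idt = (\<lambda>\<theta>. \<lparr>MDom = \<theta>, MCod = \<theta>, MC = (\<lambda>A\<in>Ob0 K. nt_id (TOb \<theta> A))\<rparr>),
      Cmp = (\<lambda>n m. \<lparr>MDom = MDom m, MCod = MCod n, MC = (\<lambda>A\<in>Ob0 K. MC n A \<bullet>\<^sub>N MC m A)\<rparr>)\<rparr>"


section \<open>Weighted pseudo-colimits\<close>

text \<open>
  The functor \<open>Cat(L, X) \<rightarrow> Hom(K\<^sup>o\<^sup>p, Cat)(W, Cat(E, X))\<close> induced by \<open>\<xi> : W \<rightarrow> Cat(E, L)\<close>, which
  sends \<open>F\<close> to \<open>Cat(E, F) \<circ> \<xi>\<close>.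
\<close>

definition induced :: "('c, 'f, 't) two_cat \<Rightarrow> ('c, 'f, 't, 'eo, 'ea) cat_psf \<Rightarrow>
    ('c, 'f, 't, 'wo, 'wa) cat_psf \<Rightarrow> ('l, 'k) cat \<Rightarrow>
    ('c, 'f, 'wo, 'wa, ('eo, 'ea, 'l, 'k) fnct, ('eo, 'ea, 'l, 'k) nt) pnat \<Rightarrow> ('x, 'y) cat \<Rightarrow>
    (('l, 'k, 'x, 'y) fnct, ('l, 'k, 'x, 'y) nt,
     ('c, 'f, 'wo, 'wa, ('eo, 'ea, 'x, 'y) fnct, ('eo, 'ea, 'x, 'y) nt) pnat,
     ('c, 'f, 'wo, 'wa, ('eo, 'ea, 'x, 'y) fnct, ('eo, 'ea, 'x, 'y) nt) modif) fnct" where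
  "induced K E W L \<xi> X =
     (let ob = (\<lambda>F. \<lparr>TOb = (\<lambda>C\<in>Ob0 K. postcomp (P0 E C) F \<circ>\<^sub>F TOb \<xi> C),
                     TCell = (\<lambda>f\<in>Ar1 K. nt_id (postcomp (P0 E (Dom1 K f)) F) \<star>\<^sub>N TCell \<xi> f)\<rparr>)
      in \<lparr>FDom = FunCat L X,
          FCod = PsHom (op1 K) W (CatInto E X),
          FOb = (\<lambda>F\<in>Ob (FunCat L X). ob F),
          FAr = (\<lambda>\<alpha>\<in>Ar (FunCat L X).
                   \<lparr>MDom = ob (NDom \<alpha>), MCod = ob (NCod \<alpha>),
                    MC = (\<lambda>C\<in>Ob0 K. postcomp_nt (P0 E C) \<alpha> \<star>\<^sub>N nt_id (TOb \<xi> C))\<rparr>)\<rparr>)"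

text \<open>
  The universal property of the pseudo-colimit \<open>(L, \<xi>)\<close> of \<open>E\<close> weighted by \<open>W\<close>, tested on one category
  \<open>X\<close>. A definition cannot quantify over the type of \<open>X\<close>; a theorem that leaves \<open>X\<close> free does.
\<close>

definition pseudo_colimit_at :: "('c, 'f, 't) two_cat \<Rightarrow> ('c, 'f, 't, 'eo, 'ea) cat_psf \<Rightarrow>
    ('c, 'f, 't, 'wo, 'wa) cat_psf \<Rightarrow> ('l, 'k) cat \<Rightarrow>
    ('c, 'f, 'wo, 'wa, ('eo, 'ea, 'l, 'k) fnct, ('eo, 'ea, 'l, 'k) nt) pnat \<Rightarrow> ('x, 'y) cat \<Rightarrow> bool" where
  "pseudo_colimit_at K E W L \<xi> X \<longleftrightarrow>
     category L \<and> is_pnat (op1 K) W (CatInto E L) \<xi> \<and>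
     (\<exists>G. mutually_inverse (FunCat L X) (PsHom (op1 K) W (CatInto E X)) (induced K E W L \<xi> X) G)"


section \<open>Connected components and categories of fractions\<close>

definition eq_class :: "('a \<times> 'a) set \<Rightarrow> 'a \<Rightarrow> 'a set" where
  "eq_class R x = (R \<union> R\<inverse>)\<^sup>* `` {x}"

definition rep :: "'a set \<Rightarrow> 'a" where
  "rep c = (SOME x. x \<in> c)"

definition component :: "('c, 'f, 't) two_cat \<Rightarrow> 'f \<Rightarrow> 'f set" where
  "component K f = eq_class {(Dom2 K \<alpha>, Cod2 K \<alpha>) |\<alpha>. \<alpha> \<in> Ar2 K} f"

definition pi0 :: "('c, 'f, 't) two_cat \<Rightarrow> ('c, 'f set) cat" where
  "pi0 K = \<lparr>Ob = Ob0 K, Ar = component K ` Ar1 K,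
            Src = (\<lambda>c. Dom1 K (rep c)), Tgt = (\<lambda>c. Cod1 K (rep c)),
            Idt = (\<lambda>A. component K (Id1 K A)),
            Cmp = (\<lambda>d c. component K (rep d \<odot>\<^bsub>K\<^esub> rep c))\<rparr>"

text \<open>
  The category of fractions \<open>A[S\<^sup>-\<^sup>1]\<close>: zigzags of arrows of \<open>A\<close> and formal inverses of arrows in \<open>S\<close>,
  read in diagrammatic order and paired with their end points, modulo the congruence making the
  inclusion of \<open>A\<close> a functor and each \<open>Bwd s\<close> inverse to \<open>Fwd s\<close>.
\<close>

datatype 'a zig = Fwd 'a | Bwd 'a

inductive zigzag :: "('o, 'a) cat \<Rightarrow> 'a set \<Rightarrow> 'o \<Rightarrow> 'a zig list \<Rightarrow> 'o \<Rightarrow> bool"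
  for A :: "('o, 'a) cat" and S :: "'a set" where
  nil: "a \<in> Ob A \<Longrightarrow> zigzag A S a [] a"
| fwd: "f \<in> Ar A \<Longrightarrow> zigzag A S (Tgt A f) l b \<Longrightarrow> zigzag A S (Src A f) (Fwd f # l) b"
| bwd: "s \<in> S \<Longrightarrow> zigzag A S (Src A s) l b \<Longrightarrow> zigzag A S (Tgt A s) (Bwd s # l) b"

inductive zig_rel :: "('o, 'a) cat \<Rightarrow> 'a set \<Rightarrow> 'a zig list \<Rightarrow> 'a zig list \<Rightarrow> bool"
  for A :: "('o, 'a) cat" and S :: "'a set" where
  comp: "f \<in> Hom A a b \<Longrightarrow> g \<in> Hom A b c \<Longrightarrow> zig_rel A S [Fwd f, Fwd g] [Fwd (g \<cdot>\<^bsub>A\<^esub> f)]"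
| idt: "a \<in> Ob A \<Longrightarrow> zig_rel A S [Fwd (Idt A a)] []"
| fwd_bwd: "s \<in> S \<Longrightarrow> zig_rel A S [Fwd s, Bwd s] []"
| bwd_fwd: "s \<in> S \<Longrightarrow> zig_rel A S [Bwd s, Fwd s] []"

definition zig_step :: "('o, 'a) cat \<Rightarrow> 'a set \<Rightarrow> (('o \<times> 'a zig list \<times> 'o) \<times> ('o \<times> 'a zig list \<times> 'o)) set" where
  "zig_step A S = {((a, l @ p @ r, b), (a, l @ q @ r, b)) |a b l p q r.
     zig_rel A S p q \<and> zigzag A S a (l @ p @ r) b \<and> zigzag A S a (l @ q @ r) b}"

definition fraction :: "('o, 'a) cat \<Rightarrow> 'a set \<Rightarrow> 'o \<times> 'a zig list \<times> 'o \<Rightarrow> ('o \<times> 'a zig list \<times> 'o) set" where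
  "fraction A S = eq_class (zig_step A S)"

definition fractions :: "('o, 'a) cat \<Rightarrow> 'a set \<Rightarrow> ('o, ('o \<times> 'a zig list \<times> 'o) set) cat" where
  "fractions A S =
     \<lparr>Ob = Ob A,
      Ar = {fraction A S (a, l, b) |a l b. zigzag A S a l b},
      Src = (\<lambda>c. fst (rep c)), Tgt = (\<lambda>c. snd (snd (rep c))),
      Idt = (\<lambda>a. fraction A S (a, [], a)),
      Cmp = (\<lambda>d c. case (rep d, rep c) of ((_, l', b'), (a, l, _)) \<Rightarrow> fraction A S (a, l @ l', b'))\<rparr>"

definition to_fractions :: "('o, 'a) cat \<Rightarrow> 'a set \<Rightarrow> 'a \<Rightarrow> ('o \<times> 'a zig list \<times> 'o) set" where
  "to_fractions A S f = fraction A S (Src A f, [Fwd f], Tgt A f)"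


section \<open>The 2-category \<open>\<Delta>(E, W)\<close> and the category \<open>E \<star> W\<close>\<close>

text \<open>Arrows \<open>(f, u, v)\<close> are tagged with source and target, and 2-cells \<open>\<alpha>\<close> with source and target.\<close>

type_synonym ('c, 'eo, 'wo) dob = "'c \<times> 'eo \<times> 'wo"
type_synonym ('c, 'f, 'eo, 'ea, 'wo, 'wa) dar =
  "('c, 'eo, 'wo) dob \<times> ('f \<times> 'ea \<times> 'wa) \<times> ('c, 'eo, 'wo) dob"
type_synonym ('c, 'f, 't, 'eo, 'ea, 'wo, 'wa) dcell =
  "('c, 'f, 'eo, 'ea, 'wo, 'wa) dar \<times> 't \<times> ('c, 'f, 'eo, 'ea, 'wo, 'wa) dar"

definition delta_ob :: "('c, 'f, 't) two_cat \<Rightarrow> ('c, 'f, 't, 'eo, 'ea) cat_psf \<Rightarrow>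
    ('c, 'f, 't, 'wo, 'wa) cat_psf \<Rightarrow> ('c, 'eo, 'wo) dob set" where
  "delta_ob K E W = {(C, X, Y). C \<in> Ob0 K \<and> X \<in> Ob (P0 E C) \<and> Y \<in> Ob (P0 W C)}"

definition delta_ar :: "('c, 'f, 't) two_cat \<Rightarrow> ('c, 'f, 't, 'eo, 'ea) cat_psf \<Rightarrow>
    ('c, 'f, 't, 'wo, 'wa) cat_psf \<Rightarrow> ('c, 'f, 'eo, 'ea, 'wo, 'wa) dar set" where
  "delta_ar K E W = {((C, X, Y), (f, u, v), (D, A, B)).
     (C, X, Y) \<in> delta_ob K E W \<and> (D, A, B) \<in> delta_ob K E W \<and> f \<in> Hom1 K C D \<and>
     u \<in> Hom (P0 E D) (FOb (P1 E f) X) A \<and> v \<in> Hom (P0 W C) Y (FOb (P1 W f) B)}"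

definition delta_cell :: "('c, 'f, 't) two_cat \<Rightarrow> ('c, 'f, 't, 'eo, 'ea) cat_psf \<Rightarrow>
    ('c, 'f, 't, 'wo, 'wa) cat_psf \<Rightarrow> ('c, 'f, 't, 'eo, 'ea, 'wo, 'wa) dcell set" where
  "delta_cell K E W = {(((C, X, Y), (f, u, v), (D, A, B)), \<alpha>, (P, (g, x, y), Q)).
     ((C, X, Y), (f, u, v), (D, A, B)) \<in> delta_ar K E W \<and>
     P = (C, X, Y) \<and> Q = (D, A, B) \<and> (P, (g, x, y), Q) \<in> delta_ar K E W \<and> \<alpha> \<in> Hom2 K f g \<and>
     x \<cdot>\<^bsub>P0 E D\<^esub> NC (P2 E \<alpha>) X = u \<and> NC (P2 W \<alpha>) B \<cdot>\<^bsub>P0 W C\<^esub> v = y}"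

definition delta_id :: "('c, 'f, 't) two_cat \<Rightarrow> ('c, 'f, 't, 'eo, 'ea) cat_psf \<Rightarrow>
    ('c, 'f, 't, 'wo, 'wa) cat_psf \<Rightarrow> ('c, 'eo, 'wo) dob \<Rightarrow> ('c, 'f, 'eo, 'ea, 'wo, 'wa) dar" where
  "delta_id K E W = (\<lambda>(C, X, Y). ((C, X, Y), (Id1 K C, Idt (P0 E C) X, Idt (P0 W C) Y), (C, X, Y)))"

text \<open>As for all compositions, the second arrow comes first: \<open>(g, x, y)\<close> after \<open>(f, u, v)\<close>.\<close>

definition delta_comp :: "('c, 'f, 't) two_cat \<Rightarrow> ('c, 'f, 't, 'eo, 'ea) cat_psf \<Rightarrow>
    ('c, 'f, 't, 'wo, 'wa) cat_psf \<Rightarrow> ('c, 'f, 'eo, 'ea, 'wo, 'wa) dar \<Rightarrow>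
    ('c, 'f, 'eo, 'ea, 'wo, 'wa) dar \<Rightarrow> ('c, 'f, 'eo, 'ea, 'wo, 'wa) dar" where
  "delta_comp K E W = (\<lambda>(_, (g, x, y), (D', A', B')) ((C, X, Y), (f, u, v), _).
     ((C, X, Y),
      (g \<odot>\<^bsub>K\<^esub> f,
       x \<cdot>\<^bsub>P0 E D'\<^esub> (FAr (P1 E g) u \<cdot>\<^bsub>P0 E D'\<^esub> Inv (P0 E D') (NC (PC E g f) X)),
       NC (PC W f g) B' \<cdot>\<^bsub>P0 W C\<^esub> (FAr (P1 W f) y \<cdot>\<^bsub>P0 W C\<^esub> v)),
      (D', A', B')))"

definition Delta :: "('c, 'f, 't) two_cat \<Rightarrow> ('c, 'f, 't, 'eo, 'ea) cat_psf \<Rightarrow>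
    ('c, 'f, 't, 'wo, 'wa) cat_psf \<Rightarrow>
    (('c, 'eo, 'wo) dob, ('c, 'f, 'eo, 'ea, 'wo, 'wa) dar, ('c, 'f, 't, 'eo, 'ea, 'wo, 'wa) dcell) two_cat" where
  "Delta K E W =
     \<lparr>Ob0 = delta_ob K E W,
      Ar1 = delta_ar K E W, Dom1 = fst, Cod1 = (\<lambda>a. snd (snd a)),
      Id1 = delta_id K E W, Comp1 = delta_comp K E W,
      Ar2 = delta_cell K E W, Dom2 = fst, Cod2 = (\<lambda>a. snd (snd a)),
      Id2 = (\<lambda>a. case a of (_, (f, _, _), _) \<Rightarrow> (a, Id2 K f, a)),
      VComp = (\<lambda>(_, \<beta>, c) (a, \<alpha>, _). (a, \<beta> \<bullet>\<^bsub>K\<^esub> \<alpha>, c)),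
      HComp = (\<lambda>(b, \<beta>, b') (a, \<alpha>, a'). (delta_comp K E W b a, \<beta> \<star>\<^bsub>K\<^esub> \<alpha>, delta_comp K E W b' a'))\<rparr>"

definition cartesian :: "('c, 'f, 't) two_cat \<Rightarrow> ('c, 'f, 't, 'eo, 'ea) cat_psf \<Rightarrow>
    ('c, 'f, 't, 'wo, 'wa) cat_psf \<Rightarrow> ('c, 'f, 'eo, 'ea, 'wo, 'wa) dar \<Rightarrow> bool" where
  "cartesian K E W = (\<lambda>((C, X, Y), (f, u, v), (D, A, B)).
     ((C, X, Y), (f, u, v), (D, A, B)) \<in> delta_ar K E W \<and>
     invertible (P0 E D) u \<and> invertible (P0 W C) v)"

definition Sigma_cart :: "('c, 'f, 't) two_cat \<Rightarrow> ('c, 'f, 't, 'eo, 'ea) cat_psf \<Rightarrow>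
    ('c, 'f, 't, 'wo, 'wa) cat_psf \<Rightarrow> ('c, 'f, 'eo, 'ea, 'wo, 'wa) dar set set" where
  "Sigma_cart K E W = component (Delta K E W) ` {a. cartesian K E W a}"

type_synonym ('c, 'f, 'eo, 'ea, 'wo, 'wa) sar =
  "(('c, 'eo, 'wo) dob \<times> ('c, 'f, 'eo, 'ea, 'wo, 'wa) dar set zig list \<times> ('c, 'eo, 'wo) dob) set"

definition Star :: "('c, 'f, 't) two_cat \<Rightarrow> ('c, 'f, 't, 'eo, 'ea) cat_psf \<Rightarrow>
    ('c, 'f, 't, 'wo, 'wa) cat_psf \<Rightarrow> (('c, 'eo, 'wo) dob, ('c, 'f, 'eo, 'ea, 'wo, 'wa) sar) cat" where
  "Star K E W = fractions (pi0 (Delta K E W)) (Sigma_cart K E W)"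

definition star_ar :: "('c, 'f, 't) two_cat \<Rightarrow> ('c, 'f, 't, 'eo, 'ea) cat_psf \<Rightarrow>
    ('c, 'f, 't, 'wo, 'wa) cat_psf \<Rightarrow> ('c, 'f, 'eo, 'ea, 'wo, 'wa) dar \<Rightarrow>
    ('c, 'f, 'eo, 'ea, 'wo, 'wa) sar" where
  "star_ar K E W a = to_fractions (pi0 (Delta K E W)) (Sigma_cart K E W) (component (Delta K E W) a)"


section \<open>The functors \<open>\<Phi>\<close> and \<open>\<Psi>\<close>\<close>

text \<open>\<open>phi_fun\<close> is the functor \<open>\<Phi>(F)\<^sub>C(Y) : E C \<rightarrow> X\<close>, and \<open>phi_comp\<close> is \<open>\<Phi>(F)\<^sub>C\<close>.\<close>

definition phi_fun :: "('c, 'f, 't) two_cat \<Rightarrow> ('c, 'f, 't, 'eo, 'ea) cat_psf \<Rightarrow>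
    ('c, 'f, 't, 'wo, 'wa) cat_psf \<Rightarrow>
    (('c, 'eo, 'wo) dob, ('c, 'f, 'eo, 'ea, 'wo, 'wa) sar, 'x, 'y) fnct \<Rightarrow> 'c \<Rightarrow> 'wo \<Rightarrow>
    ('eo, 'ea, 'x, 'y) fnct" where
  "phi_fun K E W F C Y =
     \<lparr>FDom = P0 E C, FCod = FCod F,
      FOb = (\<lambda>X\<in>Ob (P0 E C). FOb F (C, X, Y)),
      FAr = (\<lambda>u\<in>Ar (P0 E C). FAr F (star_ar K E W
               ((C, Src (P0 E C) u, Y), (Id1 K C, u, Idt (P0 W C) Y), (C, Tgt (P0 E C) u, Y))))\<rparr>"

definition phi_comp :: "('c, 'f, 't) two_cat \<Rightarrow> ('c, 'f, 't, 'eo, 'ea) cat_psf \<Rightarrow>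
    ('c, 'f, 't, 'wo, 'wa) cat_psf \<Rightarrow>
    (('c, 'eo, 'wo) dob, ('c, 'f, 'eo, 'ea, 'wo, 'wa) sar, 'x, 'y) fnct \<Rightarrow> 'c \<Rightarrow>
    ('wo, 'wa, ('eo, 'ea, 'x, 'y) fnct, ('eo, 'ea, 'x, 'y) nt) fnct" where
  "phi_comp K E W F C =
     \<lparr>FDom = P0 W C, FCod = FunCat (P0 E C) (FCod F),
      FOb = (\<lambda>Y\<in>Ob (P0 W C). phi_fun K E W F C Y),
      FAr = (\<lambda>v\<in>Ar (P0 W C).
               \<lparr>NDom = phi_fun K E W F C (Src (P0 W C) v),
                NCod = phi_fun K E W F C (Tgt (P0 W C) v),
                NC = (\<lambda>X\<in>Ob (P0 E C). FAr F (star_ar K E W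
                       ((C, X, Src (P0 W C) v), (Id1 K C, Idt (P0 E C) X, v), (C, X, Tgt (P0 W C) v))))\<rparr>)\<rparr>"

definition phi_cell :: "('c, 'f, 't) two_cat \<Rightarrow> ('c, 'f, 't, 'eo, 'ea) cat_psf \<Rightarrow>
    ('c, 'f, 't, 'wo, 'wa) cat_psf \<Rightarrow>
    (('c, 'eo, 'wo) dob, ('c, 'f, 'eo, 'ea, 'wo, 'wa) sar, 'x, 'y) fnct \<Rightarrow> 'f \<Rightarrow>
    ('wo, 'wa, ('eo, 'ea, 'x, 'y) fnct, ('eo, 'ea, 'x, 'y) nt) nt" where
  "phi_cell K E W F f =
     (let C = Dom1 K f; D = Cod1 K f;
          S = phi_comp K E W F C \<circ>\<^sub>F P1 W f;
          T = precomp (FCod F) (P1 E f) \<circ>\<^sub>F phi_comp K E W F D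
      in \<lparr>NDom = S, NCod = T,
          NC = (\<lambda>Y\<in>Ob (P0 W D).
                  \<lparr>NDom = FOb S Y, NCod = FOb T Y,
                   NC = (\<lambda>X\<in>Ob (P0 E C). FAr F (star_ar K E W
                          ((C, X, FOb (P1 W f) Y),
                           (f, Idt (P0 E D) (FOb (P1 E f) X), Idt (P0 W C) (FOb (P1 W f) Y)),
                           (D, FOb (P1 E f) X, Y))))\<rparr>)\<rparr>)"

definition phi_ob :: "('c, 'f, 't) two_cat \<Rightarrow> ('c, 'f, 't, 'eo, 'ea) cat_psf \<Rightarrow>
    ('c, 'f, 't, 'wo, 'wa) cat_psf \<Rightarrow>
    (('c, 'eo, 'wo) dob, ('c, 'f, 'eo, 'ea, 'wo, 'wa) sar, 'x, 'y) fnct \<Rightarrow>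
    ('c, 'f, 'wo, 'wa, ('eo, 'ea, 'x, 'y) fnct, ('eo, 'ea, 'x, 'y) nt) pnat" where
  "phi_ob K E W F = \<lparr>TOb = (\<lambda>C\<in>Ob0 K. phi_comp K E W F C), TCell = (\<lambda>f\<in>Ar1 K. phi_cell K E W F f)\<rparr>"

definition phi_ar :: "('c, 'f, 't) two_cat \<Rightarrow> ('c, 'f, 't, 'eo, 'ea) cat_psf \<Rightarrow>
    ('c, 'f, 't, 'wo, 'wa) cat_psf \<Rightarrow>
    (('c, 'eo, 'wo) dob, ('c, 'f, 'eo, 'ea, 'wo, 'wa) sar, 'x, 'y) nt \<Rightarrow>
    ('c, 'f, 'wo, 'wa, ('eo, 'ea, 'x, 'y) fnct, ('eo, 'ea, 'x, 'y) nt) modif" where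
  "phi_ar K E W \<alpha> =
     \<lparr>MDom = phi_ob K E W (NDom \<alpha>), MCod = phi_ob K E W (NCod \<alpha>),
      MC = (\<lambda>C\<in>Ob0 K.
              \<lparr>NDom = phi_comp K E W (NDom \<alpha>) C, NCod = phi_comp K E W (NCod \<alpha>) C,
               NC = (\<lambda>Y\<in>Ob (P0 W C).
                       \<lparr>NDom = phi_fun K E W (NDom \<alpha>) C Y, NCod = phi_fun K E W (NCod \<alpha>) C Y,
                        NC = (\<lambda>X\<in>Ob (P0 E C). NC \<alpha> (C, X, Y))\<rparr>)\<rparr>)\<rparr>"

definition Phi :: "('c, 'f, 't) two_cat \<Rightarrow> ('c, 'f, 't, 'eo, 'ea) cat_psf \<Rightarrow>
    ('c, 'f, 't, 'wo, 'wa) cat_psf \<Rightarrow> ('x, 'y) cat \<Rightarrow>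
    ((('c, 'eo, 'wo) dob, ('c, 'f, 'eo, 'ea, 'wo, 'wa) sar, 'x, 'y) fnct,
     (('c, 'eo, 'wo) dob, ('c, 'f, 'eo, 'ea, 'wo, 'wa) sar, 'x, 'y) nt,
     ('c, 'f, 'wo, 'wa, ('eo, 'ea, 'x, 'y) fnct, ('eo, 'ea, 'x, 'y) nt) pnat,
     ('c, 'f, 'wo, 'wa, ('eo, 'ea, 'x, 'y) fnct, ('eo, 'ea, 'x, 'y) nt) modif) fnct" where
  "Phi K E W X =
     \<lparr>FDom = FunCat (Star K E W) X,
      FCod = PsHom (op1 K) W (CatInto E X),
      FOb = (\<lambda>F\<in>Ob (FunCat (Star K E W) X). phi_ob K E W F),
      FAr = (\<lambda>\<alpha>\<in>Ar (FunCat (Star K E W) X). phi_ar K E W \<alpha>)\<rparr>"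

definition psi_gen_ob :: "('c, 'f, 'wo, 'wa, ('eo, 'ea, 'x, 'y) fnct, ('eo, 'ea, 'x, 'y) nt) pnat \<Rightarrow>
    ('c, 'eo, 'wo) dob \<Rightarrow> 'x" where
  "psi_gen_ob \<theta> = (\<lambda>(C, X, Y). FOb (FOb (TOb \<theta> C) Y) X)"

definition psi_gen_ar :: "('x, 'y) cat \<Rightarrow>
    ('c, 'f, 'wo, 'wa, ('eo, 'ea, 'x, 'y) fnct, ('eo, 'ea, 'x, 'y) nt) pnat \<Rightarrow>
    ('c, 'f, 'eo, 'ea, 'wo, 'wa) dar \<Rightarrow> 'y" where
  "psi_gen_ar \<X> \<theta> = (\<lambda>((C, X, Y), (f, u, v), (D, U, V)).
     FAr (FOb (TOb \<theta> D) V) u \<cdot>\<^bsub>\<X>\<^esub> (NC (NC (TCell \<theta> f) V) X \<cdot>\<^bsub>\<X>\<^esub> NC (FAr (TOb \<theta> C) v) X))"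

text \<open>
  The functor on \<open>E \<star> W\<close> induced by these assignments, i.e. the unique one restricting to them along
  the canonical map from the 2-category of triples.
\<close>

definition psi_ob :: "('c, 'f, 't) two_cat \<Rightarrow> ('c, 'f, 't, 'eo, 'ea) cat_psf \<Rightarrow>
    ('c, 'f, 't, 'wo, 'wa) cat_psf \<Rightarrow> ('x, 'y) cat \<Rightarrow>
    ('c, 'f, 'wo, 'wa, ('eo, 'ea, 'x, 'y) fnct, ('eo, 'ea, 'x, 'y) nt) pnat \<Rightarrow>
    (('c, 'eo, 'wo) dob, ('c, 'f, 'eo, 'ea, 'wo, 'wa) sar, 'x, 'y) fnct" where
  "psi_ob K E W X \<theta> = (THE H. H \<in> Functors (Star K E W) X \<and>
     (\<forall>P \<in> delta_ob K E W. FOb H P = psi_gen_ob \<theta> P) \<and>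
     (\<forall>a \<in> delta_ar K E W. FAr H (star_ar K E W a) = psi_gen_ar X \<theta> a))"

definition psi_ar :: "('c, 'f, 't) two_cat \<Rightarrow> ('c, 'f, 't, 'eo, 'ea) cat_psf \<Rightarrow>
    ('c, 'f, 't, 'wo, 'wa) cat_psf \<Rightarrow> ('x, 'y) cat \<Rightarrow>
    ('c, 'f, 'wo, 'wa, ('eo, 'ea, 'x, 'y) fnct, ('eo, 'ea, 'x, 'y) nt) modif \<Rightarrow>
    (('c, 'eo, 'wo) dob, ('c, 'f, 'eo, 'ea, 'wo, 'wa) sar, 'x, 'y) nt" where
  "psi_ar K E W X m =
     \<lparr>NDom = psi_ob K E W X (MDom m), NCod = psi_ob K E W X (MCod m),
      NC = (\<lambda>(C, X, Y)\<in>delta_ob K E W. NC (NC (MC m C) Y) X)\<rparr>"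

definition Psi :: "('c, 'f, 't) two_cat \<Rightarrow> ('c, 'f, 't, 'eo, 'ea) cat_psf \<Rightarrow>
    ('c, 'f, 't, 'wo, 'wa) cat_psf \<Rightarrow> ('x, 'y) cat \<Rightarrow>
    (('c, 'f, 'wo, 'wa, ('eo, 'ea, 'x, 'y) fnct, ('eo, 'ea, 'x, 'y) nt) pnat,
     ('c, 'f, 'wo, 'wa, ('eo, 'ea, 'x, 'y) fnct, ('eo, 'ea, 'x, 'y) nt) modif,
     (('c, 'eo, 'wo) dob, ('c, 'f, 'eo, 'ea, 'wo, 'wa) sar, 'x, 'y) fnct,
     (('c, 'eo, 'wo) dob, ('c, 'f, 'eo, 'ea, 'wo, 'wa) sar, 'x, 'y) nt) fnct" where
  "Psi K E W X =
     \<lparr>FDom = PsHom (op1 K) W (CatInto E X),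
      FCod = FunCat (Star K E W) X,
      FOb = (\<lambda>\<theta>\<in>Ob (PsHom (op1 K) W (CatInto E X)). psi_ob K E W X \<theta>),
      FAr = (\<lambda>m\<in>Ar (PsHom (op1 K) W (CatInto E X)). psi_ar K E W X m)\<rparr>"

text \<open>The pseudo-natural transformation \<open>W \<rightarrow> Cat(E, E \<star> W)\<close> corresponding to the identity functor.\<close>

definition star_cocone :: "('c, 'f, 't) two_cat \<Rightarrow> ('c, 'f, 't, 'eo, 'ea) cat_psf \<Rightarrow>
    ('c, 'f, 't, 'wo, 'wa) cat_psf \<Rightarrow>
    ('c, 'f, 'wo, 'wa, ('eo, 'ea, ('c, 'eo, 'wo) dob, ('c, 'f, 'eo, 'ea, 'wo, 'wa) sar) fnct,
     ('eo, 'ea, ('c, 'eo, 'wo) dob, ('c, 'f, 'eo, 'ea, 'wo, 'wa) sar) nt) pnat" where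
  "star_cocone K E W = phi_ob K E W (id_functor (Star K E W))"

end

theory Submission
  imports Defs
begin

text \<open>
  Every arrow of \<open>\<Delta>(E, W)\<close> factors as \<open>(f, u, v) = (1, u, 1) \<circ> (f, 1, 1) \<circ> (1, 1, v)\<close> (\<open>delta_ar_factor\<close>). A
  functor \<open>F : E \<star> W \<rightarrow> \<X>\<close> is therefore determined by its values on these three kinds of generators, and
  such values are precisely the data of a pseudo-natural transformation \<open>\<theta> : W \<rightarrow> Cat(E, \<X>)\<close>: the
  generators \<open>(1, u, 1)\<close> give the functors \<open>\<theta>\<^sub>C(Y)\<close>, the generators \<open>(1, 1, v)\<close> the action of \<open>\<theta>\<^sub>C\<close> on arrows, and
  the generators \<open>(f, 1, 1)\<close> the coherence cells. Moreover the relations match. That the generators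
  \<open>(f, 1, 1)\<close> commute with the others corresponds to naturality of coherence cells (\<open>base_arrow_E_arrow\<close>,
  \<open>base_arrow_W_arrow\<close>), their composition law to the composition axiom (\<open>base_arrow_comp\<close>), passing to
  connected components to compatibility with 2-cells (\<open>base_arrow_cell\<close>), and inverting the cartesian
  arrows to invertibility of the coherence cells (\<open>base_arrow_cartesian\<close>).

  In one direction this shows that \<open>\<Phi>(F)\<close> is pseudo-natural (\<open>phi_pnat\<close>). In the other, the axioms of \<open>\<theta>\<close>
  make the formula defining \<open>\<Psi>(\<theta>)\<close> respect composition, 2-cells and cartesian arrows (\<open>psi_gen_comp\<close>,
  \<open>psi_gen_cell\<close>, \<open>psi_gen_invertible\<close>), so the universal properties of \<open>pi0\<close> and of categories of fractions
  yield a unique functor on \<open>E \<star> W\<close> (\<open>Star_functor_exists\<close>, \<open>Star_functor_eqI\<close>). The two constructions undo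
  each other by the factorization (\<open>psi_phi\<close>, \<open>phi_psi\<close>), and likewise on natural transformations and
  modifications (\<open>psi_phi_ar\<close>, \<open>phi_psi_ar\<close>).

  The axioms of pseudo-natural transformations are equations between natural transformations whose
  values are natural transformations. They are handled by translating them once and for all into
  equations between arrows of \<open>\<X>\<close> (\<open>is_pnat_iff\<close>, \<open>is_modif_iff\<close>).

  For the pseudo-colimit, the functor induced by the universal transformation \<open>W \<rightarrow> Cat(E, E \<star> W)\<close> is \<open>\<Phi>\<close>
  itself (\<open>induced_eq_Phi\<close>), and \<open>\<Phi>\<close> has been shown to be invertible.
\<close>

section \<open>Categories, functors and natural transformations\<close>

lemma Hom_iff: "f \<in> Hom A a b \<longleftrightarrow> f \<in> Ar A \<and> Src A f = a \<and> Tgt A f = b"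
  by (auto simp: Hom_def)

text \<open>
  Typing of composites is expressed by equations between sources and targets instead of membership
  in \<open>Hom\<close>: the conditions of the following rules then contain no variable that is absent from the
  conclusion, and the simplifier discharges them.
\<close>

context category
begin

lemma Src_Ob: "f \<in> Ar A \<Longrightarrow> Src A f \<in> Ob A"
  and Tgt_Ob: "f \<in> Ar A \<Longrightarrow> Tgt A f \<in> Ob A"
  using ends by auto

lemma Idt_Ar: "a \<in> Ob A \<Longrightarrow> Idt A a \<in> Ar A"
  and Src_Idt: "a \<in> Ob A \<Longrightarrow> Src A (Idt A a) = a"
  and Tgt_Idt: "a \<in> Ob A \<Longrightarrow> Tgt A (Idt A a) = a"
  using idt by (auto simp: Hom_iff)

lemma cmp_Ar: "f \<in> Ar A \<Longrightarrow> g \<in> Ar A \<Longrightarrow> Src A g = Tgt A f \<Longrightarrow> g \<cdot>\<^bsub>A\<^esub> f \<in> Ar A"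
  and Src_cmp: "f \<in> Ar A \<Longrightarrow> g \<in> Ar A \<Longrightarrow> Src A g = Tgt A f \<Longrightarrow> Src A (g \<cdot>\<^bsub>A\<^esub> f) = Src A f"
  and Tgt_cmp: "f \<in> Ar A \<Longrightarrow> g \<in> Ar A \<Longrightarrow> Src A g = Tgt A f \<Longrightarrow> Tgt A (g \<cdot>\<^bsub>A\<^esub> f) = Tgt A g"
  using cmp[of f "Src A f" "Tgt A f" g "Tgt A g"] by (auto simp: Hom_iff)

lemma cmp_assoc: "f \<in> Ar A \<Longrightarrow> g \<in> Ar A \<Longrightarrow> h \<in> Ar A \<Longrightarrow> Src A g = Tgt A f \<Longrightarrow> Src A h = Tgt A g \<Longrightarrow>
    (h \<cdot>\<^bsub>A\<^esub> g) \<cdot>\<^bsub>A\<^esub> f = h \<cdot>\<^bsub>A\<^esub> (g \<cdot>\<^bsub>A\<^esub> f)"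
  using assoc[of f "Src A f" "Tgt A f" g "Tgt A g" h "Tgt A h"] by (auto simp: Hom_iff)

lemma Idt_cmp: "f \<in> Ar A \<Longrightarrow> Tgt A f = a \<Longrightarrow> Idt A a \<cdot>\<^bsub>A\<^esub> f = f"
  and cmp_Idt: "f \<in> Ar A \<Longrightarrow> Src A f = a \<Longrightarrow> f \<cdot>\<^bsub>A\<^esub> Idt A a = f"
  using idt_left[of f "Src A f" "Tgt A f"] idt_right[of f "Src A f" "Tgt A f"] by (auto simp: Hom_iff)

end

lemmas category_simps = category.Src_Ob category.Tgt_Ob category.Idt_Ar category.Src_Idt
  category.Tgt_Idt category.cmp_Ar category.Src_cmp category.Tgt_cmp category.cmp_assoc
  category.Idt_cmp category.cmp_Idt

lemma categoryI:
  assumes "\<And>f. f \<in> Ar A \<Longrightarrow> Src A f \<in> Ob A" "\<And>f. f \<in> Ar A \<Longrightarrow> Tgt A f \<in> Ob A"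
    and "\<And>a. a \<in> Ob A \<Longrightarrow> Idt A a \<in> Ar A" "\<And>a. a \<in> Ob A \<Longrightarrow> Src A (Idt A a) = a"
    "\<And>a. a \<in> Ob A \<Longrightarrow> Tgt A (Idt A a) = a"
    and "\<And>f g. f \<in> Ar A \<Longrightarrow> g \<in> Ar A \<Longrightarrow> Src A g = Tgt A f \<Longrightarrow>
      g \<cdot>\<^bsub>A\<^esub> f \<in> Ar A \<and> Src A (g \<cdot>\<^bsub>A\<^esub> f) = Src A f \<and> Tgt A (g \<cdot>\<^bsub>A\<^esub> f) = Tgt A g"
    and "\<And>f. f \<in> Ar A \<Longrightarrow> f \<cdot>\<^bsub>A\<^esub> Idt A (Src A f) = f" "\<And>f. f \<in> Ar A \<Longrightarrow> Idt A (Tgt A f) \<cdot>\<^bsub>A\<^esub> f = f"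
    and "\<And>f g h. f \<in> Ar A \<Longrightarrow> g \<in> Ar A \<Longrightarrow> h \<in> Ar A \<Longrightarrow> Src A g = Tgt A f \<Longrightarrow> Src A h = Tgt A g \<Longrightarrow>
      (h \<cdot>\<^bsub>A\<^esub> g) \<cdot>\<^bsub>A\<^esub> f = h \<cdot>\<^bsub>A\<^esub> (g \<cdot>\<^bsub>A\<^esub> f)"
  shows "category A"
  using assms by unfold_locales (auto simp: Hom_iff)

lemma (in category) inverses_unique:
  assumes "inverses A f g" "inverses A f h" shows "g = h"
proof -
  have "(g \<cdot>\<^bsub>A\<^esub> f) \<cdot>\<^bsub>A\<^esub> h = g \<cdot>\<^bsub>A\<^esub> (f \<cdot>\<^bsub>A\<^esub> h)"
    by (rule cmp_assoc) (use assms in \<open>auto simp: inverses_def Hom_iff\<close>)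
  then show ?thesis using assms by (simp add: inverses_def Hom_iff Idt_cmp cmp_Idt)
qed

lemma (in category) inverses_Inv: "invertible A f \<Longrightarrow> inverses A f (Inv A f)"
  unfolding invertible_def Inv_def using inverses_unique by (blast intro: theI)

lemma (in category) Inv_eq: "inverses A f g \<Longrightarrow> Inv A f = g"
  using inverses_Inv inverses_unique unfolding invertible_def by blast

lemma (in category)
  assumes "invertible A f"
  shows Inv_Ar: "Inv A f \<in> Ar A" and Src_Inv: "Src A (Inv A f) = Tgt A f"
    and Tgt_Inv: "Tgt A (Inv A f) = Src A f"
    and Inv_cmp: "Inv A f \<cdot>\<^bsub>A\<^esub> f = Idt A (Src A f)" and cmp_Inv: "f \<cdot>\<^bsub>A\<^esub> Inv A f = Idt A (Tgt A f)"
  using inverses_Inv[OF assms] by (auto simp: inverses_def Hom_iff)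

lemmas Inv_simps = category.Inv_Ar category.Src_Inv category.Tgt_Inv category.Inv_cmp category.cmp_Inv

lemma invertible_Ar: "invertible A f \<Longrightarrow> f \<in> Ar A"
  by (auto simp: invertible_def inverses_def)

lemma (in category) inverses_Idt: "a \<in> Ob A \<Longrightarrow> inverses A (Idt A a) (Idt A a)"
  by (simp add: inverses_def Hom_iff category_simps[OF category_axioms])

lemma (in category) invertible_Idt: "a \<in> Ob A \<Longrightarrow> invertible A (Idt A a)"
  unfolding invertible_def using inverses_Idt by blast

lemma (in category) Inv_Idt: "a \<in> Ob A \<Longrightarrow> Inv A (Idt A a) = Idt A a"
  using inverses_Idt Inv_eq by blast

lemma (in category) inverses_cmp:
  assumes "inverses A f f'" "inverses A g g'" "Src A g = Tgt A f"
  shows "inverses A (g \<cdot>\<^bsub>A\<^esub> f) (f' \<cdot>\<^bsub>A\<^esub> g')"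
proof -
  have f: "f \<in> Ar A" "f' \<in> Ar A" "Src A f' = Tgt A f" "Tgt A f' = Src A f"
    "f' \<cdot>\<^bsub>A\<^esub> f = Idt A (Src A f)" "f \<cdot>\<^bsub>A\<^esub> f' = Idt A (Tgt A f)"
   and g: "g \<in> Ar A" "g' \<in> Ar A" "Src A g' = Tgt A g" "Tgt A g' = Src A g"
    "g' \<cdot>\<^bsub>A\<^esub> g = Idt A (Src A g)" "g \<cdot>\<^bsub>A\<^esub> g' = Idt A (Tgt A g)"
    using assms by (auto simp: inverses_def Hom_iff)
  note s = category_simps[OF category_axioms]
  have "g' \<cdot>\<^bsub>A\<^esub> (g \<cdot>\<^bsub>A\<^esub> f) = f" "f \<cdot>\<^bsub>A\<^esub> (f' \<cdot>\<^bsub>A\<^esub> g') = g'"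
    using cmp_assoc[of f g g'] cmp_assoc[of g' f' f] f g assms(3) by (simp_all add: s)
  then show ?thesis using f g assms(3) by (simp add: inverses_def Hom_iff s)
qed

lemma (in category) invertible_cmp:
  "invertible A f \<Longrightarrow> invertible A g \<Longrightarrow> Src A g = Tgt A f \<Longrightarrow> invertible A (g \<cdot>\<^bsub>A\<^esub> f)"
  unfolding invertible_def using inverses_cmp by blast

text \<open>
  Inverting two opposite sides of a commuting square gives a commuting square. The composition of
  \<open>\<Delta>(E, W)\<close> involves inverses of comparison cells of \<open>E\<close>, and this is how their coherence follows
  from the coherence of the cells themselves.
\<close>

lemma (in category) Inv_square:
  assumes "b \<cdot>\<^bsub>A\<^esub> t = s \<cdot>\<^bsub>A\<^esub> a" and ab: "invertible A a" "invertible A b"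
    and t: "t \<in> Ar A" "s \<in> Ar A" "Src A b = Tgt A t" "Src A s = Tgt A a"
  shows "Inv A b \<cdot>\<^bsub>A\<^esub> s = t \<cdot>\<^bsub>A\<^esub> Inv A a"
proof -
  note i = ab[THEN invertible_Ar] ab[THEN Inv_Ar] ab[THEN Src_Inv] ab[THEN Tgt_Inv]
    ab[THEN Inv_cmp] ab[THEN cmp_Inv]
  note c = category_simps[OF category_axioms]
  have src: "Src A t = Src A a" "Tgt A s = Tgt A b" using assms(1) t i Src_cmp Tgt_cmp by metis+
  have "Inv A b \<cdot>\<^bsub>A\<^esub> s = Inv A b \<cdot>\<^bsub>A\<^esub> ((s \<cdot>\<^bsub>A\<^esub> a) \<cdot>\<^bsub>A\<^esub> Inv A a)"
    using t i src by (simp add: c)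
  also have "\<dots> = (Inv A b \<cdot>\<^bsub>A\<^esub> b) \<cdot>\<^bsub>A\<^esub> (t \<cdot>\<^bsub>A\<^esub> Inv A a)"
    using t i(1-8) src unfolding assms(1)[symmetric] by (simp add: c)
  also have "\<dots> = t \<cdot>\<^bsub>A\<^esub> Inv A a" using t i src by (simp add: c)
  finally show ?thesis .
qed

lemma (in category) Inv_of_cmp:
  assumes "invertible A f" "invertible A g" "Src A g = Tgt A f"
  shows "Inv A (g \<cdot>\<^bsub>A\<^esub> f) = Inv A f \<cdot>\<^bsub>A\<^esub> Inv A g"
  using assms inverses_Inv inverses_cmp Inv_eq by blast

text \<open>
  The simplifier nests composites to the right, where an equation between two-fold composites only
  matches at the end of a chain; here it is in the form that applies anywhere in the chain.
\<close>

lemma (in category) extend_square: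
  assumes "g \<cdot>\<^bsub>A\<^esub> f = g' \<cdot>\<^bsub>A\<^esub> f'"
    and "f \<in> Ar A" "g \<in> Ar A" "Src A g = Tgt A f" "f' \<in> Ar A" "g' \<in> Ar A" "Src A g' = Tgt A f'"
    and "k \<in> Ar A" "Tgt A k = Src A f"
  shows "g \<cdot>\<^bsub>A\<^esub> (f \<cdot>\<^bsub>A\<^esub> k) = g' \<cdot>\<^bsub>A\<^esub> (f' \<cdot>\<^bsub>A\<^esub> k)"
proof -
  have "Src A f = Src A f'" using assms(1-7) by (metis Src_cmp)
  then show ?thesis using assms cmp_assoc[of k f g] cmp_assoc[of k f' g'] by simp
qed

text \<open>Rules about a functor mention its source category only as \<open>FDom F\<close>, so that every variable of
  a premise occurs in the conclusion and the simplifier can discharge the typing conditions.\<close>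

context is_functor
begin

lemma FOb_Ob: "FCod F = B \<Longrightarrow> a \<in> Ob (FDom F) \<Longrightarrow> FOb F a \<in> Ob B"
  using ob by auto

lemma FAr_Ar: "FCod F = B \<Longrightarrow> f \<in> Ar (FDom F) \<Longrightarrow> FAr F f \<in> Ar B"
  and Src_FAr: "FCod F = B \<Longrightarrow> f \<in> Ar (FDom F) \<Longrightarrow> Src B (FAr F f) = FOb F (Src (FDom F) f)"
  and Tgt_FAr: "FCod F = B \<Longrightarrow> f \<in> Ar (FDom F) \<Longrightarrow> Tgt B (FAr F f) = FOb F (Tgt (FDom F) f)"
  using ar[of f "Src (FDom F) f" "Tgt (FDom F) f"] by (auto simp: Hom_iff)

lemma FAr_Idt: "FDom F = A \<Longrightarrow> a \<in> Ob A \<Longrightarrow> FAr F (Idt A a) = Idt (FCod F) (FOb F a)"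
  using idt by auto

lemma FAr_cmp: "FDom F = A \<Longrightarrow> f \<in> Ar A \<Longrightarrow> g \<in> Ar A \<Longrightarrow> Src A g = Tgt A f \<Longrightarrow>
    FAr F (g \<cdot>\<^bsub>A\<^esub> f) = FAr F g \<cdot>\<^bsub>FCod F\<^esub> FAr F f"
  using cmp[of f "Src (FDom F) f" "Tgt (FDom F) f" g "Tgt (FDom F) g"] by (auto simp: Hom_iff)

lemma FOb_ext: "FOb F \<in> extensional (Ob (FDom F))"
  using ob by (simp add: PiE_def)

lemma FAr_inverses: "inverses (FDom F) f g \<Longrightarrow> inverses (FCod F) (FAr F f) (FAr F g)"
  using FAr_cmp[OF refl, of f g] FAr_cmp[OF refl, of g f] dom cod
  by (auto simp: inverses_def Hom_iff FAr_Ar Src_FAr Tgt_FAr FAr_Idt category_simps)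

lemma FAr_invertible: "invertible (FDom F) f \<Longrightarrow> invertible (FCod F) (FAr F f)"
  unfolding invertible_def using FAr_inverses by blast

lemma FAr_Inv: "FDom F = A \<Longrightarrow> invertible A f \<Longrightarrow> FAr F (Inv A f) = Inv (FCod F) (FAr F f)"
  using category.Inv_eq[OF cod FAr_inverses] category.inverses_Inv[OF dom] by metis

end

lemmas functor_simps = is_functor.dom is_functor.cod is_functor.FOb_Ob is_functor.FAr_Ar
  is_functor.Src_FAr is_functor.Tgt_FAr is_functor.FAr_Idt is_functor.FAr_cmp

lemma Functors_iff: "F \<in> Functors A B \<longleftrightarrow> is_functor F \<and> FDom F = A \<and> FCod F = B"
  by (simp add: Functors_def)

lemma is_functorI:
  assumes "FDom F = A" "FCod F = B" "category A" "category B"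
    and "FOb F \<in> extensional (Ob A)" "FAr F \<in> extensional (Ar A)"
    and "\<And>a. a \<in> Ob A \<Longrightarrow> FOb F a \<in> Ob B"
    and "\<And>f. f \<in> Ar A \<Longrightarrow> FAr F f \<in> Ar B \<and> Src B (FAr F f) = FOb F (Src A f) \<and> Tgt B (FAr F f) = FOb F (Tgt A f)"
    and "\<And>a. a \<in> Ob A \<Longrightarrow> FAr F (Idt A a) = Idt B (FOb F a)"
    and "\<And>f g. f \<in> Ar A \<Longrightarrow> g \<in> Ar A \<Longrightarrow> Src A g = Tgt A f \<Longrightarrow>
       FAr F (g \<cdot>\<^bsub>A\<^esub> f) = FAr F g \<cdot>\<^bsub>B\<^esub> FAr F f"
  shows "is_functor F"
  using assms by (intro is_functor.intro) (auto simp: Hom_iff PiE_def)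

lemma functor_eqI:
  fixes F G :: "('o, 'a, 'p, 'b) fnct"
  assumes "is_functor F" "is_functor G" "FDom F = FDom G" "FCod F = FCod G"
    and "\<And>a. a \<in> Ob (FDom G) \<Longrightarrow> FOb F a = FOb G a" "\<And>f. f \<in> Ar (FDom G) \<Longrightarrow> FAr F f = FAr G f"
  shows "F = G"
proof -
  have "FOb F = FOb G" "FAr F = FAr G"
    using assms is_functor.FOb_ext[of F] is_functor.FOb_ext[of G] is_functor.ar_ext[of F] is_functor.ar_ext[of G]
    by (metis extensionalityI)+
  then show ?thesis using assms(3,4) by simp
qed

lemma fcomp_sel [simp]: "FDom (G \<circ>\<^sub>F F) = FDom F" "FCod (G \<circ>\<^sub>F F) = FCod G"
  "a \<in> Ob (FDom F) \<Longrightarrow> FOb (G \<circ>\<^sub>F F) a = FOb G (FOb F a)"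
  "f \<in> Ar (FDom F) \<Longrightarrow> FAr (G \<circ>\<^sub>F F) f = FAr G (FAr F f)"
  by (auto simp: fcomp_def)

lemma is_functor_fcomp:
  assumes "is_functor F" "is_functor G" "FDom G = FCod F" shows "is_functor (G \<circ>\<^sub>F F)"
  using assms by (intro is_functorI[OF refl refl])
    (auto simp: functor_simps category_simps, auto simp: fcomp_def)

lemma id_functor_sel [simp]: "FDom (id_functor A) = A" "FCod (id_functor A) = A"
  "a \<in> Ob A \<Longrightarrow> FOb (id_functor A) a = a" "f \<in> Ar A \<Longrightarrow> FAr (id_functor A) f = f"
  by (auto simp: id_functor_def)

lemma is_functor_id: "category A \<Longrightarrow> is_functor (id_functor A)"
  by (intro is_functorI[OF refl refl]) (auto simp: category_simps, auto simp: id_functor_def)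

lemma fcomp_assoc:
  assumes "is_functor F" "is_functor G" "is_functor H" "FDom G = FCod F" "FDom H = FCod G"
  shows "(H \<circ>\<^sub>F G) \<circ>\<^sub>F F = H \<circ>\<^sub>F (G \<circ>\<^sub>F F)"
  using assms by (intro functor_eqI is_functor_fcomp) (auto simp: functor_simps)

lemma fcomp_id: "is_functor F \<Longrightarrow> FDom F = A \<Longrightarrow> F \<circ>\<^sub>F id_functor A = F"
  and id_fcomp: "is_functor F \<Longrightarrow> FCod F = B \<Longrightarrow> id_functor B \<circ>\<^sub>F F = F"
  by (intro functor_eqI is_functor_fcomp is_functor_id; auto simp: functor_simps)+

context is_nt
begin

lemma NC_Ar: "FCod (NDom \<alpha>) = B \<Longrightarrow> a \<in> Ob (FDom (NDom \<alpha>)) \<Longrightarrow> NC \<alpha> a \<in> Ar B"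
  and Src_NC: "FCod (NDom \<alpha>) = B \<Longrightarrow> a \<in> Ob (FDom (NDom \<alpha>)) \<Longrightarrow> Src B (NC \<alpha> a) = FOb (NDom \<alpha>) a"
  and Tgt_NC: "FCod (NDom \<alpha>) = B \<Longrightarrow> a \<in> Ob (FDom (NDom \<alpha>)) \<Longrightarrow> Tgt B (NC \<alpha> a) = FOb (NCod \<alpha>) a"
  using comp by (auto simp: Hom_iff)

lemma NC_natural: "FDom (NDom \<alpha>) = A \<Longrightarrow> FCod (NDom \<alpha>) = B \<Longrightarrow> f \<in> Ar A \<Longrightarrow> Src A f = a \<Longrightarrow> Tgt A f = b \<Longrightarrow>
   NC \<alpha> b \<cdot>\<^bsub>B\<^esub> FAr (NDom \<alpha>) f = FAr (NCod \<alpha>) f \<cdot>\<^bsub>B\<^esub> NC \<alpha> a"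
  using natural by (auto simp: Hom_iff)

end

lemmas nt_simps = is_nt.dom is_nt.cod is_nt.par_dom is_nt.par_cod is_nt.NC_Ar is_nt.Src_NC is_nt.Tgt_NC

lemma is_ntI:
  assumes "NDom \<alpha> = F" "NCod \<alpha> = G" "F \<in> Functors A B" "G \<in> Functors A B" "NC \<alpha> \<in> extensional (Ob A)"
    and "\<And>a. a \<in> Ob A \<Longrightarrow> NC \<alpha> a \<in> Ar B \<and> Src B (NC \<alpha> a) = FOb F a \<and> Tgt B (NC \<alpha> a) = FOb G a"
    and "\<And>f. f \<in> Ar A \<Longrightarrow> NC \<alpha> (Tgt A f) \<cdot>\<^bsub>B\<^esub> FAr F f = FAr G f \<cdot>\<^bsub>B\<^esub> NC \<alpha> (Src A f)"
  shows "is_nt \<alpha>"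
  using assms by (intro is_nt.intro) (auto simp: Hom_iff Functors_iff)

lemma nt_eqI:
  fixes \<alpha> \<beta> :: "('o, 'a, 'p, 'b) nt"
  assumes "is_nt \<alpha>" "is_nt \<beta>" "NDom \<alpha> = NDom \<beta>" "NCod \<alpha> = NCod \<beta>"
    and "\<And>a. a \<in> Ob (FDom (NDom \<beta>)) \<Longrightarrow> NC \<alpha> a = NC \<beta> a"
  shows "\<alpha> = \<beta>"
proof -
  have "NC \<alpha> = NC \<beta>" using assms is_nt.ext[of \<alpha>] is_nt.ext[of \<beta>] by (metis extensionalityI)
  then show ?thesis using assms(3,4) by simp
qed

lemma nt_id_sel [simp]: "NDom (nt_id F) = F" "NCod (nt_id F) = F"
  "a \<in> Ob (FDom F) \<Longrightarrow> NC (nt_id F) a = Idt (FCod F) (FOb F a)"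
  by (auto simp: nt_id_def)

lemma is_nt_id: "is_functor F \<Longrightarrow> is_nt (nt_id F)"
  by (rule is_ntI[OF _ _ _ _ _ _ _, of _ F F "FDom F" "FCod F"])
     (auto simp: Functors_iff functor_simps category_simps, auto simp: nt_id_def)

lemma nt_vcomp_sel [simp]: "NDom (\<beta> \<bullet>\<^sub>N \<alpha>) = NDom \<alpha>" "NCod (\<beta> \<bullet>\<^sub>N \<alpha>) = NCod \<beta>"
  "a \<in> Ob (FDom (NDom \<alpha>)) \<Longrightarrow> NC (\<beta> \<bullet>\<^sub>N \<alpha>) a = NC \<beta> a \<cdot>\<^bsub>FCod (NDom \<alpha>)\<^esub> NC \<alpha> a"
  by (auto simp: nt_vcomp_def)

lemma is_nt_vcomp:
  assumes a: "is_nt \<alpha>" and b: "is_nt \<beta>" and ab: "NDom \<beta> = NCod \<alpha>"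
  shows "is_nt (\<beta> \<bullet>\<^sub>N \<alpha>)"
proof -
  let ?A = "FDom (NDom \<alpha>)" let ?B = "FCod (NDom \<alpha>)"
  have c: "category ?A" "category ?B" using a by (simp_all add: nt_simps functor_simps)
  note s = a b ab c nt_simps functor_simps category_simps
  show ?thesis
  proof (rule is_ntI[of _ "NDom \<alpha>" "NCod \<beta>" ?A ?B])
    fix f assume f: "f \<in> Ar ?A"
    have "NC \<beta> (Tgt ?A f) \<cdot>\<^bsub>?B\<^esub> (FAr (NCod \<alpha>) f \<cdot>\<^bsub>?B\<^esub> NC \<alpha> (Src ?A f)) =
        FAr (NCod \<beta>) f \<cdot>\<^bsub>?B\<^esub> (NC \<beta> (Src ?A f) \<cdot>\<^bsub>?B\<^esub> NC \<alpha> (Src ?A f))"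
      by (rule category.extend_square) (simp_all add: f is_nt.NC_natural[OF b, of ?A ?B f, unfolded ab] s)
    then show "NC (\<beta> \<bullet>\<^sub>N \<alpha>) (Tgt ?A f) \<cdot>\<^bsub>?B\<^esub> FAr (NDom \<alpha>) f = FAr (NCod \<beta>) f \<cdot>\<^bsub>?B\<^esub> NC (\<beta> \<bullet>\<^sub>N \<alpha>) (Src ?A f)"
      using f is_nt.NC_natural[OF a, of ?A ?B f] by (simp add: s)
  qed (auto simp: Functors_iff nt_vcomp_def s)
qed

lemma nt_vcomp_assoc:
  assumes "is_nt \<alpha>" "is_nt \<beta>" "is_nt \<gamma>" "NDom \<beta> = NCod \<alpha>" "NDom \<gamma> = NCod \<beta>"
  shows "(\<gamma> \<bullet>\<^sub>N \<beta>) \<bullet>\<^sub>N \<alpha> = \<gamma> \<bullet>\<^sub>N (\<beta> \<bullet>\<^sub>N \<alpha>)"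
  using assms by (intro nt_eqI is_nt_vcomp) (auto simp: nt_simps functor_simps category_simps)

lemma FunCat_sel [simp]: "Ob (FunCat A X) = Functors A X"
  "Src (FunCat A X) = NDom" "Tgt (FunCat A X) = NCod" "Idt (FunCat A X) = nt_id" "Cmp (FunCat A X) = nt_vcomp"
  by (simp_all add: FunCat_def)

lemma FunCat_Ar: "\<alpha> \<in> Ar (FunCat A X) \<longleftrightarrow>
    is_nt \<alpha> \<and> FDom (NDom \<alpha>) = A \<and> FCod (NDom \<alpha>) = X"
  by (auto simp: FunCat_def Functors_iff nt_simps)

text \<open>
  Functors and natural transformations carry the categories they live on, so \<open>Functors A X\<close> is empty
  unless \<open>A\<close> and \<open>X\<close> are categories, and the empty category is a category.
\<close>

lemma category_FunCat: "category (FunCat A X)"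
proof (rule categoryI)
  fix f assume f: "f \<in> Ar (FunCat A X)"
  show "f \<cdot>\<^bsub>FunCat A X\<^esub> Idt (FunCat A X) (Src (FunCat A X) f) = f"
    "Idt (FunCat A X) (Tgt (FunCat A X) f) \<cdot>\<^bsub>FunCat A X\<^esub> f = f"
    using f by (auto simp: FunCat_Ar nt_simps functor_simps category_simps intro!: nt_eqI is_nt_vcomp is_nt_id)
qed (auto simp: FunCat_Ar nt_simps Functors_iff functor_simps is_nt_id is_nt_vcomp nt_vcomp_assoc)

lemma nt_vcomp_id: "is_nt \<alpha> \<Longrightarrow> NDom \<alpha> = F \<Longrightarrow> \<alpha> \<bullet>\<^sub>N nt_id F = \<alpha>"
  and nt_id_vcomp: "is_nt \<alpha> \<Longrightarrow> NCod \<alpha> = F \<Longrightarrow> nt_id F \<bullet>\<^sub>N \<alpha> = \<alpha>"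
  using category.cmp_Idt[OF category_FunCat, of \<alpha> "FDom (NDom \<alpha>)" "FCod (NDom \<alpha>)" F]
    category.Idt_cmp[OF category_FunCat, of \<alpha> "FDom (NDom \<alpha>)" "FCod (NDom \<alpha>)" F] by (simp_all add: FunCat_Ar)

lemma invertible_NC:
  assumes a: "is_nt \<alpha>" and b: "is_nt \<beta>" "NDom \<beta> = NCod \<alpha>" "NCod \<beta> = NDom \<alpha>"
    and i: "\<beta> \<bullet>\<^sub>N \<alpha> = nt_id (NDom \<alpha>)" "\<alpha> \<bullet>\<^sub>N \<beta> = nt_id (NCod \<alpha>)"
    and x: "x \<in> Ob (FDom (NDom \<alpha>))"
  shows "invertible (FCod (NDom \<alpha>)) (NC \<alpha> x)"
proof -
  have "NC (\<beta> \<bullet>\<^sub>N \<alpha>) x = NC (nt_id (NDom \<alpha>)) x" "NC (\<alpha> \<bullet>\<^sub>N \<beta>) x = NC (nt_id (NCod \<alpha>)) x"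
    using i by simp_all
  then have "inverses (FCod (NDom \<alpha>)) (NC \<alpha> x) (NC \<beta> x)"
    using a b x by (simp add: inverses_def Hom_iff nt_simps)
  then show ?thesis unfolding invertible_def by blast
qed

text \<open>
  The inverses of the components form a natural transformation, by \<open>Inv_square\<close>.
\<close>

lemma invertible_FunCat_iff:
  assumes a: "\<alpha> \<in> Ar (FunCat A X)"
  shows "invertible (FunCat A X) \<alpha> \<longleftrightarrow> (\<forall>x\<in>Ob A. invertible X (NC \<alpha> x))"
proof
  assume "invertible (FunCat A X) \<alpha>"
  then obtain \<beta> where "inverses (FunCat A X) \<alpha> \<beta>" by (auto simp: invertible_def)
  then have b: "is_nt \<beta>" "NDom \<beta> = NCod \<alpha>" "NCod \<beta> = NDom \<alpha>"
      "\<beta> \<bullet>\<^sub>N \<alpha> = nt_id (NDom \<alpha>)" "\<alpha> \<bullet>\<^sub>N \<beta> = nt_id (NCod \<alpha>)"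
    by (auto simp: inverses_def Hom_iff FunCat_Ar)
  show "\<forall>x\<in>Ob A. invertible X (NC \<alpha> x)"
    using invertible_NC[OF _ b] a by (auto simp: FunCat_Ar)
next
  assume i: "\<forall>x\<in>Ob A. invertible X (NC \<alpha> x)"
  let ?F = "NDom \<alpha>" let ?G = "NCod \<alpha>"
  have n: "is_nt \<alpha>" and A: "FDom ?F = A" and X: "FCod ?F = X" using a by (simp_all add: FunCat_Ar)
  have c: "category A" "category X" using n A X by (metis is_nt.dom is_functor.dom is_functor.cod)+
  note s = n A X c i[rule_format] nt_simps functor_simps category_simps Inv_simps
  define \<beta> where "\<beta> = \<lparr>NDom = ?G, NCod = ?F, NC = (\<lambda>x\<in>Ob A. Inv X (NC \<alpha> x))\<rparr>"
  have \<beta>: "NDom \<beta> = ?G" "NCod \<beta> = ?F" "\<And>x. x \<in> Ob A \<Longrightarrow> NC \<beta> x = Inv X (NC \<alpha> x)"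
    by (simp_all add: \<beta>_def)
  have b: "is_nt \<beta>"
  proof (rule is_ntI[of _ ?G ?F A X])
    fix f assume f: "f \<in> Ar A"
    have "Inv X (NC \<alpha> (Tgt A f)) \<cdot>\<^bsub>X\<^esub> FAr ?G f = FAr ?F f \<cdot>\<^bsub>X\<^esub> Inv X (NC \<alpha> (Src A f))"
      by (rule category.Inv_square[OF c(2) is_nt.NC_natural[OF n A X f refl refl]]) (use f in \<open>simp_all add: s\<close>)
    then show "NC \<beta> (Tgt A f) \<cdot>\<^bsub>X\<^esub> FAr ?G f = FAr ?F f \<cdot>\<^bsub>X\<^esub> NC \<beta> (Src A f)"
      using f c by (simp add: \<beta>_def category_simps)
  qed (auto simp: \<beta>_def Functors_iff s)
  have "\<beta> \<bullet>\<^sub>N \<alpha> = nt_id ?F" by (rule nt_eqI) (auto simp: is_nt_vcomp is_nt_id \<beta> b s)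
  moreover have "\<alpha> \<bullet>\<^sub>N \<beta> = nt_id ?G" by (rule nt_eqI) (auto simp: is_nt_vcomp is_nt_id \<beta> b s)
  ultimately have "inverses (FunCat A X) \<alpha> \<beta>"
    using a b by (auto simp: inverses_def Hom_iff FunCat_Ar \<beta> s)
  then show "invertible (FunCat A X) \<alpha>" unfolding invertible_def by blast
qed

section \<open>Whiskering\<close>

lemma whisker_sel [simp]: "NDom (\<beta> \<star>\<^sub>N \<alpha>) = NDom \<beta> \<circ>\<^sub>F NDom \<alpha>" "NCod (\<beta> \<star>\<^sub>N \<alpha>) = NCod \<beta> \<circ>\<^sub>F NCod \<alpha>"
  by (auto simp: nt_hcomp_def)

lemma hcomp_NC: "a \<in> Ob (FDom (NDom \<alpha>)) \<Longrightarrow> NC (\<beta> \<star>\<^sub>N \<alpha>) a =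
    NC \<beta> (FOb (NCod \<alpha>) a) \<cdot>\<^bsub>FCod (NDom \<beta>)\<^esub> FAr (NDom \<beta>) (NC \<alpha> a)"
  by (auto simp: nt_hcomp_def)

lemma whisker_left_NC:
  "is_functor H \<Longrightarrow> is_nt \<alpha> \<Longrightarrow> FCod (NDom \<alpha>) = FDom H \<Longrightarrow> a \<in> Ob (FDom (NDom \<alpha>)) \<Longrightarrow>
    NC (nt_id H \<star>\<^sub>N \<alpha>) a = FAr H (NC \<alpha> a)"
  by (simp add: hcomp_NC nt_simps functor_simps category_simps)

lemma is_nt_whisker_left:
  assumes H: "is_functor H" and a: "is_nt \<alpha>" and d: "FCod (NDom \<alpha>) = FDom H"
  shows "is_nt (nt_id H \<star>\<^sub>N \<alpha>)"
proof -
  let ?A = "FDom (NDom \<alpha>)"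
  note s = H a d whisker_left_NC nt_simps functor_simps category_simps
  have c: "category ?A" using a by (simp add: s)
  show ?thesis
  proof (rule is_ntI[of _ "H \<circ>\<^sub>F NDom \<alpha>" "H \<circ>\<^sub>F NCod \<alpha>" ?A "FCod H"])
    fix f assume f: "f \<in> Ar ?A"
    have "FAr H (NC \<alpha> (Tgt ?A f) \<cdot>\<^bsub>FDom H\<^esub> FAr (NDom \<alpha>) f) =
      FAr H (FAr (NCod \<alpha>) f \<cdot>\<^bsub>FDom H\<^esub> NC \<alpha> (Src ?A f))"
      using is_nt.NC_natural[OF a refl d f refl refl] by simp
    then show "NC (nt_id H \<star>\<^sub>N \<alpha>) (Tgt ?A f) \<cdot>\<^bsub>FCod H\<^esub> FAr (H \<circ>\<^sub>F NDom \<alpha>) f =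
      FAr (H \<circ>\<^sub>F NCod \<alpha>) f \<cdot>\<^bsub>FCod H\<^esub> NC (nt_id H \<star>\<^sub>N \<alpha>) (Src ?A f)"
      using f c by (simp add: s)
  qed (auto simp: Functors_iff is_functor_fcomp c s, auto simp: nt_hcomp_def)
qed

lemma whisker_right_NC:
  "is_functor F \<Longrightarrow> is_nt \<sigma> \<Longrightarrow> FCod F = FDom (NDom \<sigma>) \<Longrightarrow> a \<in> Ob (FDom F) \<Longrightarrow>
    NC (\<sigma> \<star>\<^sub>N nt_id F) a = NC \<sigma> (FOb F a)"
  by (simp add: hcomp_NC nt_simps functor_simps category_simps)

lemma is_nt_whisker_right:
  assumes F: "is_functor F" and a: "is_nt \<sigma>" and d: "FCod F = FDom (NDom \<sigma>)"
  shows "is_nt (\<sigma> \<star>\<^sub>N nt_id F)"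
proof -
  let ?A = "FDom F" let ?X = "FCod (NDom \<sigma>)"
  note s = F a d whisker_right_NC nt_simps functor_simps category_simps
  have c: "category ?A" "category (FCod F)" using F by (simp_all add: s)
  show ?thesis
  proof (rule is_ntI[of _ "NDom \<sigma> \<circ>\<^sub>F F" "NCod \<sigma> \<circ>\<^sub>F F" ?A ?X])
    fix f assume f: "f \<in> Ar ?A"
    show "NC (\<sigma> \<star>\<^sub>N nt_id F) (Tgt ?A f) \<cdot>\<^bsub>?X\<^esub> FAr (NDom \<sigma> \<circ>\<^sub>F F) f =
      FAr (NCod \<sigma> \<circ>\<^sub>F F) f \<cdot>\<^bsub>?X\<^esub> NC (\<sigma> \<star>\<^sub>N nt_id F) (Src ?A f)"
      using f c is_nt.NC_natural[OF a d[symmetric] refl, of "FAr F f", OF _ refl refl] by (simp add: s)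
  qed (auto simp: Functors_iff is_functor_fcomp c s, auto simp: nt_hcomp_def)
qed

lemma precomp_sel [simp]: "FDom (precomp X F) = FunCat (FCod F) X" "FCod (precomp X F) = FunCat (FDom F) X"
  "H \<in> Functors (FCod F) X \<Longrightarrow> FOb (precomp X F) H = H \<circ>\<^sub>F F"
  "\<sigma> \<in> Ar (FunCat (FCod F) X) \<Longrightarrow> FAr (precomp X F) \<sigma> = \<sigma> \<star>\<^sub>N nt_id F"
  by (auto simp: precomp_def)

lemma is_functor_precomp:
  assumes F: "is_functor F" shows "is_functor (precomp X F)"
proof (rule is_functorI[OF refl refl])
  show "FAr (precomp X F) (Idt (FDom (precomp X F)) a) = Idt (FCod (precomp X F)) (FOb (precomp X F) a)"
    if "a \<in> Ob (FDom (precomp X F))" for a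
    using that F by (simp, intro nt_eqI)
      (auto simp: Functors_iff FunCat_Ar is_nt_id is_nt_whisker_right is_functor_fcomp whisker_right_NC functor_simps)
  show "FAr (precomp X F) (g \<cdot>\<^bsub>FDom (precomp X F)\<^esub> f) =
      FAr (precomp X F) g \<cdot>\<^bsub>FCod (precomp X F)\<^esub> FAr (precomp X F) f"
    if "f \<in> Ar (FDom (precomp X F))" "g \<in> Ar (FDom (precomp X F))"
      "Src (FDom (precomp X F)) g = Tgt (FDom (precomp X F)) f" for f g
  proof -
    have "g \<bullet>\<^sub>N f \<in> Ar (FunCat (FCod F) X)" using that by (simp add: FunCat_Ar is_nt_vcomp)
    then show ?thesis using that F
      by (simp, intro nt_eqI)
       (auto simp: FunCat_Ar is_nt_vcomp is_nt_whisker_right whisker_right_NC functor_simps nt_simps)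
  qed
qed (auto simp: category_FunCat precomp_def F FunCat_Ar is_nt_whisker_right Functors_iff is_functor_fcomp nt_simps)

section \<open>Connected components\<close>

lemma eq_class_eq_iff: "eq_class R x = eq_class R y \<longleftrightarrow> (x, y) \<in> (R \<union> R\<inverse>)\<^sup>*"
proof -
  have "sym ((R \<union> R\<inverse>)\<^sup>*)" by (intro sym_rtrancl) (auto simp: sym_def)
  then show ?thesis unfolding eq_class_def by (auto dest: symD intro: rtrancl_trans)
qed

lemma eq_class_rep: "eq_class R (rep (eq_class R x)) = eq_class R x"
proof -
  have "x \<in> eq_class R x" by (simp add: eq_class_def)
  then have "rep (eq_class R x) \<in> eq_class R x" unfolding rep_def by (rule someI)
  then have "(x, rep (eq_class R x)) \<in> (R \<union> R\<inverse>)\<^sup>*" by (simp add: eq_class_def)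
  then show ?thesis by (metis eq_class_eq_iff)
qed

lemma eq_class_step: "(x, y) \<in> R \<Longrightarrow> eq_class R x = eq_class R y"
  unfolding eq_class_eq_iff by blast

lemma eq_class_invariant:
  assumes "\<And>x y. (x, y) \<in> R \<Longrightarrow> g x = g y" and "eq_class R x = eq_class R y"
  shows "g x = g y"
proof -
  have "(x, y) \<in> (R \<union> R\<inverse>)\<^sup>*" using assms(2) by (simp add: eq_class_eq_iff)
  then show ?thesis by (induction rule: rtrancl_induct) (use assms(1) in auto)
qed

text \<open>
  Composition descends to connected components because 2-cells can be whiskered with 1-cells on
  either side; the locale collects the properties of a 2-category on which \<open>pi0\<close> depends.
\<close>

locale whiskered =
  fixes K :: "('c, 'f, 't) two_cat"
  assumes cat1: "category (cat1 K)"
    and cell: "\<alpha> \<in> Ar2 K \<Longrightarrow> Dom2 K \<alpha> \<in> Ar1 K \<and> Cod2 K \<alpha> \<in> Ar1 K \<and>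
      Dom1 K (Cod2 K \<alpha>) = Dom1 K (Dom2 K \<alpha>) \<and> Cod1 K (Cod2 K \<alpha>) = Cod1 K (Dom2 K \<alpha>)"
    and whisker_left: "\<alpha> \<in> Ar2 K \<Longrightarrow> g \<in> Ar1 K \<Longrightarrow> Dom1 K g = Cod1 K (Dom2 K \<alpha>) \<Longrightarrow>
      \<exists>\<beta>\<in>Ar2 K. Dom2 K \<beta> = g \<odot>\<^bsub>K\<^esub> Dom2 K \<alpha> \<and> Cod2 K \<beta> = g \<odot>\<^bsub>K\<^esub> Cod2 K \<alpha>"
    and whisker_right: "\<alpha> \<in> Ar2 K \<Longrightarrow> f \<in> Ar1 K \<Longrightarrow> Cod1 K f = Dom1 K (Dom2 K \<alpha>) \<Longrightarrow>
      \<exists>\<beta>\<in>Ar2 K. Dom2 K \<beta> = Dom2 K \<alpha> \<odot>\<^bsub>K\<^esub> f \<and> Cod2 K \<beta> = Cod2 K \<alpha> \<odot>\<^bsub>K\<^esub> f"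
begin

lemma component_cell: "\<alpha> \<in> Ar2 K \<Longrightarrow> component K (Dom2 K \<alpha>) = component K (Cod2 K \<alpha>)"
  unfolding component_def by (rule eq_class_step) blast

lemma component_invariant:
  assumes "\<And>\<alpha>. \<alpha> \<in> Ar2 K \<Longrightarrow> h (Dom2 K \<alpha>) = h (Cod2 K \<alpha>)" and "component K f = component K f'"
  shows "h f = h f'"
  by (rule eq_class_invariant[OF _ assms(2)[unfolded component_def]]) (use assms(1) in auto)

lemma component_parallel:
  assumes "component K f = component K f'"
  shows "f \<in> Ar1 K \<longleftrightarrow> f' \<in> Ar1 K" "Dom1 K f = Dom1 K f'" "Cod1 K f = Cod1 K f'"
  using component_invariant[of "\<lambda>f. (f \<in> Ar1 K, Dom1 K f, Cod1 K f)", OF _ assms] cell by auto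

lemma component_comp:
  assumes "component K f = component K f'" "component K g = component K g'"
    and fg: "f \<in> Ar1 K" "g \<in> Ar1 K" "Dom1 K g = Cod1 K f"
  shows "component K (g \<odot>\<^bsub>K\<^esub> f) = component K (g' \<odot>\<^bsub>K\<^esub> f')"
proof -
  \<comment> \<open>One factor is varied at a time; the value \<open>{}\<close> on arrows not composable with \<open>g\<close> makes the function total.\<close>
  let ?h = "\<lambda>f. if f \<in> Ar1 K \<and> Dom1 K g = Cod1 K f then component K (g \<odot>\<^bsub>K\<^esub> f) else {}"
  have "?h f = ?h f'"
    by (rule component_invariant[OF _ assms(1)])
       (use cell whisker_left[OF _ fg(2)] component_cell in \<open>simp, metis\<close>)
  moreover have f': "f' \<in> Ar1 K" "Dom1 K g = Cod1 K f'"
    using component_parallel[OF assms(1)] fg by auto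
  ultimately have 1: "component K (g \<odot>\<^bsub>K\<^esub> f) = component K (g \<odot>\<^bsub>K\<^esub> f')" using fg by simp
  let ?k = "\<lambda>g. if g \<in> Ar1 K \<and> Cod1 K f' = Dom1 K g then component K (g \<odot>\<^bsub>K\<^esub> f') else {}"
  have "?k g = ?k g'"
    by (rule component_invariant[OF _ assms(2)])
       (use cell whisker_right[OF _ f'(1)] component_cell in \<open>simp, metis\<close>)
  then show ?thesis using 1 f' fg component_parallel[OF assms(2)] by simp
qed

lemma component_rep: "component K (rep (component K f)) = component K f"
  unfolding component_def by (rule eq_class_rep)

lemma pi0_sel:
  "Ob (pi0 K) = Ob0 K" "Ar (pi0 K) = component K ` Ar1 K" "Idt (pi0 K) a = component K (Id1 K a)"
  "Src (pi0 K) (component K f) = Dom1 K f" "Tgt (pi0 K) (component K f) = Cod1 K f"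
  using component_parallel[OF component_rep] by (simp_all add: pi0_def)

lemma pi0_comp: "f \<in> Ar1 K \<Longrightarrow> g \<in> Ar1 K \<Longrightarrow> Dom1 K g = Cod1 K f \<Longrightarrow>
    component K g \<cdot>\<^bsub>pi0 K\<^esub> component K f = component K (g \<odot>\<^bsub>K\<^esub> f)"
  unfolding pi0_def using component_comp[OF component_rep component_rep] component_parallel[OF component_rep]
  by simp

lemma category_pi0: "category (pi0 K)"
proof -
  note s = category_simps[OF cat1, unfolded cat1_def, simplified] pi0_sel pi0_comp
  show ?thesis by (rule categoryI) (auto simp: s)
qed

end

section \<open>Categories of fractions\<close>

locale fraction_data = category A for A :: "('o, 'a) cat" +
  fixes S :: "'a set"
  assumes S_sub: "S \<subseteq> Ar A"
begin

lemma zigzag_Ob: "zigzag A S a l b \<Longrightarrow> a \<in> Ob A \<and> b \<in> Ob A"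
  by (induction rule: zigzag.induct) (use S_sub in \<open>auto intro: Src_Ob Tgt_Ob\<close>)

inductive_cases zigzag_NilE: "zigzag A S a [] b"
inductive_cases zigzag_FwdE: "zigzag A S a (Fwd f # l) b"
inductive_cases zigzag_BwdE: "zigzag A S a (Bwd f # l) b"

lemma zigzag_Nil: "zigzag A S a [] b \<longleftrightarrow> a \<in> Ob A \<and> b = a"
  by (auto elim: zigzag_NilE intro: zigzag.intros)

lemma zigzag_Fwd: "zigzag A S a (Fwd f # l) b \<longleftrightarrow> f \<in> Ar A \<and> a = Src A f \<and> zigzag A S (Tgt A f) l b"
  by (auto elim: zigzag_FwdE intro: zigzag.intros)

lemma zigzag_Bwd: "zigzag A S a (Bwd s # l) b \<longleftrightarrow> s \<in> S \<and> a = Tgt A s \<and> zigzag A S (Src A s) l b"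
  by (auto elim: zigzag_BwdE intro: zigzag.intros)

lemmas zigzag_iffs = zigzag_Nil zigzag_Fwd zigzag_Bwd

lemma zigzag_append: "zigzag A S a (l @ r) b \<longleftrightarrow> (\<exists>c. zigzag A S a l c \<and> zigzag A S c r b)"
proof (induction l arbitrary: a)
  case Nil
  show ?case using zigzag_Ob by (auto simp: zigzag_iffs)
next
  case (Cons z l)
  show ?case by (cases z) (auto simp: zigzag_iffs Cons)
qed

lemma fraction_invariant:
  assumes "\<And>a b l p q r. zig_rel A S p q \<Longrightarrow> zigzag A S a (l @ p @ r) b \<Longrightarrow> zigzag A S a (l @ q @ r) b \<Longrightarrow>
      h (a, l @ p @ r, b) = h (a, l @ q @ r, b)"
    and "fraction A S x = fraction A S y"
  shows "h x = h y"
  by (rule eq_class_invariant[OF _ assms(2)[unfolded fraction_def]]) (use assms(1) in \<open>auto simp: zig_step_def\<close>)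

lemma fraction_step: "zig_rel A S p q \<Longrightarrow> zigzag A S a (l @ p @ r) b \<Longrightarrow> zigzag A S a (l @ q @ r) b \<Longrightarrow>
    fraction A S (a, l @ p @ r, b) = fraction A S (a, l @ q @ r, b)"
  unfolding fraction_def by (rule eq_class_step) (auto simp: zig_step_def)

lemma fraction_parallel:
  assumes "fraction A S (a, l, b) = fraction A S (a', l', b')"
  shows "a = a'" "b = b'" "zigzag A S a l b \<longleftrightarrow> zigzag A S a' l' b'"
  using fraction_invariant[OF _ assms, of "\<lambda>(a, l, b). (a, b, zigzag A S a l b)"] by auto

text \<open>
  Concatenation respects the congruence since a rewriting step may take place inside any longer
  zigzag. As for connected components, one factor is varied at a time.
\<close>

lemma fraction_append:
  assumes "fraction A S (a, l, b) = fraction A S (a, l', b)" "fraction A S (b, r, c) = fraction A S (b, r', c)"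
    and z: "zigzag A S a l b" "zigzag A S b r c"
  shows "fraction A S (a, l @ r, c) = fraction A S (a, l' @ r', c)"
proof -
  let ?h = "\<lambda>(a, l, b). if zigzag A S b r c then fraction A S (a, l @ r, c) else {}"
  have "?h (a, l, b) = ?h (a, l', b)"
  proof (rule fraction_invariant[OF _ assms(1)])
    fix a b p q m n assume "zig_rel A S p q" "zigzag A S a (m @ p @ n) b" "zigzag A S a (m @ q @ n) b"
    then show "?h (a, m @ p @ n, b) = ?h (a, m @ q @ n, b)"
      using fraction_step[of p q a m "n @ r" c] by (auto simp: zigzag_append)
  qed
  then have 1: "fraction A S (a, l @ r, c) = fraction A S (a, l' @ r, c)" using z by simp
  have z': "zigzag A S a l' b" using fraction_parallel[OF assms(1)] z by simp
  let ?k = "\<lambda>(b, r, c). if zigzag A S a l' b then fraction A S (a, l' @ r, c) else {}"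
  have "?k (b, r, c) = ?k (b, r', c)"
  proof (rule fraction_invariant[OF _ assms(2)])
    fix b c p q m n assume "zig_rel A S p q" "zigzag A S b (m @ p @ n) c" "zigzag A S b (m @ q @ n) c"
    then show "?k (b, m @ p @ n, c) = ?k (b, m @ q @ n, c)"
      using fraction_step[of p q a "l' @ m" n c] by (auto simp: zigzag_append)
  qed
  then show ?thesis using 1 z' by simp
qed

lemma fraction_rep:
  obtains l' where "rep (fraction A S (a, l, b)) = (a, l', b)" "fraction A S (a, l', b) = fraction A S (a, l, b)"
proof -
  obtain a' l' b' where r: "rep (fraction A S (a, l, b)) = (a', l', b')" using prod_cases3 by blast
  then have e: "fraction A S (a', l', b') = fraction A S (a, l, b)"
    using eq_class_rep unfolding fraction_def by metis
  then show thesis using that r fraction_parallel[OF e] by simp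
qed

abbreviation "FR \<equiv> fractions A S"

lemma fractions_Ar: "c \<in> Ar FR \<longleftrightarrow> (\<exists>a l b. c = fraction A S (a, l, b) \<and> zigzag A S a l b)"
  by (auto simp: fractions_def)

lemma fractions_Ob: "Ob FR = Ob A" and fractions_Idt: "Idt FR a = fraction A S (a, [], a)"
  by (simp_all add: fractions_def)

lemma fractions_Src: "Src FR (fraction A S (a, l, b)) = a"
  and fractions_Tgt: "Tgt FR (fraction A S (a, l, b)) = b"
  by (rule fraction_rep[of a l b]; simp add: fractions_def)+

lemma fractions_Cmp:
  assumes "zigzag A S a l b" "zigzag A S b r c"
  shows "fraction A S (b, r, c) \<cdot>\<^bsub>FR\<^esub> fraction A S (a, l, b) = fraction A S (a, l @ r, c)"
proof -
  obtain l' where l: "rep (fraction A S (a, l, b)) = (a, l', b)" "fraction A S (a, l', b) = fraction A S (a, l, b)"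
    by (rule fraction_rep)
  obtain r' where r: "rep (fraction A S (b, r, c)) = (b, r', c)" "fraction A S (b, r', c) = fraction A S (b, r, c)"
    by (rule fraction_rep)
  have "fraction A S (a, l @ r, c) = fraction A S (a, l' @ r', c)"
    by (rule fraction_append[where b = b]) (use l r assms in simp_all)
  then show ?thesis using l r by (simp add: fractions_def)
qed

lemmas fractions_simps = fractions_Ob fractions_Idt fractions_Src fractions_Tgt fractions_Cmp

lemma zigzag_appendI: "zigzag A S a l b \<Longrightarrow> zigzag A S b r c \<Longrightarrow> zigzag A S a (l @ r) c"
  by (auto simp: zigzag_append)

lemma fraction_Ar: "zigzag A S a l b \<Longrightarrow> fraction A S (a, l, b) \<in> Ar FR"
  by (auto simp: fractions_Ar)

lemma fractions_ArE:
  assumes "c \<in> Ar FR"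
  obtains l where "c = fraction A S (Src FR c, l, Tgt FR c)" "zigzag A S (Src FR c) l (Tgt FR c)"
  using assms by (auto simp: fractions_Ar fractions_simps)

lemma category_fractions: "category FR"
proof (rule categoryI)
  fix f g assume fg: "f \<in> Ar FR" "g \<in> Ar FR" "Src FR g = Tgt FR f"
  obtain l where l: "f = fraction A S (Src FR f, l, Tgt FR f)" "zigzag A S (Src FR f) l (Tgt FR f)"
    using fg(1) by (rule fractions_ArE)
  obtain r where r: "g = fraction A S (Tgt FR f, r, Tgt FR g)" "zigzag A S (Tgt FR f) r (Tgt FR g)"
    using fg(2,3) by (metis fractions_ArE)
  have gf: "g \<cdot>\<^bsub>FR\<^esub> f = fraction A S (Src FR f, l @ r, Tgt FR g)"
    using fractions_Cmp[OF l(2) r(2)] l(1) r(1) by simp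
  show "g \<cdot>\<^bsub>FR\<^esub> f \<in> Ar FR \<and> Src FR (g \<cdot>\<^bsub>FR\<^esub> f) = Src FR f \<and> Tgt FR (g \<cdot>\<^bsub>FR\<^esub> f) = Tgt FR g"
    using l(2) r(2) unfolding gf by (simp add: fractions_simps fraction_Ar zigzag_appendI)
  fix h assume h: "h \<in> Ar FR" "Src FR h = Tgt FR g"
  obtain q where q: "h = fraction A S (Tgt FR g, q, Tgt FR h)" "zigzag A S (Tgt FR g) q (Tgt FR h)"
    using h by (metis fractions_ArE)
  have hg: "h \<cdot>\<^bsub>FR\<^esub> g = fraction A S (Tgt FR f, r @ q, Tgt FR h)"
    using fractions_Cmp[OF r(2) q(2)] r(1) q(1) by simp
  show "(h \<cdot>\<^bsub>FR\<^esub> g) \<cdot>\<^bsub>FR\<^esub> f = h \<cdot>\<^bsub>FR\<^esub> (g \<cdot>\<^bsub>FR\<^esub> f)"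
    unfolding gf hg using fractions_Cmp[OF l(2) zigzag_appendI[OF r(2) q(2)]]
      fractions_Cmp[OF zigzag_appendI[OF l(2) r(2)] q(2)] l(1) q(1) by simp
next
  fix f assume "f \<in> Ar FR"
  then obtain l where l: "f = fraction A S (Src FR f, l, Tgt FR f)" "zigzag A S (Src FR f) l (Tgt FR f)"
    by (rule fractions_ArE)
  have o: "Src FR f \<in> Ob A" "Tgt FR f \<in> Ob A" using l(2) zigzag_Ob by auto
  then show "f \<cdot>\<^bsub>FR\<^esub> Idt FR (Src FR f) = f" "Idt FR (Tgt FR f) \<cdot>\<^bsub>FR\<^esub> f = f"
    using l fractions_Cmp[OF _ l(2), of "Src FR f" "[]"] fractions_Cmp[OF l(2), of "[]" "Tgt FR f"]
    by (simp_all add: zigzag_Nil fractions_Idt)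
  show "Src FR f \<in> Ob FR" "Tgt FR f \<in> Ob FR" using o by (simp_all add: fractions_Ob)
qed (auto simp: fractions_simps zigzag_Nil intro: fraction_Ar)

abbreviation "Q \<equiv> to_fractions A S"

lemma to_fractions_simps:
  assumes "f \<in> Ar A"
  shows "Q f \<in> Ar FR" "Src FR (Q f) = Src A f" "Tgt FR (Q f) = Tgt A f"
  using assms Tgt_Ob unfolding to_fractions_def by (auto simp: fractions_simps fraction_Ar zigzag_iffs)

lemma to_fractions_Idt:
  assumes "a \<in> Ob A" shows "Q (Idt A a) = Idt FR a"
  using assms fraction_step[of "[Fwd (Idt A a)]" "[]" a "[]" "[]" a]
  by (simp add: to_fractions_def fractions_simps zigzag_iffs Idt_Ar Src_Idt Tgt_Idt zig_rel.idt)

lemma to_fractions_Cmp: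
  assumes f: "f \<in> Ar A" "g \<in> Ar A" "Src A g = Tgt A f"
  shows "Q (g \<cdot>\<^bsub>A\<^esub> f) = Q g \<cdot>\<^bsub>FR\<^esub> Q f"
proof -
  have "zig_rel A S [Fwd f, Fwd g] [Fwd (g \<cdot>\<^bsub>A\<^esub> f)]"
    using f by (auto simp: Hom_iff intro: zig_rel.comp)
  then show ?thesis using f Tgt_Ob[of f] Tgt_Ob[of g] fractions_Cmp[of "Src A f" "[Fwd f]" "Tgt A f" "[Fwd g]" "Tgt A g"]
    fraction_step[of "[Fwd f, Fwd g]" "[Fwd (g \<cdot>\<^bsub>A\<^esub> f)]" "Src A f" "[]" "[]" "Tgt A g"]
    by (simp add: to_fractions_def zigzag_iffs cmp_Ar Src_cmp Tgt_cmp)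
qed

lemma to_fractions_inverses:
  assumes s: "s \<in> S" shows "inverses FR (Q s) (fraction A S (Tgt A s, [Bwd s], Src A s))"
proof -
  have "s \<in> Ar A" using s S_sub by auto
  moreover from this have "Src A s \<in> Ob A" "Tgt A s \<in> Ob A" by (simp_all add: Src_Ob Tgt_Ob)
  ultimately show ?thesis
    using s fraction_step[OF zig_rel.fwd_bwd[OF s], of "Src A s" "[]" "[]" "Src A s"]
      fraction_step[OF zig_rel.bwd_fwd[OF s], of "Tgt A s" "[]" "[]" "Tgt A s"]
    by (auto simp: inverses_def Hom_iff to_fractions_def fractions_simps fraction_Ar zigzag_iffs)
qed

text \<open>
  Every arrow of the category of fractions is a composite of images of arrows and of inverses of
  images of arrows in \<open>S\<close>. Uniqueness of induced functors and naturality of induced transformations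
  are both instances of this induction.
\<close>

lemma fractions_induct [consumes 1, case_names Idt Fwd Bwd Cmp]:
  assumes c: "c \<in> Ar FR"
    and Idt: "\<And>a. a \<in> Ob A \<Longrightarrow> P (Idt FR a)"
    and Fwd: "\<And>f. f \<in> Ar A \<Longrightarrow> P (Q f)"
    and Bwd: "\<And>s t. s \<in> S \<Longrightarrow> inverses FR (Q s) t \<Longrightarrow> P t"
    and Cmp: "\<And>c d. c \<in> Ar FR \<Longrightarrow> d \<in> Ar FR \<Longrightarrow> Src FR d = Tgt FR c \<Longrightarrow> P c \<Longrightarrow> P d \<Longrightarrow> P (d \<cdot>\<^bsub>FR\<^esub> c)"
  shows "P c"
proof -
  have "P (fraction A S (a, l, b))" if "zigzag A S a l b" for a l b
    using that
  proof (induction rule: zigzag.induct)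
    case (nil a) then show ?case using Idt by (simp add: fractions_Idt)
  next
    case (fwd f l b)
    have "P (fraction A S (Tgt A f, l, b) \<cdot>\<^bsub>FR\<^esub> Q f)"
      using fwd Fwd by (intro Cmp) (auto simp: fraction_Ar to_fractions_simps fractions_simps)
    then show ?case
      using fwd fractions_Cmp[of "Src A f" "[Fwd f]" "Tgt A f" l b] Tgt_Ob by (simp add: to_fractions_def zigzag_iffs)
  next
    case (bwd s l b)
    have b: "zigzag A S (Tgt A s) [Bwd s] (Src A s)" using bwd S_sub Src_Ob by (auto simp: zigzag_iffs)
    have "P (fraction A S (Src A s, l, b) \<cdot>\<^bsub>FR\<^esub> fraction A S (Tgt A s, [Bwd s], Src A s))"
      using b bwd Bwd to_fractions_inverses by (intro Cmp) (auto simp: fraction_Ar fractions_simps)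
    then show ?case using b bwd by (simp add: fractions_simps)
  qed
  then show ?thesis using c by (auto simp: fractions_Ar)
qed

end

primrec zig_value :: "('p, 'b) cat \<Rightarrow> ('o, 'a, 'p, 'b) fnct \<Rightarrow> 'o \<Rightarrow> 'a zig list \<Rightarrow> 'b" where
  "zig_value X G a [] = Idt X (FOb G a)"
| "zig_value X G a (z # l) = (case z of
      Fwd f \<Rightarrow> zig_value X G (Tgt (FDom G) f) l \<cdot>\<^bsub>X\<^esub> FAr G f
    | Bwd s \<Rightarrow> zig_value X G (Src (FDom G) s) l \<cdot>\<^bsub>X\<^esub> Inv X (FAr G s))"

locale inverting_functor = fraction_data A S + is_functor G
  for A :: "('o, 'a) cat" and S and G :: "('o, 'a, 'p, 'b) fnct" +
  fixes X :: "('p, 'b) cat"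
  assumes G_dom: "FDom G = A" and G_cod: "FCod G = X"
    and inverts: "s \<in> S \<Longrightarrow> invertible X (FAr G s)"
begin

lemma cX: "category X" using cod G_cod by simp

lemmas G_simps = FOb_Ob FAr_Ar Src_FAr Tgt_FAr FAr_Idt FAr_cmp G_dom G_cod
lemmas X_simps = category_simps[OF cX] Inv_simps[OF cX]

lemma zig_value_Ar: "zigzag A S a l b \<Longrightarrow> zig_value X G a l \<in> Ar X \<and>
    Src X (zig_value X G a l) = FOb G a \<and> Tgt X (zig_value X G a l) = FOb G b"
proof (induction rule: zigzag.induct)
  case (bwd s l b)
  then show ?case using S_sub inverts by (auto simp: G_simps X_simps)
qed (auto simp: G_simps X_simps)

lemma zig_value_append:
  assumes "zigzag A S a l b" "zigzag A S b r c"
  shows "zig_value X G a (l @ r) = zig_value X G b r \<cdot>\<^bsub>X\<^esub> zig_value X G a l"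
  using assms
proof (induction rule: zigzag.induct)
  case (nil a) then show ?case using zig_value_Ar[of a r c] by (simp add: X_simps)
next
  case (fwd f l b)
  then show ?case using zig_value_Ar[of "Tgt A f" l b] zig_value_Ar[of b r c] by (simp add: X_simps G_simps)
next
  case (bwd s l b)
  then show ?case using zig_value_Ar[of "Src A s" l b] zig_value_Ar[of b r c] inverts[of s] S_sub
    by (auto simp: X_simps G_simps)
qed

lemma zig_value_rel:
  assumes "zig_rel A S p q" "zigzag A S a p b" "zigzag A S a q b"
  shows "zig_value X G a p = zig_value X G a q"
  using assms
proof cases
  case (comp f _ _ g)
  then show ?thesis using assms(2,3) Tgt_Ob[of g] by (auto simp: Hom_iff zigzag_iffs X_simps G_simps)
next
  case (idt c)
  then show ?thesis using assms(2) by (auto simp: zigzag_iffs X_simps G_simps Idt_Ar Src_Idt Tgt_Idt)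
next
  case (fwd_bwd s)
  then show ?thesis using assms(2) inverts[of s] S_sub
    by (auto simp: zigzag_iffs X_simps G_simps)
next
  case (bwd_fwd s)
  then show ?thesis using assms(2) inverts[of s] S_sub
    by (auto simp: zigzag_iffs X_simps G_simps)
qed

text \<open>
  A rewriting step replaces a segment of a zigzag. The two segments start at the same object because
  the zigzag before them determines where it ends, and then they also end at the same object. So
  their values may be compared by \<open>zig_value_rel\<close>.
\<close>

lemma zig_value_fraction:
  assumes "fraction A S (a, l, b) = fraction A S (a', l', b')"
  shows "zig_value X G a l = zig_value X G a' l'"
proof -
  have "(\<lambda>(a, l, b). zig_value X G a l) (a, l, b) = (\<lambda>(a, l, b). zig_value X G a l) (a', l', b')"
  proof (rule fraction_invariant[OF _ assms])
    fix a b l p q r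
    assume pq: "zig_rel A S p q" and p: "zigzag A S a (l @ p @ r) b" and q: "zigzag A S a (l @ q @ r) b"
    obtain c d where z: "zigzag A S a l c" "zigzag A S c p d" "zigzag A S d r b"
      using p by (auto simp: zigzag_append)
    obtain c' d' where z': "zigzag A S a l c'" "zigzag A S c' q d'" "zigzag A S d' r b"
      using q by (auto simp: zigzag_append)
    have "c' = c" using z(1) z'(1)
    proof (induction arbitrary: c' rule: zigzag.induct)
    qed (auto simp: zigzag_iffs)
    moreover have "d' = d" using pq z(2) z'(2)
      by cases (auto simp: zigzag_iffs Hom_iff \<open>c' = c\<close> Tgt_cmp Idt_Ar Tgt_Idt Src_Idt)
    ultimately have "zig_value X G c p = zig_value X G c q" using z z' pq zig_value_rel by blast
    moreover have "zigzag A S c (p @ r) b" "zigzag A S c (q @ r) b"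
      using z z' \<open>c' = c\<close> \<open>d' = d\<close> by (auto simp: zigzag_append)
    ultimately show "(\<lambda>(a, l, b). zig_value X G a l) (a, l @ p @ r, b) =
        (\<lambda>(a, l, b). zig_value X G a l) (a, l @ q @ r, b)"
      using z z' \<open>c' = c\<close> \<open>d' = d\<close> by (simp add: zig_value_append)
  qed
  then show ?thesis by simp
qed

lemma functor_of_fractions:
  "\<exists>H\<in>Functors FR X. (\<forall>a\<in>Ob A. FOb H a = FOb G a) \<and> (\<forall>f\<in>Ar A. FAr H (Q f) = FAr G f)"
proof
  define H where "H = \<lparr>FDom = fractions A S, FCod = X, FOb = FOb G,
    FAr = (\<lambda>c\<in>Ar FR. zig_value X G (fst (rep c)) (fst (snd (rep c))))\<rparr>"
  have v: "FAr H (fraction A S (a, l, b)) = zig_value X G a l" if "zigzag A S a l b" for a l b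
  proof -
    obtain l' where r: "rep (fraction A S (a, l, b)) = (a, l', b)" and e: "fraction A S (a, l', b) = fraction A S (a, l, b)"
      by (rule fraction_rep)
    then show ?thesis using zig_value_fraction[OF e] fraction_Ar[OF that] by (simp add: H_def)
  qed
  have "is_functor H"
  proof (rule is_functorI[of _ FR X])
    fix f assume "f \<in> Ar FR"
    then show "FAr H f \<in> Ar X \<and> Src X (FAr H f) = FOb H (Src FR f) \<and>
       Tgt X (FAr H f) = FOb H (Tgt FR f)"
      by (auto simp: fractions_Ar v fractions_simps zig_value_Ar) (simp_all add: H_def)
  next
    fix a assume "a \<in> Ob FR"
    then show "FAr H (Idt FR a) = Idt X (FOb H a)"
      by (simp add: fractions_simps v zigzag_Nil) (simp add: H_def)
  next
    fix f g assume fg: "f \<in> Ar FR" "g \<in> Ar FR"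
      "Src FR g = Tgt FR f"
    then obtain a l b r c where "f = fraction A S (a, l, b)" "g = fraction A S (b, r, c)"
      "zigzag A S a l b" "zigzag A S b r c"
      by (auto simp: fractions_Ar fractions_simps)
    moreover from this have "zigzag A S a (l @ r) c" by (auto simp: zigzag_append)
    ultimately show "FAr H (g \<cdot>\<^bsub>FR\<^esub> f) = FAr H g \<cdot>\<^bsub>X\<^esub> FAr H f"
      by (simp add: v fractions_simps zig_value_append)
  qed (use category_fractions cX FOb_ext in \<open>auto simp: H_def fractions_Ob G_simps\<close>)
  then show "H \<in> Functors FR X" by (simp add: Functors_iff H_def)
  show "(\<forall>a\<in>Ob A. FOb H a = FOb G a) \<and> (\<forall>f\<in>Ar A. FAr H (Q f) = FAr G f)"
    by (auto simp: to_fractions_def v zigzag_iffs Tgt_Ob G_simps X_simps) (simp add: H_def)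
qed

end

section \<open>Pseudo-functors into \<open>Cat\<close>\<close>

lemma Cat_sel [simp]: "Ob0 Cat = {A. category A}" "Ar1 Cat = {F. is_functor F}" "Dom1 Cat = FDom" "Cod1 Cat = FCod"
  "Id1 Cat = id_functor" "Comp1 Cat = fcomp" "Ar2 Cat = {\<alpha>. is_nt \<alpha>}" "Dom2 Cat = NDom" "Cod2 Cat = NCod"
  "Id2 Cat = nt_id" "VComp Cat = nt_vcomp" "HComp Cat = nt_hcomp"
  by (simp_all add: Cat_def)

lemma op1_sel [simp]: "Ob0 (op1 K) = Ob0 K" "Ar1 (op1 K) = Ar1 K" "Dom1 (op1 K) = Cod1 K" "Cod1 (op1 K) = Dom1 K"
  "Id1 (op1 K) = Id1 K" "Comp1 (op1 K) g f = f \<odot>\<^bsub>K\<^esub> g" "Ar2 (op1 K) = Ar2 K" "Dom2 (op1 K) = Dom2 K"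
  "Cod2 (op1 K) = Cod2 K" "Id2 (op1 K) = Id2 K" "HComp (op1 K) \<beta> \<alpha> = \<alpha> \<star>\<^bsub>K\<^esub> \<beta>"
  by (simp_all add: op1_def)

lemma Hom1_iff: "f \<in> Hom1 K A B \<longleftrightarrow> f \<in> Ar1 K \<and> Dom1 K f = A \<and> Cod1 K f = B"
  and Hom2_iff: "\<alpha> \<in> Hom2 K f g \<longleftrightarrow> \<alpha> \<in> Ar2 K \<and> Dom2 K \<alpha> = f \<and> Cod2 K \<alpha> = g"
  by (simp_all add: Hom1_def Hom2_def Hom_iff cat1_def vcat_def)

lemma invertible_vcat_NC:
  assumes "is_nt \<alpha>" "invertible (vcat Cat) \<alpha>" "x \<in> Ob (FDom (NDom \<alpha>))"
  shows "invertible (FCod (NDom \<alpha>)) (NC \<alpha> x)"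
proof -
  obtain \<beta> where "inverses (vcat Cat) \<alpha> \<beta>" using assms(2) by (auto simp: invertible_def)
  then show ?thesis using assms by (intro invertible_NC[of _ \<beta>]) (auto simp: inverses_def Hom_iff vcat_def)
qed

text \<open>
  The weight \<open>W\<close> is a pseudo-functor on \<open>op1 K\<close>, so stating the following for a pseudo-functor on an
  arbitrary \<open>K\<close> serves both \<open>E\<close> and \<open>W\<close>.
\<close>

locale cat_valued =
  fixes K :: "('c, 'f, 't) two_cat" and F :: "('c, 'f, 't, 'o, 'a) cat_psf"
  assumes psf: "pseudofunctor K Cat F"
begin

sublocale pseudofunctor K Cat F by (rule psf)

lemma P0_category: "C \<in> Ob0 K \<Longrightarrow> category (P0 F C)"
  using ob by simp

lemma P1_functor: "f \<in> Ar1 K \<Longrightarrow> is_functor (P1 F f)"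
  and P1_dom: "f \<in> Ar1 K \<Longrightarrow> FDom (P1 F f) = P0 F (Dom1 K f)"
  and P1_cod: "f \<in> Ar1 K \<Longrightarrow> FCod (P1 F f) = P0 F (Cod1 K f)"
  using ar[of f "Dom1 K f" "Cod1 K f"] by (simp_all add: Hom1_iff)

lemma P1_Id: "C \<in> Ob0 K \<Longrightarrow> P1 F (Id1 K C) = id_functor (P0 F C)"
  using normal by simp

lemma P2_nt: "\<alpha> \<in> Ar2 K \<Longrightarrow> is_nt (P2 F \<alpha>)"
  and P2_dom: "\<alpha> \<in> Ar2 K \<Longrightarrow> NDom (P2 F \<alpha>) = P1 F (Dom2 K \<alpha>)"
  and P2_cod: "\<alpha> \<in> Ar2 K \<Longrightarrow> NCod (P2 F \<alpha>) = P1 F (Cod2 K \<alpha>)"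
  using cell[of \<alpha> "Dom2 K \<alpha>" "Cod2 K \<alpha>"] by (simp_all add: Hom2_iff)

lemma P2_Id: "f \<in> Ar1 K \<Longrightarrow> P2 F (Id2 K f) = nt_id (P1 F f)"
  using cell_id by simp

context
  fixes f g assumes fg: "f \<in> Ar1 K" "g \<in> Ar1 K" "Dom1 K g = Cod1 K f"
begin

lemma PC_nt: "is_nt (PC F g f)" and PC_dom: "NDom (PC F g f) = P1 F g \<circ>\<^sub>F P1 F f"
  and PC_cod: "NCod (PC F g f) = P1 F (g \<odot>\<^bsub>K\<^esub> f)"
  using comparison[of f "Dom1 K f" "Cod1 K f" g "Cod1 K g"] fg by (simp_all add: Hom1_iff Hom2_iff)

lemma PC_invertible: "Cod1 K g = D \<Longrightarrow> X \<in> Ob (P0 F (Dom1 K f)) \<Longrightarrow> invertible (P0 F D) (NC (PC F g f) X)"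
  using invertible_vcat_NC[OF PC_nt, of X] comparison[of f "Dom1 K f" "Cod1 K f" g "Cod1 K g"] fg
  by (auto simp: Hom1_iff PC_dom P1_dom P1_cod)

end

lemma PC_Ar: "f \<in> Ar1 K \<Longrightarrow> g \<in> Ar1 K \<Longrightarrow> Dom1 K g = Cod1 K f \<Longrightarrow> Cod1 K g = D \<Longrightarrow>
    X \<in> Ob (P0 F (Dom1 K f)) \<Longrightarrow> NC (PC F g f) X \<in> Ar (P0 F D)"
  and PC_Src: "f \<in> Ar1 K \<Longrightarrow> g \<in> Ar1 K \<Longrightarrow> Dom1 K g = Cod1 K f \<Longrightarrow> Cod1 K g = D \<Longrightarrow>
    X \<in> Ob (P0 F (Dom1 K f)) \<Longrightarrow> Src (P0 F D) (NC (PC F g f) X) = FOb (P1 F g) (FOb (P1 F f) X)"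
  and PC_Tgt: "f \<in> Ar1 K \<Longrightarrow> g \<in> Ar1 K \<Longrightarrow> Dom1 K g = Cod1 K f \<Longrightarrow> Cod1 K g = D \<Longrightarrow>
    X \<in> Ob (P0 F (Dom1 K f)) \<Longrightarrow> Tgt (P0 F D) (NC (PC F g f) X) = FOb (P1 F (g \<odot>\<^bsub>K\<^esub> f)) X"
  using is_nt.NC_Ar[OF PC_nt, of f g "P0 F D" X] is_nt.Src_NC[OF PC_nt, of f g "P0 F D" X] is_nt.Tgt_NC[OF PC_nt, of f g "P0 F D" X]
  by (simp_all add: PC_dom PC_cod P1_dom P1_cod)

lemma P2_Ar: "\<alpha> \<in> Ar2 K \<Longrightarrow> Dom2 K \<alpha> \<in> Ar1 K \<Longrightarrow> Cod1 K (Dom2 K \<alpha>) = D \<Longrightarrow> X \<in> Ob (P0 F (Dom1 K (Dom2 K \<alpha>))) \<Longrightarrow>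
    NC (P2 F \<alpha>) X \<in> Ar (P0 F D)"
  and P2_Src: "\<alpha> \<in> Ar2 K \<Longrightarrow> Dom2 K \<alpha> \<in> Ar1 K \<Longrightarrow> Cod1 K (Dom2 K \<alpha>) = D \<Longrightarrow> X \<in> Ob (P0 F (Dom1 K (Dom2 K \<alpha>))) \<Longrightarrow>
    Src (P0 F D) (NC (P2 F \<alpha>) X) = FOb (P1 F (Dom2 K \<alpha>)) X"
  and P2_Tgt: "\<alpha> \<in> Ar2 K \<Longrightarrow> Dom2 K \<alpha> \<in> Ar1 K \<Longrightarrow> Cod1 K (Dom2 K \<alpha>) = D \<Longrightarrow> X \<in> Ob (P0 F (Dom1 K (Dom2 K \<alpha>))) \<Longrightarrow>
    Tgt (P0 F D) (NC (P2 F \<alpha>) X) = FOb (P1 F (Cod2 K \<alpha>)) X"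
  using is_nt.NC_Ar[OF P2_nt, of \<alpha> "P0 F D" X] is_nt.Src_NC[OF P2_nt, of \<alpha> "P0 F D" X] is_nt.Tgt_NC[OF P2_nt, of \<alpha> "P0 F D" X]
  by (simp_all add: P2_dom P2_cod P1_dom P1_cod)

lemma P1_Ob: "f \<in> Ar1 K \<Longrightarrow> Cod1 K f = D \<Longrightarrow> X \<in> Ob (P0 F (Dom1 K f)) \<Longrightarrow> FOb (P1 F f) X \<in> Ob (P0 F D)"
  and P1_Ar: "f \<in> Ar1 K \<Longrightarrow> Cod1 K f = D \<Longrightarrow> u \<in> Ar (P0 F (Dom1 K f)) \<Longrightarrow> FAr (P1 F f) u \<in> Ar (P0 F D)"
  and P1_Src: "f \<in> Ar1 K \<Longrightarrow> Cod1 K f = D \<Longrightarrow> u \<in> Ar (P0 F (Dom1 K f)) \<Longrightarrow>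
    Src (P0 F D) (FAr (P1 F f) u) = FOb (P1 F f) (Src (P0 F (Dom1 K f)) u)"
  and P1_Tgt: "f \<in> Ar1 K \<Longrightarrow> Cod1 K f = D \<Longrightarrow> u \<in> Ar (P0 F (Dom1 K f)) \<Longrightarrow>
    Tgt (P0 F D) (FAr (P1 F f) u) = FOb (P1 F f) (Tgt (P0 F (Dom1 K f)) u)"
  and P1_Idt: "f \<in> Ar1 K \<Longrightarrow> Dom1 K f = C \<Longrightarrow> X \<in> Ob (P0 F C) \<Longrightarrow>
    FAr (P1 F f) (Idt (P0 F C) X) = Idt (P0 F (Cod1 K f)) (FOb (P1 F f) X)"
  and P1_Cmp: "f \<in> Ar1 K \<Longrightarrow> Dom1 K f = C \<Longrightarrow> u \<in> Ar (P0 F C) \<Longrightarrow> v \<in> Ar (P0 F C) \<Longrightarrow> Src (P0 F C) v = Tgt (P0 F C) u \<Longrightarrow>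
    FAr (P1 F f) (v \<cdot>\<^bsub>P0 F C\<^esub> u) = FAr (P1 F f) v \<cdot>\<^bsub>P0 F (Cod1 K f)\<^esub> FAr (P1 F f) u"
  using P1_functor[of f] by (simp_all add: functor_simps P1_dom P1_cod)

lemma PC_Id: "f \<in> Ar1 K \<Longrightarrow> Dom1 K f = C \<Longrightarrow> PC F f (Id1 K C) = nt_id (P1 F f)"
  "f \<in> Ar1 K \<Longrightarrow> Cod1 K f = C \<Longrightarrow> PC F (Id1 K C) f = nt_id (P1 F f)"
  using comparison_unit[of f "Dom1 K f" "Cod1 K f"] by (auto simp: Hom1_iff)

lemmas psf_simps = P0_category P1_functor P1_dom P1_cod P1_Id P2_nt P2_dom P2_cod P2_Id PC_nt PC_dom PC_cod
  PC_invertible PC_Ar PC_Src PC_Tgt P2_Ar P2_Src P2_Tgt P1_Ob P1_Ar P1_Src P1_Tgt P1_Idt P1_Cmp PC_Id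

lemma P2_natural:
  assumes a: "\<alpha> \<in> Ar2 K" "Dom2 K \<alpha> \<in> Ar1 K" and u: "u \<in> Ar (P0 F (Dom1 K (Dom2 K \<alpha>)))" "Src (P0 F (Dom1 K (Dom2 K \<alpha>))) u = X"
    "Tgt (P0 F (Dom1 K (Dom2 K \<alpha>))) u = Z"
    and D: "Cod1 K (Dom2 K \<alpha>) = D"
  shows "NC (P2 F \<alpha>) Z \<cdot>\<^bsub>P0 F D\<^esub> FAr (P1 F (Dom2 K \<alpha>)) u = FAr (P1 F (Cod2 K \<alpha>)) u \<cdot>\<^bsub>P0 F D\<^esub> NC (P2 F \<alpha>) X"
  using is_nt.NC_natural[OF P2_nt[OF a(1)], of "P0 F (Dom1 K (Dom2 K \<alpha>))" "P0 F D" u X Z] a u D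
  by (simp add: psf_simps)

lemma PC_natural:
  assumes fg: "f \<in> Ar1 K" "g \<in> Ar1 K" "Dom1 K g = Cod1 K f" "Cod1 K g = D"
    and u: "u \<in> Ar (P0 F (Dom1 K f))" "Src (P0 F (Dom1 K f)) u = X" "Tgt (P0 F (Dom1 K f)) u = Z"
  shows "NC (PC F g f) Z \<cdot>\<^bsub>P0 F D\<^esub> FAr (P1 F g) (FAr (P1 F f) u) = FAr (P1 F (g \<odot>\<^bsub>K\<^esub> f)) u \<cdot>\<^bsub>P0 F D\<^esub> NC (PC F g f) X"
  using is_nt.NC_natural[OF PC_nt[OF fg(1,2,3)], of "P0 F (Dom1 K f)" "P0 F D" u X Z] fg u
  by (simp add: psf_simps)

lemma PC_assoc:
  assumes f: "f \<in> Ar1 K" "g \<in> Ar1 K" "h \<in> Ar1 K" "Dom1 K g = Cod1 K f" "Dom1 K h = Cod1 K g" "Cod1 K h = D"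
    and gf: "g \<odot>\<^bsub>K\<^esub> f \<in> Ar1 K" "Dom1 K (g \<odot>\<^bsub>K\<^esub> f) = Dom1 K f" "Cod1 K (g \<odot>\<^bsub>K\<^esub> f) = Cod1 K g"
    and X: "X \<in> Ob (P0 F (Dom1 K f))" and o: "Dom1 K f \<in> Ob0 K" "Cod1 K f \<in> Ob0 K" "Cod1 K g \<in> Ob0 K" "D \<in> Ob0 K"
  shows "NC (PC F h (g \<odot>\<^bsub>K\<^esub> f)) X \<cdot>\<^bsub>P0 F D\<^esub> FAr (P1 F h) (NC (PC F g f) X) =
    NC (PC F (h \<odot>\<^bsub>K\<^esub> g) f) X \<cdot>\<^bsub>P0 F D\<^esub> NC (PC F h g) (FOb (P1 F f) X)"
proof -
  have "NC (PC F h (g \<odot>\<^bsub>K\<^esub> f) \<bullet>\<^sub>N (nt_id (P1 F h) \<star>\<^sub>N PC F g f)) X =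
    NC (PC F (h \<odot>\<^bsub>K\<^esub> g) f \<bullet>\<^sub>N (PC F h g \<star>\<^sub>N nt_id (P1 F f))) X"
    using comparison_assoc[of f "Dom1 K f" "Cod1 K f" g "Cod1 K g" h D] f by (simp add: Hom1_iff)
  then show ?thesis
    using assms whisker_left_NC[OF P1_functor[of h] PC_nt, of f g X] whisker_right_NC[OF P1_functor[of f] PC_nt, of g h X]
    by (simp add: psf_simps)
qed

lemma PC_natural_left:
  assumes f: "g \<in> Ar1 K" "\<alpha> \<in> Ar2 K" "Dom2 K \<alpha> \<in> Ar1 K" "Cod2 K \<alpha> \<in> Ar1 K" "Dom1 K g = Cod1 K (Dom2 K \<alpha>)"
      "Cod1 K g = D" "Id2 K g \<in> Ar2 K" "Dom2 K (Id2 K g) = g" "Cod2 K (Id2 K g) = g"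
    and X: "X \<in> Ob (P0 F (Dom1 K (Dom2 K \<alpha>)))"
  shows "NC (PC F g (Cod2 K \<alpha>)) X \<cdot>\<^bsub>P0 F D\<^esub> FAr (P1 F g) (NC (P2 F \<alpha>) X) =
    NC (P2 F (Id2 K g \<star>\<^bsub>K\<^esub> \<alpha>)) X \<cdot>\<^bsub>P0 F D\<^esub> NC (PC F g (Dom2 K \<alpha>)) X"
proof -
  have "NC (PC F g (Cod2 K \<alpha>) \<bullet>\<^sub>N (nt_id (P1 F g) \<star>\<^sub>N P2 F \<alpha>)) X =
    NC (P2 F (Id2 K g \<star>\<^bsub>K\<^esub> \<alpha>) \<bullet>\<^sub>N PC F g (Dom2 K \<alpha>)) X"
    using comparison_natural[of "Dom2 K \<alpha>" "Dom1 K (Dom2 K \<alpha>)" "Cod1 K (Dom2 K \<alpha>)" g D \<alpha> "Cod2 K \<alpha>" "Id2 K g" g]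
      f P2_Id[of g] by (simp add: Hom1_iff Hom2_iff)
  then show ?thesis
    using assms whisker_left_NC[OF P1_functor[of g] P2_nt[of \<alpha>], of X] by (simp add: psf_simps)
qed

lemma PC_natural_right:
  assumes f: "f \<in> Ar1 K" "\<alpha> \<in> Ar2 K" "Dom2 K \<alpha> \<in> Ar1 K" "Cod2 K \<alpha> \<in> Ar1 K" "Dom1 K (Dom2 K \<alpha>) = Cod1 K f"
      "Cod1 K (Dom2 K \<alpha>) = D" "Id2 K f \<in> Ar2 K" "Dom2 K (Id2 K f) = f" "Cod2 K (Id2 K f) = f"
    and X: "X \<in> Ob (P0 F (Dom1 K f))"
  shows "NC (PC F (Cod2 K \<alpha>) f) X \<cdot>\<^bsub>P0 F D\<^esub> NC (P2 F \<alpha>) (FOb (P1 F f) X) =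
    NC (P2 F (\<alpha> \<star>\<^bsub>K\<^esub> Id2 K f)) X \<cdot>\<^bsub>P0 F D\<^esub> NC (PC F (Dom2 K \<alpha>) f) X"
proof -
  have "NC (PC F (Cod2 K \<alpha>) f \<bullet>\<^sub>N (P2 F \<alpha> \<star>\<^sub>N nt_id (P1 F f))) X =
    NC (P2 F (\<alpha> \<star>\<^bsub>K\<^esub> Id2 K f) \<bullet>\<^sub>N PC F (Dom2 K \<alpha>) f) X"
    using comparison_natural[of f "Dom1 K f" "Cod1 K f" "Dom2 K \<alpha>" D "Id2 K f" f \<alpha> "Cod2 K \<alpha>"]
      f P2_Id[of f] by (simp add: Hom1_iff Hom2_iff)
  then show ?thesis
    using assms whisker_right_NC[OF P1_functor[of f] P2_nt[of \<alpha>], of X] by (simp add: psf_simps)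
qed

text \<open>
  The composition of \<open>\<Delta>(E, W)\<close> uses inverses of comparison cells. Naturality and coherence pass to them
  by \<open>Inv_square\<close> and \<open>Inv_of_cmp\<close>.
\<close>

lemma PC_Inv_natural:
  assumes fg: "f \<in> Ar1 K" "g \<in> Ar1 K" "Dom1 K g = Cod1 K f" "Cod1 K g = D"
    and gf: "g \<odot>\<^bsub>K\<^esub> f \<in> Ar1 K" "Dom1 K (g \<odot>\<^bsub>K\<^esub> f) = Dom1 K f" "Cod1 K (g \<odot>\<^bsub>K\<^esub> f) = Cod1 K g"
    and o: "Dom1 K f \<in> Ob0 K" "D \<in> Ob0 K"
    and u: "u \<in> Ar (P0 F (Dom1 K f))" "Src (P0 F (Dom1 K f)) u = X" "Tgt (P0 F (Dom1 K f)) u = Z"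
  shows "Inv (P0 F D) (NC (PC F g f) Z) \<cdot>\<^bsub>P0 F D\<^esub> FAr (P1 F (g \<odot>\<^bsub>K\<^esub> f)) u =
    FAr (P1 F g) (FAr (P1 F f) u) \<cdot>\<^bsub>P0 F D\<^esub> Inv (P0 F D) (NC (PC F g f) X)"
proof -
  have "X \<in> Ob (P0 F (Dom1 K f))" "Z \<in> Ob (P0 F (Dom1 K f))"
    using u category.ends[OF P0_category[OF o(1)]] by auto
  then show ?thesis
    by (intro category.Inv_square PC_natural) (use assms in \<open>simp_all add: psf_simps\<close>)
qed

lemma PC_Inv_assoc:
  assumes f: "f \<in> Ar1 K" "g \<in> Ar1 K" "h \<in> Ar1 K" "Dom1 K g = Cod1 K f" "Dom1 K h = Cod1 K g" "Cod1 K h = D"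
    and gf: "g \<odot>\<^bsub>K\<^esub> f \<in> Ar1 K" "Dom1 K (g \<odot>\<^bsub>K\<^esub> f) = Dom1 K f" "Cod1 K (g \<odot>\<^bsub>K\<^esub> f) = Cod1 K g"
    and hg: "h \<odot>\<^bsub>K\<^esub> g \<in> Ar1 K" "Dom1 K (h \<odot>\<^bsub>K\<^esub> g) = Dom1 K g" "Cod1 K (h \<odot>\<^bsub>K\<^esub> g) = Cod1 K h"
    and hgf: "(h \<odot>\<^bsub>K\<^esub> g) \<odot>\<^bsub>K\<^esub> f = h \<odot>\<^bsub>K\<^esub> (g \<odot>\<^bsub>K\<^esub> f)"
    and X: "X \<in> Ob (P0 F (Dom1 K f))" and o: "Dom1 K f \<in> Ob0 K" "Cod1 K f \<in> Ob0 K" "Cod1 K g \<in> Ob0 K" "D \<in> Ob0 K"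
  shows "FAr (P1 F h) (Inv (P0 F (Cod1 K g)) (NC (PC F g f) X)) \<cdot>\<^bsub>P0 F D\<^esub> Inv (P0 F D) (NC (PC F h (g \<odot>\<^bsub>K\<^esub> f)) X) =
    Inv (P0 F D) (NC (PC F h g) (FOb (P1 F f) X)) \<cdot>\<^bsub>P0 F D\<^esub> Inv (P0 F D) (NC (PC F (h \<odot>\<^bsub>K\<^esub> g) f) X)"
proof -
  have c: "category (P0 F D)" using o P0_category by simp
  have i: "invertible (P0 F D) (FAr (P1 F h) (NC (PC F g f) X))"
    using is_functor.FAr_invertible[OF P1_functor[of h], of "NC (PC F g f) X"] assms by (simp add: psf_simps)
  have "Inv (P0 F D) (NC (PC F h (g \<odot>\<^bsub>K\<^esub> f)) X \<cdot>\<^bsub>P0 F D\<^esub> FAr (P1 F h) (NC (PC F g f) X)) =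
    Inv (P0 F D) (NC (PC F (h \<odot>\<^bsub>K\<^esub> g) f) X \<cdot>\<^bsub>P0 F D\<^esub> NC (PC F h g) (FOb (P1 F f) X))"
    using PC_assoc[OF f gf X o] by simp
  then show ?thesis
    using assms i is_functor.FAr_Inv[OF P1_functor[of h], of "P0 F (Cod1 K g)" "NC (PC F g f) X"]
    by (simp add: category.Inv_of_cmp[OF c] psf_simps)
qed

end

section \<open>The 2-category of triples\<close>

locale weight = two_category K + E: cat_valued K E + W: cat_valued "op1 K" W
  for K :: "('c, 'f, 't) two_cat" and E :: "('c, 'f, 't, 'eo, 'ea) cat_psf" and W :: "('c, 'f, 't, 'wo, 'wa) cat_psf"
begin

abbreviation "DOb \<equiv> delta_ob K E W"
abbreviation "DAr \<equiv> delta_ar K E W"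
abbreviation "DCell \<equiv> delta_cell K E W"
abbreviation "DId \<equiv> delta_id K E W"
abbreviation "DComp \<equiv> delta_comp K E W"
abbreviation "pnat_into \<X> \<equiv> is_pnat (op1 K) W (CatInto E \<X>)"
abbreviation "modif_into \<X> \<equiv> is_modif (op1 K) W (CatInto E \<X>)"
abbreviation "Cocones \<X> \<equiv> PsHom (op1 K) W (CatInto E \<X>)"

lemmas K1_simps = category_simps[OF cat1, unfolded cat1_def, simplified]
lemmas K2_simps = category.Src_Ob[OF vcat, unfolded vcat_def, simplified] category.Tgt_Ob[OF vcat, unfolded vcat_def, simplified]
  category.Idt_Ar[OF vcat, unfolded vcat_def, simplified] category.Src_Idt[OF vcat, unfolded vcat_def, simplified]
  category.Tgt_Idt[OF vcat, unfolded vcat_def, simplified]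

lemma globular_Cod: "\<alpha> \<in> Ar2 K \<Longrightarrow> Dom1 K (Cod2 K \<alpha>) = Dom1 K (Dom2 K \<alpha>)"
  "\<alpha> \<in> Ar2 K \<Longrightarrow> Cod1 K (Cod2 K \<alpha>) = Cod1 K (Dom2 K \<alpha>)"
  using globular by simp_all

lemma whisker_cell_left:
  assumes "\<alpha> \<in> Ar2 K" "g \<in> Ar1 K" "Dom1 K g = Cod1 K (Dom2 K \<alpha>)"
  shows "Id2 K g \<star>\<^bsub>K\<^esub> \<alpha> \<in> Ar2 K" "Dom2 K (Id2 K g \<star>\<^bsub>K\<^esub> \<alpha>) = g \<odot>\<^bsub>K\<^esub> Dom2 K \<alpha>" "Cod2 K (Id2 K g \<star>\<^bsub>K\<^esub> \<alpha>) = g \<odot>\<^bsub>K\<^esub> Cod2 K \<alpha>"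
  using hcomp[of "Dom2 K \<alpha>" "Dom1 K (Dom2 K \<alpha>)" "Cod1 K (Dom2 K \<alpha>)" g "Cod1 K g" \<alpha> "Cod2 K \<alpha>" "Id2 K g" g] assms
  by (simp_all add: Hom1_iff Hom2_iff K2_simps)

lemma whisker_cell_right:
  assumes "\<alpha> \<in> Ar2 K" "f \<in> Ar1 K" "Dom1 K (Dom2 K \<alpha>) = Cod1 K f"
  shows "\<alpha> \<star>\<^bsub>K\<^esub> Id2 K f \<in> Ar2 K" "Dom2 K (\<alpha> \<star>\<^bsub>K\<^esub> Id2 K f) = Dom2 K \<alpha> \<odot>\<^bsub>K\<^esub> f" "Cod2 K (\<alpha> \<star>\<^bsub>K\<^esub> Id2 K f) = Cod2 K \<alpha> \<odot>\<^bsub>K\<^esub> f"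
  using hcomp[of f "Dom1 K f" "Cod1 K f" "Dom2 K \<alpha>" "Cod1 K (Dom2 K \<alpha>)" "Id2 K f" f \<alpha> "Cod2 K \<alpha>"] assms
  by (simp_all add: Hom1_iff Hom2_iff K2_simps)

lemmas K_simps = K1_simps K2_simps globular_Cod whisker_cell_left whisker_cell_right
lemmas Esimps = E.psf_simps
lemmas Wsimps = W.psf_simps[simplified]
lemmas simps = K_simps Esimps Wsimps category_simps Inv_simps

lemma delta_ob_iff: "(C, X, Y) \<in> DOb \<longleftrightarrow> C \<in> Ob0 K \<and> X \<in> Ob (P0 E C) \<and> Y \<in> Ob (P0 W C)"
  by (simp add: delta_ob_def)

lemma delta_ar_iff: "((C, X, Y), (f, u, v), (D, A, B)) \<in> DAr \<longleftrightarrow>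
    f \<in> Ar1 K \<and> Dom1 K f = C \<and> Cod1 K f = D \<and> C \<in> Ob0 K \<and> D \<in> Ob0 K \<and>
    X \<in> Ob (P0 E C) \<and> Y \<in> Ob (P0 W C) \<and> A \<in> Ob (P0 E D) \<and> B \<in> Ob (P0 W D) \<and>
    u \<in> Ar (P0 E D) \<and> Src (P0 E D) u = FOb (P1 E f) X \<and> Tgt (P0 E D) u = A \<and>
    v \<in> Ar (P0 W C) \<and> Src (P0 W C) v = Y \<and> Tgt (P0 W C) v = FOb (P1 W f) B"
  by (auto simp: delta_ar_def delta_ob_def Hom1_iff Hom_iff)

lemma delta_arE:
  assumes "a \<in> DAr"
  obtains C X Y f u v D A B where "a = ((C, X, Y), (f, u, v), (D, A, B))"
    "((C, X, Y), (f, u, v), (D, A, B)) \<in> DAr"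
  using assms by (cases a) auto

lemma delta_comp_eq: "DComp (P, (g, x, y), (D', A', B')) ((C, X, Y), (f, u, v), Q) =
     ((C, X, Y),
      (g \<odot>\<^bsub>K\<^esub> f,
       x \<cdot>\<^bsub>P0 E D'\<^esub> (FAr (P1 E g) u \<cdot>\<^bsub>P0 E D'\<^esub> Inv (P0 E D') (NC (PC E g f) X)),
       NC (PC W f g) B' \<cdot>\<^bsub>P0 W C\<^esub> (FAr (P1 W f) y \<cdot>\<^bsub>P0 W C\<^esub> v)),
      (D', A', B'))"
  by (simp add: delta_comp_def)

lemma delta_id_eq: "DId (C, X, Y) = ((C, X, Y), (Id1 K C, Idt (P0 E C) X, Idt (P0 W C) Y), (C, X, Y))"
  by (simp add: delta_id_def)

lemma delta_comp_ar: 
  assumes "((C, X, Y), (f, u, v), (D, A, B)) \<in> DAr" "((D, A, B), (g, x, y), (D', A', B')) \<in> DAr"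
  shows "DComp ((D, A, B), (g, x, y), (D', A', B')) ((C, X, Y), (f, u, v), (D, A, B)) \<in> DAr"
  using assms by (simp add: delta_comp_eq delta_ar_iff simps)

lemma delta_comp_id:
  assumes "((C, X, Y), (f, u, v), (D, A, B)) \<in> DAr"
  shows "DComp ((C, X, Y), (f, u, v), (D, A, B)) (DId (C, X, Y)) = ((C, X, Y), (f, u, v), (D, A, B))"
    "DComp (DId (D, A, B)) ((C, X, Y), (f, u, v), (D, A, B)) = ((C, X, Y), (f, u, v), (D, A, B))"
  using assms by (simp_all add: delta_comp_eq delta_id_eq delta_ar_iff simps category.Inv_Idt)

text \<open>
  In the \<open>E\<close>-component, the inverse comparison cell is moved past the image of \<open>u\<close> by naturality, and
  the two remaining inverse cells are exchanged by coherence. The \<open>W\<close>-component is treated in the same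
  way with the comparison cells of \<open>W\<close>.
\<close>

lemma delta_comp_assoc:
  assumes "((C, X, Y), (f, u, v), (D, A, B)) \<in> DAr" "((D, A, B), (g, x, y), (D', A', B')) \<in> DAr"
    "((D', A', B'), (h, p, q), (D'', A'', B'')) \<in> DAr"
  shows "DComp (DComp ((D', A', B'), (h, p, q), (D'', A'', B'')) ((D, A, B), (g, x, y), (D', A', B')))
        ((C, X, Y), (f, u, v), (D, A, B)) =
     DComp ((D', A', B'), (h, p, q), (D'', A'', B''))
       (DComp ((D, A, B), (g, x, y), (D', A', B')) ((C, X, Y), (f, u, v), (D, A, B)))"
proof -
  note t = assms[unfolded delta_ar_iff]
  let ?E = "P0 E D''" let ?W = "P0 W C"
  have cE: "category ?E" and cW: "category ?W" using t by (simp_all add: simps)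
  have "Inv ?E (NC (PC E h g) A) \<cdot>\<^bsub>?E\<^esub> (FAr (P1 E (h \<odot>\<^bsub>K\<^esub> g)) u \<cdot>\<^bsub>?E\<^esub> Inv ?E (NC (PC E (h \<odot>\<^bsub>K\<^esub> g) f) X)) =
    FAr (P1 E h) (FAr (P1 E g) u) \<cdot>\<^bsub>?E\<^esub> (Inv ?E (NC (PC E h g) (FOb (P1 E f) X)) \<cdot>\<^bsub>?E\<^esub> Inv ?E (NC (PC E (h \<odot>\<^bsub>K\<^esub> g) f) X))"
    by (rule category.extend_square[OF cE E.PC_Inv_natural]) (use t in \<open>simp_all add: simps\<close>)
  also have "Inv ?E (NC (PC E h g) (FOb (P1 E f) X)) \<cdot>\<^bsub>?E\<^esub> Inv ?E (NC (PC E (h \<odot>\<^bsub>K\<^esub> g) f) X) =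
    FAr (P1 E h) (Inv (P0 E D') (NC (PC E g f) X)) \<cdot>\<^bsub>?E\<^esub> Inv ?E (NC (PC E h (g \<odot>\<^bsub>K\<^esub> f)) X)"
    using E.PC_Inv_assoc[of f g h D'' X] t by (simp add: simps)
  finally have e: "Inv ?E (NC (PC E h g) A) \<cdot>\<^bsub>?E\<^esub> (FAr (P1 E (h \<odot>\<^bsub>K\<^esub> g)) u \<cdot>\<^bsub>?E\<^esub> Inv ?E (NC (PC E (h \<odot>\<^bsub>K\<^esub> g) f) X)) =
    FAr (P1 E h) (FAr (P1 E g) u) \<cdot>\<^bsub>?E\<^esub> (FAr (P1 E h) (Inv (P0 E D') (NC (PC E g f) X)) \<cdot>\<^bsub>?E\<^esub> Inv ?E (NC (PC E h (g \<odot>\<^bsub>K\<^esub> f)) X))" .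
  let ?k = "FAr (P1 W f) y \<cdot>\<^bsub>?W\<^esub> v"
  have "NC (PC W f (h \<odot>\<^bsub>K\<^esub> g)) B'' \<cdot>\<^bsub>?W\<^esub> (FAr (P1 W f) (NC (PC W g h) B'') \<cdot>\<^bsub>?W\<^esub> (FAr (P1 W f) (FAr (P1 W g) q) \<cdot>\<^bsub>?W\<^esub> ?k)) =
     NC (PC W (g \<odot>\<^bsub>K\<^esub> f) h) B'' \<cdot>\<^bsub>?W\<^esub> (NC (PC W f g) (FOb (P1 W h) B'') \<cdot>\<^bsub>?W\<^esub> (FAr (P1 W f) (FAr (P1 W g) q) \<cdot>\<^bsub>?W\<^esub> ?k))"
    by (rule category.extend_square[OF cW W.PC_assoc[of h g f C B'', simplified]]) (use t in \<open>simp_all add: simps\<close>)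
  also have "NC (PC W f g) (FOb (P1 W h) B'') \<cdot>\<^bsub>?W\<^esub> (FAr (P1 W f) (FAr (P1 W g) q) \<cdot>\<^bsub>?W\<^esub> ?k) =
    FAr (P1 W (g \<odot>\<^bsub>K\<^esub> f)) q \<cdot>\<^bsub>?W\<^esub> (NC (PC W f g) B' \<cdot>\<^bsub>?W\<^esub> ?k)"
    by (rule category.extend_square[OF cW W.PC_natural[of g f C q B' "FOb (P1 W h) B''", simplified]])
      (use t in \<open>simp_all add: simps\<close>)
  finally show ?thesis
    using t e by (simp add: delta_comp_eq simps)
qed

lemma Delta_sel: "Ob0 (Delta K E W) = DOb" "Ar1 (Delta K E W) = DAr" "Dom1 (Delta K E W) = fst"
  "Cod1 (Delta K E W) = (\<lambda>a. snd (snd a))" "Id1 (Delta K E W) = DId" "Comp1 (Delta K E W) = DComp"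
  "Ar2 (Delta K E W) = DCell" "Dom2 (Delta K E W) = fst" "Cod2 (Delta K E W) = (\<lambda>a. snd (snd a))"
  by (simp_all add: Delta_def)

lemma delta_cell_iff: "(((C, X, Y), (f, u, v), (D, A, B)), \<alpha>, ((C', X', Y'), (g, x, y), (D', A', B'))) \<in> DCell \<longleftrightarrow>
    ((C, X, Y), (f, u, v), (D, A, B)) \<in> DAr \<and> C' = C \<and> X' = X \<and> Y' = Y \<and> D' = D \<and> A' = A \<and> B' = B \<and>
    ((C, X, Y), (g, x, y), (D, A, B)) \<in> DAr \<and> \<alpha> \<in> Ar2 K \<and> Dom2 K \<alpha> = f \<and> Cod2 K \<alpha> = g \<and>
    x \<cdot>\<^bsub>P0 E D\<^esub> NC (P2 E \<alpha>) X = u \<and> NC (P2 W \<alpha>) B \<cdot>\<^bsub>P0 W C\<^esub> v = y"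
  by (auto simp: delta_cell_def Hom2_iff)

lemma delta_cellE:
  assumes "c \<in> DCell"
  obtains C X Y D A B \<alpha> x v where "\<alpha> \<in> Ar2 K"
    "c = (((C, X, Y), (Dom2 K \<alpha>, x \<cdot>\<^bsub>P0 E D\<^esub> NC (P2 E \<alpha>) X, v), (D, A, B)), \<alpha>,
       ((C, X, Y), (Cod2 K \<alpha>, x, NC (P2 W \<alpha>) B \<cdot>\<^bsub>P0 W C\<^esub> v), (D, A, B)))"
    "((C, X, Y), (Dom2 K \<alpha>, x \<cdot>\<^bsub>P0 E D\<^esub> NC (P2 E \<alpha>) X, v), (D, A, B)) \<in> DAr"
    "((C, X, Y), (Cod2 K \<alpha>, x, NC (P2 W \<alpha>) B \<cdot>\<^bsub>P0 W C\<^esub> v), (D, A, B)) \<in> DAr"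
  using assms that by (auto simp: delta_cell_def Hom2_iff)

text \<open>
  A 2-cell of \<open>\<Delta>(E, W)\<close> is a 2-cell \<open>\<alpha>\<close> of \<open>K\<close> subject to two equations. They hold for the whiskering of \<open>\<alpha>\<close>
  because the comparison cells of \<open>E\<close> and \<open>W\<close> are natural with respect to 2-cells.
\<close>

lemma delta_whisker_left:
  assumes a: "\<alpha> \<in> Ar2 K"
    and 1: "((C, X, Y), (Dom2 K \<alpha>, x \<cdot>\<^bsub>P0 E D\<^esub> NC (P2 E \<alpha>) X, v), (D, A, B)) \<in> DAr"
    and 2: "((C, X, Y), (Cod2 K \<alpha>, x, NC (P2 W \<alpha>) B \<cdot>\<^bsub>P0 W C\<^esub> v), (D, A, B)) \<in> DAr"
    and g: "((D, A, B), (g, p, q), (D', A', B')) \<in> DAr"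
  shows "(DComp ((D, A, B), (g, p, q), (D', A', B'))
      ((C, X, Y), (Dom2 K \<alpha>, x \<cdot>\<^bsub>P0 E D\<^esub> NC (P2 E \<alpha>) X, v), (D, A, B)), Id2 K g \<star>\<^bsub>K\<^esub> \<alpha>,
    DComp ((D, A, B), (g, p, q), (D', A', B'))
      ((C, X, Y), (Cod2 K \<alpha>, x, NC (P2 W \<alpha>) B \<cdot>\<^bsub>P0 W C\<^esub> v), (D, A, B))) \<in> DCell"
proof -
  note t = a 1[unfolded delta_ar_iff] 2[unfolded delta_ar_iff] g[unfolded delta_ar_iff]
  let ?E = "P0 E D'" let ?W = "P0 W C" let ?f = "Dom2 K \<alpha>" let ?f' = "Cod2 K \<alpha>"
  have cE: "category ?E" and cW: "category ?W" using t by (simp_all add: simps)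
  have x: "x \<in> Ar (P0 E D)" "Src (P0 E D) x = FOb (P1 E ?f') X" using t by auto
  have v: "v \<in> Ar (P0 W C)" "Tgt (P0 W C) v = FOb (P1 W ?f) B" using t by auto
  have e: "Inv ?E (NC (PC E g ?f') X) \<cdot>\<^bsub>?E\<^esub> NC (P2 E (Id2 K g \<star>\<^bsub>K\<^esub> \<alpha>)) X =
     FAr (P1 E g) (NC (P2 E \<alpha>) X) \<cdot>\<^bsub>?E\<^esub> Inv ?E (NC (PC E g ?f) X)"
    by (intro category.Inv_square[OF cE] E.PC_natural_left) (use t in \<open>simp_all add: simps\<close>)
  have w: "NC (P2 W (Id2 K g \<star>\<^bsub>K\<^esub> \<alpha>)) B' \<cdot>\<^bsub>?W\<^esub> (NC (PC W ?f g) B' \<cdot>\<^bsub>?W\<^esub> (FAr (P1 W ?f) q \<cdot>\<^bsub>?W\<^esub> v)) =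
      NC (PC W ?f' g) B' \<cdot>\<^bsub>?W\<^esub> (NC (P2 W \<alpha>) (FOb (P1 W g) B') \<cdot>\<^bsub>?W\<^esub> (FAr (P1 W ?f) q \<cdot>\<^bsub>?W\<^esub> v))"
    by (rule category.extend_square[OF cW W.PC_natural_right[of g \<alpha> C B', simplified, symmetric]])
      (use t in \<open>simp_all add: simps\<close>)
  have w': "NC (P2 W \<alpha>) (FOb (P1 W g) B') \<cdot>\<^bsub>?W\<^esub> (FAr (P1 W ?f) q \<cdot>\<^bsub>?W\<^esub> v) =
      FAr (P1 W ?f') q \<cdot>\<^bsub>?W\<^esub> (NC (P2 W \<alpha>) B \<cdot>\<^bsub>?W\<^esub> v)"
    by (rule category.extend_square[OF cW W.P2_natural[of \<alpha> q B "FOb (P1 W g) B'" C, simplified]])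
      (use t in \<open>simp_all add: simps\<close>)
  show ?thesis
    unfolding delta_comp_eq delta_cell_iff
    by (intro conjI delta_comp_ar[unfolded delta_comp_eq, OF 1 g] delta_comp_ar[unfolded delta_comp_eq, OF 2 g])
      (use t x v e w w' in \<open>simp_all add: simps\<close>)
qed

lemma delta_whisker_right:
  assumes a: "\<alpha> \<in> Ar2 K"
    and 1: "((C, X, Y), (Dom2 K \<alpha>, x \<cdot>\<^bsub>P0 E D\<^esub> NC (P2 E \<alpha>) X, v), (D, A, B)) \<in> DAr"
    and 2: "((C, X, Y), (Cod2 K \<alpha>, x, NC (P2 W \<alpha>) B \<cdot>\<^bsub>P0 W C\<^esub> v), (D, A, B)) \<in> DAr"
    and g: "((C', X', Y'), (f, p, q), (C, X, Y)) \<in> DAr"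
  shows "(DComp ((C, X, Y), (Dom2 K \<alpha>, x \<cdot>\<^bsub>P0 E D\<^esub> NC (P2 E \<alpha>) X, v), (D, A, B))
      ((C', X', Y'), (f, p, q), (C, X, Y)), \<alpha> \<star>\<^bsub>K\<^esub> Id2 K f,
    DComp ((C, X, Y), (Cod2 K \<alpha>, x, NC (P2 W \<alpha>) B \<cdot>\<^bsub>P0 W C\<^esub> v), (D, A, B))
      ((C', X', Y'), (f, p, q), (C, X, Y))) \<in> DCell"
proof -
  note t = a 1[unfolded delta_ar_iff] 2[unfolded delta_ar_iff] g[unfolded delta_ar_iff]
  let ?E = "P0 E D" let ?W = "P0 W C'" let ?g = "Dom2 K \<alpha>" let ?g' = "Cod2 K \<alpha>"
  have cE: "category ?E" and cW: "category ?W" using t by (simp_all add: simps)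
  have x: "x \<in> Ar (P0 E D)" "Src (P0 E D) x = FOb (P1 E ?g') X" using t by auto
  have v: "v \<in> Ar (P0 W C)" "Tgt (P0 W C) v = FOb (P1 W ?g) B" using t by auto
  have e: "Inv ?E (NC (PC E ?g' f) X') \<cdot>\<^bsub>?E\<^esub> NC (P2 E (\<alpha> \<star>\<^bsub>K\<^esub> Id2 K f)) X' =
     NC (P2 E \<alpha>) (FOb (P1 E f) X') \<cdot>\<^bsub>?E\<^esub> Inv ?E (NC (PC E ?g f) X')"
    by (intro category.Inv_square[OF cE] E.PC_natural_right) (use t in \<open>simp_all add: simps\<close>)
  have e': "NC (P2 E \<alpha>) X \<cdot>\<^bsub>?E\<^esub> (FAr (P1 E ?g) p \<cdot>\<^bsub>?E\<^esub> Inv ?E (NC (PC E ?g f) X')) =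
     FAr (P1 E ?g') p \<cdot>\<^bsub>?E\<^esub> (NC (P2 E \<alpha>) (FOb (P1 E f) X') \<cdot>\<^bsub>?E\<^esub> Inv ?E (NC (PC E ?g f) X'))"
    by (rule category.extend_square[OF cE E.P2_natural]) (use t in \<open>simp_all add: simps\<close>)
  have w: "NC (P2 W (\<alpha> \<star>\<^bsub>K\<^esub> Id2 K f)) B \<cdot>\<^bsub>?W\<^esub> (NC (PC W f ?g) B \<cdot>\<^bsub>?W\<^esub> (FAr (P1 W f) v \<cdot>\<^bsub>?W\<^esub> q)) =
      NC (PC W f ?g') B \<cdot>\<^bsub>?W\<^esub> (FAr (P1 W f) (NC (P2 W \<alpha>) B) \<cdot>\<^bsub>?W\<^esub> (FAr (P1 W f) v \<cdot>\<^bsub>?W\<^esub> q))"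
    by (rule category.extend_square[OF cW W.PC_natural_left[of f \<alpha> C' B, simplified, symmetric]])
      (use t x v in \<open>simp_all add: simps\<close>)
  show ?thesis
    unfolding delta_comp_eq delta_cell_iff
    by (intro conjI delta_comp_ar[unfolded delta_comp_eq, OF g 1] delta_comp_ar[unfolded delta_comp_eq, OF g 2])
      (use t x v e e' w in \<open>simp_all add: simps\<close>)
qed

end

lemma (in weight) category_Delta: "category (cat1 (Delta K E W))"
proof (rule categoryI, unfold cat1_def, simp_all only: Delta_sel cat.select_convs)
  fix a assume a: "a \<in> DAr"
  show "fst a \<in> DOb" "snd (snd a) \<in> DOb"
    by (rule delta_arE[OF a], simp add: delta_ar_iff delta_ob_iff)+
  show "DComp a (DId (fst a)) = a" "DComp (DId (snd (snd a))) a = a"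
    by (rule delta_arE[OF a], simp add: delta_comp_id)+
next
  fix a b assume a: "a \<in> DAr" and b: "b \<in> DAr" and ab: "fst b = snd (snd a)"
  show "DComp b a \<in> DAr \<and> fst (DComp b a) = fst a \<and>
      snd (snd (DComp b a)) = snd (snd b)"
    by (rule delta_arE[OF a], rule delta_arE[OF b], use ab in \<open>simp add: delta_comp_ar\<close>) (simp add: delta_comp_eq)
next
  fix a b c assume a: "a \<in> DAr" and b: "b \<in> DAr" and c: "c \<in> DAr"
    and e: "fst b = snd (snd a)" "fst c = snd (snd b)"
  show "DComp (DComp c b) a = DComp c (DComp b a)"
    by (rule delta_arE[OF a], rule delta_arE[OF b], rule delta_arE[OF c], use e in \<open>simp add: delta_comp_assoc\<close>)
next
  fix P assume "P \<in> DOb"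
  then show "DId P \<in> DAr" "fst (DId P) = P" "snd (snd (DId P)) = P"
    by (cases P; simp add: delta_id_eq delta_ar_iff delta_ob_iff simps)+
qed

sublocale weight \<subseteq> Delta: whiskered "Delta K E W"
proof (rule whiskered.intro, simp_all only: Delta_sel)
  show "category (cat1 (Delta K E W))" by (rule category_Delta)
next
  fix c assume c: "c \<in> DCell"
  show "fst c \<in> DAr \<and> snd (snd c) \<in> DAr \<and>
      fst (snd (snd c)) = fst (fst c) \<and> snd (snd (snd (snd c))) = snd (snd (fst c))"
    by (rule delta_cellE[OF c]) simp
next
  fix c g assume c: "c \<in> DCell" and g: "g \<in> DAr" and e: "fst g = snd (snd (fst c))"
  show "\<exists>\<beta>\<in>DCell. fst \<beta> = DComp g (fst c) \<and> snd (snd \<beta>) = DComp g (snd (snd c))"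
  proof -
    obtain C X Y D A B \<alpha> x v where \<alpha>: "\<alpha> \<in> Ar2 K"
      and c': "c = (((C, X, Y), (Dom2 K \<alpha>, x \<cdot>\<^bsub>P0 E D\<^esub> NC (P2 E \<alpha>) X, v), (D, A, B)), \<alpha>,
         ((C, X, Y), (Cod2 K \<alpha>, x, NC (P2 W \<alpha>) B \<cdot>\<^bsub>P0 W C\<^esub> v), (D, A, B)))"
      and ar: "((C, X, Y), (Dom2 K \<alpha>, x \<cdot>\<^bsub>P0 E D\<^esub> NC (P2 E \<alpha>) X, v), (D, A, B)) \<in> DAr"
        "((C, X, Y), (Cod2 K \<alpha>, x, NC (P2 W \<alpha>) B \<cdot>\<^bsub>P0 W C\<^esub> v), (D, A, B)) \<in> DAr"
      by (rule delta_cellE[OF c])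
    obtain h p q D' A' B' where "g = ((D, A, B), (h, p, q), (D', A', B'))" using e c' by (cases g) auto
    then show ?thesis using g c' by (intro bexI[OF _ delta_whisker_left[OF \<alpha> ar]]) simp_all
  qed
next
  fix c f assume c: "c \<in> DCell" and f: "f \<in> DAr" and e: "snd (snd f) = fst (fst c)"
  show "\<exists>\<beta>\<in>DCell. fst \<beta> = DComp (fst c) f \<and> snd (snd \<beta>) = DComp (snd (snd c)) f"
  proof -
    obtain C X Y D A B \<alpha> x v where \<alpha>: "\<alpha> \<in> Ar2 K"
      and c': "c = (((C, X, Y), (Dom2 K \<alpha>, x \<cdot>\<^bsub>P0 E D\<^esub> NC (P2 E \<alpha>) X, v), (D, A, B)), \<alpha>,
         ((C, X, Y), (Cod2 K \<alpha>, x, NC (P2 W \<alpha>) B \<cdot>\<^bsub>P0 W C\<^esub> v), (D, A, B)))"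
      and ar: "((C, X, Y), (Dom2 K \<alpha>, x \<cdot>\<^bsub>P0 E D\<^esub> NC (P2 E \<alpha>) X, v), (D, A, B)) \<in> DAr"
        "((C, X, Y), (Cod2 K \<alpha>, x, NC (P2 W \<alpha>) B \<cdot>\<^bsub>P0 W C\<^esub> v), (D, A, B)) \<in> DAr"
      by (rule delta_cellE[OF c])
    obtain h p q C' X' Y' where "f = ((C', X', Y'), (h, p, q), (C, X, Y))" using e c' by (cases f) auto
    then show ?thesis using f c' by (intro bexI[OF _ delta_whisker_right[OF \<alpha> ar]]) simp_all
  qed
qed

context weight
begin

lemma cartesian_iff: "cartesian K E W ((C, X, Y), (f, u, v), (D, A, B)) \<longleftrightarrow>
    ((C, X, Y), (f, u, v), (D, A, B)) \<in> DAr \<and> invertible (P0 E D) u \<and> invertible (P0 W C) v"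
  by (simp add: cartesian_def)

lemma cartesian_ar: "cartesian K E W a \<Longrightarrow> a \<in> DAr"
  by (auto simp: cartesian_def)

lemma Sigma_cart_sub: "Sigma_cart K E W \<subseteq> Ar (pi0 (Delta K E W))"
  by (auto simp: Sigma_cart_def Delta.pi0_sel Delta_sel cartesian_ar)

end

sublocale weight \<subseteq> Frac: fraction_data "pi0 (Delta K E W)" "Sigma_cart K E W"
  using Delta.category_pi0 Sigma_cart_sub by (simp add: fraction_data_def fraction_data_axioms_def)

section \<open>The category of fractions of triples\<close>

context weight
begin

abbreviation "loc a \<equiv> star_ar K E W a"
abbreviation "ST \<equiv> Star K E W"

text \<open>
  The comparison of \<open>\<Phi>\<close> and \<open>\<Psi>\<close> uses \<open>E \<star> W\<close> only through the facts of this section: it is a category;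
  \<open>loc\<close> is functorial, constant along 2-cells and inverts cartesian arrows; and functors on \<open>E \<star> W\<close> can be
  constructed and compared, and naturality between them tested, on the values of \<open>loc\<close>.
\<close>

lemma Star_category: "category ST"
  unfolding Star_def by (rule Frac.category_fractions)

lemma Star_Ob: "Ob ST = DOb"
  by (simp add: Star_def Frac.fractions_simps Delta.pi0_sel Delta_sel)

lemma star_ar_simps:
  assumes "a \<in> DAr"
  shows "loc a \<in> Ar ST" "Src ST (loc a) = fst a" "Tgt ST (loc a) = snd (snd a)"
  using assms by (simp_all add: Star_def star_ar_def Frac.to_fractions_simps Delta.pi0_sel Delta_sel)

lemma star_ar_id: "P \<in> DOb \<Longrightarrow> loc (DId P) = Idt ST P"
  using Frac.to_fractions_Idt[of P] by (simp add: Star_def star_ar_def Delta.pi0_sel Delta_sel)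

lemma star_ar_comp:
  assumes "a \<in> DAr" "b \<in> DAr" "fst b = snd (snd a)"
  shows "loc (DComp b a) = loc b \<cdot>\<^bsub>ST\<^esub> loc a"
  using assms Frac.to_fractions_Cmp[of "component (Delta K E W) a" "component (Delta K E W) b"] Delta.pi0_comp[of a b]
  by (simp add: Star_def star_ar_def Delta.pi0_sel Delta_sel)

lemma star_ar_cell: "(a, \<alpha>, b) \<in> DCell \<Longrightarrow> loc a = loc b"
  using Delta.component_cell[of "(a, \<alpha>, b)"] by (simp add: star_ar_def Delta_sel)

lemma star_ar_invertible: "cartesian K E W a \<Longrightarrow> invertible ST (loc a)"
  unfolding Star_def star_ar_def invertible_def
  by (rule exI, rule Frac.to_fractions_inverses) (simp add: Sigma_cart_def)

lemma Star_induct [consumes 1, case_names Idt Fwd Bwd Cmp]: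
  assumes c: "c \<in> Ar ST"
    and Idt: "\<And>P. P \<in> DOb \<Longrightarrow> Q (Idt ST P)"
    and Fwd: "\<And>a. a \<in> DAr \<Longrightarrow> Q (loc a)"
    and Bwd: "\<And>a t. cartesian K E W a \<Longrightarrow> inverses ST (loc a) t \<Longrightarrow> Q t"
    and Cmp: "\<And>c d. c \<in> Ar ST \<Longrightarrow> d \<in> Ar ST \<Longrightarrow> Src ST d = Tgt ST c \<Longrightarrow> Q c \<Longrightarrow> Q d \<Longrightarrow> Q (d \<cdot>\<^bsub>ST\<^esub> c)"
  shows "Q c"
  using c unfolding Star_def
proof (induction rule: Frac.fractions_induct)
  case (Idt a) then show ?case using assms(2) by (simp add: Star_def Delta.pi0_sel Delta_sel)
next
  case (Fwd f) then show ?case using assms(3) by (auto simp: star_ar_def Delta.pi0_sel Delta_sel)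
next
  case (Bwd s t) then show ?case using assms(4) by (auto simp: star_ar_def Star_def Sigma_cart_def)
next
  case (Cmp c d) then show ?case using assms(5) by (simp add: Star_def)
qed

text \<open>
  The universal properties of \<open>pi0\<close> and of the category of fractions combined: being constant along
  2-cells gives a functor on connected components, and inverting cartesian arrows extends it to
  fractions.
\<close>

lemma Star_functor_exists:
  fixes \<X> :: "('x, 'y) cat"
  assumes X: "category \<X>" and o: "\<And>P. P \<in> DOb \<Longrightarrow> o' P \<in> Ob \<X>"
    and g: "\<And>a. a \<in> DAr \<Longrightarrow> g a \<in> Ar \<X> \<and> Src \<X> (g a) = o' (fst a) \<and> Tgt \<X> (g a) = o' (snd (snd a))"
    and id: "\<And>P. P \<in> DOb \<Longrightarrow> g (DId P) = Idt \<X> (o' P)"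
    and comp: "\<And>a b. a \<in> DAr \<Longrightarrow> b \<in> DAr \<Longrightarrow> fst b = snd (snd a) \<Longrightarrow>
        g (DComp b a) = g b \<cdot>\<^bsub>\<X>\<^esub> g a"
    and cell: "\<And>a \<alpha> b. (a, \<alpha>, b) \<in> DCell \<Longrightarrow> g a = g b"
    and cart: "\<And>a. cartesian K E W a \<Longrightarrow> invertible \<X> (g a)"
  shows "\<exists>H\<in>Functors ST \<X>. (\<forall>P\<in>DOb. FOb H P = o' P) \<and> (\<forall>a\<in>DAr. FAr H (loc a) = g a)"
proof -
  let ?D = "Delta K E W"
  define G where "G = \<lparr>FDom = pi0 ?D, FCod = \<X>, FOb = (\<lambda>P\<in>DOb. o' P), FAr = (\<lambda>c\<in>Ar (pi0 ?D). g (rep c))\<rparr>"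
  have inv: "g a = g b" if "component ?D a = component ?D b" for a b
    by (rule Delta.component_invariant[OF _ that]) (use cell in \<open>auto simp: Delta_sel\<close>)
  have G: "FAr G (component ?D a) = g a" if "a \<in> DAr" for a
    using that inv[OF Delta.component_rep] by (simp add: G_def Delta.pi0_sel Delta_sel)
  note s = Delta.pi0_sel Delta_sel
  note D = category_simps[OF Delta.cat1, unfolded cat1_def, simplified, unfolded Delta_sel]
  have oG: "FOb G P = o' P" if "P \<in> DOb" for P using that by (simp add: G_def)
  have "is_functor G"
  proof (rule is_functorI[of _ "pi0 ?D" \<X>])
    show "FAr G c \<in> Ar \<X> \<and> Src \<X> (FAr G c) = FOb G (Src (pi0 ?D) c) \<and> Tgt \<X> (FAr G c) = FOb G (Tgt (pi0 ?D) c)"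
      if c: "c \<in> Ar (pi0 ?D)" for c
    proof -
      obtain a where a: "c = component ?D a" "a \<in> DAr" using c by (auto simp: s)
      moreover have "fst a \<in> DOb" "snd (snd a) \<in> DOb" using a(2) D by auto
      ultimately show ?thesis by (simp add: s G oG g)
    qed
    fix c d assume "c \<in> Ar (pi0 ?D)" "d \<in> Ar (pi0 ?D)" "Src (pi0 ?D) d = Tgt (pi0 ?D) c"
    then show "FAr G (d \<cdot>\<^bsub>pi0 ?D\<^esub> c) = FAr G d \<cdot>\<^bsub>\<X>\<^esub> FAr G c"
      by (auto simp: s G Delta.pi0_comp D comp)
  qed (auto simp: s G oG X D g id o Delta.category_pi0, auto simp: G_def s)
  moreover have "invertible \<X> (FAr G c)" if "c \<in> Sigma_cart K E W" for c
    using that by (auto simp: Sigma_cart_def G[OF cartesian_ar] cart)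
  moreover have "FDom G = pi0 ?D" "FCod G = \<X>" by (simp_all add: G_def)
  ultimately interpret inverting_functor "pi0 ?D" "Sigma_cart K E W" G \<X>
    by (intro inverting_functor.intro inverting_functor_axioms.intro Frac.fraction_data_axioms)
  obtain H where "H \<in> Functors (fractions (pi0 ?D) (Sigma_cart K E W)) \<X>"
      "\<And>a. a \<in> Ob (pi0 ?D) \<Longrightarrow> FOb H a = FOb G a"
      "\<And>f. f \<in> Ar (pi0 ?D) \<Longrightarrow> FAr H (to_fractions (pi0 ?D) (Sigma_cart K E W) f) = FAr G f"
    using functor_of_fractions by blast
  then show ?thesis
    by (intro bexI[of _ H]) (auto simp: Star_def star_ar_def s oG G)
qed

lemma Star_functor_eqI:
  fixes G H :: "(_, _, 'x, 'y) fnct"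
  assumes G: "G \<in> Functors ST \<X>" and H: "H \<in> Functors ST \<X>"
    and o: "\<And>P. P \<in> DOb \<Longrightarrow> FOb G P = FOb H P"
    and a: "\<And>a. a \<in> DAr \<Longrightarrow> FAr G (loc a) = FAr H (loc a)"
  shows "G = H"
proof (rule functor_eqI)
  note f = G[unfolded Functors_iff] H[unfolded Functors_iff]
  show "is_functor G" "is_functor H" "FDom G = FDom H" "FCod G = FCod H" using f by auto
  show "FOb G P = FOb H P" if "P \<in> Ob (FDom H)" for P using that o f by (simp add: Star_Ob)
  fix c assume "c \<in> Ar (FDom H)"
  then have "c \<in> Ar ST" using f by simp
  then show "FAr G c = FAr H c"
  proof (induction rule: Star_induct)
    case (Idt P) then show ?case using f o by (simp add: functor_simps Star_Ob)
  next
    case (Fwd b) then show ?case by (rule a)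
  next
    case (Bwd b t)
    have X: "category \<X>" using f is_functor.cod by auto
    have "inverses \<X> (FAr G (loc b)) (FAr G t)" "inverses \<X> (FAr H (loc b)) (FAr H t)"
      using is_functor.FAr_inverses[of G] is_functor.FAr_inverses[of H] f Bwd by auto
    then show ?case using a[OF cartesian_ar[OF Bwd(1)]] category.inverses_unique[OF X] by simp
  next
    case (Cmp c d) then show ?case using f by (simp add: functor_simps)
  qed
qed

text \<open>
  Naturality with respect to a cartesian arrow implies naturality with respect to its formal inverse,
  by \<open>Inv_square\<close>.
\<close>

lemma Star_natural:
  fixes G H :: "(_, _, 'x, 'y) fnct"
  assumes G: "G \<in> Functors ST \<X>" and H: "H \<in> Functors ST \<X>"
    and m: "\<And>P. P \<in> DOb \<Longrightarrow> m P \<in> Ar \<X> \<and> Src \<X> (m P) = FOb G P \<and> Tgt \<X> (m P) = FOb H P"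
    and a: "\<And>a. a \<in> DAr \<Longrightarrow> m (snd (snd a)) \<cdot>\<^bsub>\<X>\<^esub> FAr G (loc a) = FAr H (loc a) \<cdot>\<^bsub>\<X>\<^esub> m (fst a)"
    and c: "c \<in> Ar ST"
  shows "m (Tgt ST c) \<cdot>\<^bsub>\<X>\<^esub> FAr G c = FAr H c \<cdot>\<^bsub>\<X>\<^esub> m (Src ST c)"
proof -
  note f = G[unfolded Functors_iff] H[unfolded Functors_iff]
  have X: "category \<X>" using f is_functor.cod by auto
  note s = f X Star_category functor_simps category_simps[OF X] category_simps[OF Star_category] Star_Ob m
  have o: "\<And>c. c \<in> Ar ST \<Longrightarrow> Src ST c \<in> DOb" "\<And>c. c \<in> Ar ST \<Longrightarrow> Tgt ST c \<in> DOb"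
    using category.ends[OF Star_category] by (auto simp: Star_Ob)
  show ?thesis using c
  proof (induction rule: Star_induct)
    case (Idt P) then show ?case by (simp add: s)
  next
    case (Fwd b) then show ?case using a star_ar_simps by simp
  next
    case (Bwd b t)
    have b: "b \<in> DAr" using Bwd cartesian_ar by simp
    have i: "inverses \<X> (FAr G (loc b)) (FAr G t)" "inverses \<X> (FAr H (loc b)) (FAr H t)"
      using is_functor.FAr_inverses[of G] is_functor.FAr_inverses[of H] f Bwd by auto
    have "Inv \<X> (FAr H (loc b)) \<cdot>\<^bsub>\<X>\<^esub> m (snd (snd b)) = m (fst b) \<cdot>\<^bsub>\<X>\<^esub> Inv \<X> (FAr G (loc b))"
      using i star_ar_simps[OF b] o[of "loc b"] b
      by (intro category.Inv_square[OF X] a[symmetric]) (auto simp: invertible_def s)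
    then show ?case
      using i[THEN category.Inv_eq[OF X]] Bwd(2) star_ar_simps[OF b] by (simp add: inverses_def Hom_iff)
  next
    case (Cmp c d)
    have "m (Tgt ST d) \<cdot>\<^bsub>\<X>\<^esub> (FAr G d \<cdot>\<^bsub>\<X>\<^esub> FAr G c) = FAr H d \<cdot>\<^bsub>\<X>\<^esub> (m (Src ST d) \<cdot>\<^bsub>\<X>\<^esub> FAr G c)"
      by (rule category.extend_square[OF X Cmp(5)]) (use Cmp in \<open>simp_all add: s o\<close>)
    then show ?case using Cmp by (simp add: s o)
  qed
qed

end

section \<open>Pseudo-natural transformations in components\<close>

lemma precomp_nt_sel [simp]: "NDom (precomp_nt X \<alpha>) = precomp X (NDom \<alpha>)" "NCod (precomp_nt X \<alpha>) = precomp X (NCod \<alpha>)"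
  "H \<in> Functors (FCod (NDom \<alpha>)) X \<Longrightarrow> NC (precomp_nt X \<alpha>) H = nt_id H \<star>\<^sub>N \<alpha>"
  by (simp_all add: precomp_nt_def)

lemma is_nt_precomp_nt:
  assumes a: "is_nt \<alpha>" shows "is_nt (precomp_nt X \<alpha>)"
proof (rule is_ntI[of _ "precomp X (NDom \<alpha>)" "precomp X (NCod \<alpha>)" "FunCat (FCod (NDom \<alpha>)) X" "FunCat (FDom (NDom \<alpha>)) X"])
  fix \<sigma> assume "\<sigma> \<in> Ar (FunCat (FCod (NDom \<alpha>)) X)"
  then have s: "is_nt \<sigma>" "FDom (NDom \<sigma>) = FCod (NDom \<alpha>)" "FCod (NDom \<sigma>) = X"
    "\<sigma> \<in> Ar (FunCat (FCod (NDom \<alpha>)) X)" by (simp_all add: FunCat_Ar)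
  have "(nt_id (NCod \<sigma>) \<star>\<^sub>N \<alpha>) \<bullet>\<^sub>N (\<sigma> \<star>\<^sub>N nt_id (NDom \<alpha>)) = (\<sigma> \<star>\<^sub>N nt_id (NCod \<alpha>)) \<bullet>\<^sub>N (nt_id (NDom \<sigma>) \<star>\<^sub>N \<alpha>)"
  proof (rule nt_eqI)
    fix x assume "x \<in> Ob (FDom (NDom ((\<sigma> \<star>\<^sub>N nt_id (NCod \<alpha>)) \<bullet>\<^sub>N (nt_id (NDom \<sigma>) \<star>\<^sub>N \<alpha>))))"
    then have x: "x \<in> Ob (FDom (NDom \<alpha>))" by simp
    have "NC \<sigma> (FOb (NCod \<alpha>) x) \<cdot>\<^bsub>X\<^esub> FAr (NDom \<sigma>) (NC \<alpha> x) = FAr (NCod \<sigma>) (NC \<alpha> x) \<cdot>\<^bsub>X\<^esub> NC \<sigma> (FOb (NDom \<alpha>) x)"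
      by (rule is_nt.NC_natural[OF s(1,2,3)]) (use a x in \<open>simp_all add: nt_simps\<close>)
    then show "NC ((nt_id (NCod \<sigma>) \<star>\<^sub>N \<alpha>) \<bullet>\<^sub>N (\<sigma> \<star>\<^sub>N nt_id (NDom \<alpha>))) x =
        NC ((\<sigma> \<star>\<^sub>N nt_id (NCod \<alpha>)) \<bullet>\<^sub>N (nt_id (NDom \<sigma>) \<star>\<^sub>N \<alpha>)) x"
      using x a s by (simp add: whisker_left_NC whisker_right_NC nt_simps)
  qed (use a s in \<open>simp_all add: is_nt_vcomp is_nt_whisker_left is_nt_whisker_right nt_simps\<close>)
  then show "NC (precomp_nt X \<alpha>) (Tgt (FunCat (FCod (NDom \<alpha>)) X) \<sigma>) \<cdot>\<^bsub>FunCat (FDom (NDom \<alpha>)) X\<^esub>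
      FAr (precomp X (NDom \<alpha>)) \<sigma> =
      FAr (precomp X (NCod \<alpha>)) \<sigma> \<cdot>\<^bsub>FunCat (FDom (NDom \<alpha>)) X\<^esub>
      NC (precomp_nt X \<alpha>) (Src (FunCat (FCod (NDom \<alpha>)) X) \<sigma>)"
    using a s by (simp add: nt_simps Functors_iff)
qed (use a in \<open>simp_all add: Functors_iff nt_simps is_functor_precomp FunCat_Ar is_nt_whisker_left\<close>, simp add: precomp_nt_def)

lemma CatInto_sel [simp]: "P0 (CatInto E X) C = FunCat (P0 E C) X" "P1 (CatInto E X) f = precomp X (P1 E f)"
  "P2 (CatInto E X) \<alpha> = precomp_nt X (P2 E \<alpha>)" "PC (CatInto E X) f g = precomp_nt X (PC E g f)"
  by (simp_all add: CatInto_def)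

text \<open>
  The values of a transformation between functors into \<open>FunCat B X\<close> are themselves transformations,
  so it is determined by its double components, which are arrows of \<open>X\<close>. The point of this section is
  to express all the axioms of pseudo-natural transformations and modifications in terms of these.
\<close>

context
  fixes \<sigma> :: "('o, 'a, ('p, 'b, 'q, 'c) fnct, ('p, 'b, 'q, 'c) nt) nt" and B X
  assumes s: "is_nt \<sigma>" "FCod (NDom \<sigma>) = FunCat B X"
begin

lemma nt2_NC: "Y \<in> Ob (FDom (NDom \<sigma>)) \<Longrightarrow> is_nt (NC \<sigma> Y)"
  "Y \<in> Ob (FDom (NDom \<sigma>)) \<Longrightarrow> NDom (NC \<sigma> Y) = FOb (NDom \<sigma>) Y"
  "Y \<in> Ob (FDom (NDom \<sigma>)) \<Longrightarrow> NCod (NC \<sigma> Y) = FOb (NCod \<sigma>) Y"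
  "Y \<in> Ob (FDom (NDom \<sigma>)) \<Longrightarrow> FDom (FOb (NDom \<sigma>) Y) = B"
  "Y \<in> Ob (FDom (NDom \<sigma>)) \<Longrightarrow> FCod (FOb (NDom \<sigma>) Y) = X"
  using is_nt.NC_Ar[OF s, of Y] is_nt.Src_NC[OF s, of Y] is_nt.Tgt_NC[OF s, of Y]
  by (auto simp: FunCat_Ar)

end

lemma nt2_eq_iff:
  fixes \<sigma> \<tau> :: "('o, 'a, ('p, 'b, 'q, 'c) fnct, ('p, 'b, 'q, 'c) nt) nt"
  assumes s: "is_nt \<sigma>" "is_nt \<tau>" "NDom \<sigma> = NDom \<tau>" "NCod \<sigma> = NCod \<tau>" "FCod (NDom \<tau>) = FunCat B X" "FDom (NDom \<tau>) = A"
  shows "\<sigma> = \<tau> \<longleftrightarrow> (\<forall>Y\<in>Ob A. \<forall>x\<in>Ob B. NC (NC \<sigma> Y) x = NC (NC \<tau> Y) x)"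
proof
  assume *: "\<forall>Y\<in>Ob A. \<forall>x\<in>Ob B. NC (NC \<sigma> Y) x = NC (NC \<tau> Y) x"
  show "\<sigma> = \<tau>"
  proof (rule nt_eqI)
    fix Y assume "Y \<in> Ob (FDom (NDom \<tau>))"
    then show "NC \<sigma> Y = NC \<tau> Y"
      using * s by (intro nt_eqI) (auto simp: nt2_NC)
  qed (use s in auto)
qed simp

lemma nt2_vcomp:
  fixes \<sigma> \<tau> :: "('o, 'a, ('p, 'b, 'q, 'c) fnct, ('p, 'b, 'q, 'c) nt) nt"
  assumes s: "is_nt \<sigma>" "FCod (NDom \<sigma>) = FunCat B X" "Y \<in> Ob (FDom (NDom \<sigma>))" "x \<in> Ob B"
  shows "NC (NC (\<tau> \<bullet>\<^sub>N \<sigma>) Y) x = NC (NC \<tau> Y) x \<cdot>\<^bsub>X\<^esub> NC (NC \<sigma> Y) x"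
  using assms nt2_NC[OF s(1,2,3)] by simp

lemma nt2_whisker_precomp:
  fixes \<sigma> :: "('o, 'a, ('p, 'b, 'q, 'c) fnct, ('p, 'b, 'q, 'c) nt) nt"
  assumes s: "is_nt \<sigma>" "FCod (NDom \<sigma>) = FunCat B X" "Y \<in> Ob (FDom (NDom \<sigma>))"
    and G: "is_functor G" "FCod G = B" and x: "x \<in> Ob (FDom G)"
  shows "NC (NC (nt_id (precomp X G) \<star>\<^sub>N \<sigma>) Y) x = NC (NC \<sigma> Y) (FOb G x)"
proof -
  have "NC \<sigma> Y \<in> Ar (FunCat (FCod G) X)" using assms nt2_NC[OF s(1,2,3)] by (simp add: FunCat_Ar)
  then show ?thesis
    using assms nt2_NC[OF s(1,2,3)] by (simp add: whisker_left_NC whisker_right_NC is_functor_precomp)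
qed

lemma nt2_precomp_nt_whisker:
  fixes H :: "('o, 'a, ('p, 'b, 'q, 'c) fnct, ('p, 'b, 'q, 'c) nt) fnct"
  assumes H: "is_functor H" "FCod H = FunCat (FCod (NDom \<alpha>)) X" "Y \<in> Ob (FDom H)"
    and a: "is_nt \<alpha>" "x \<in> Ob (FDom (NDom \<alpha>))"
  shows "NC (NC (precomp_nt X \<alpha> \<star>\<^sub>N nt_id H) Y) x = FAr (FOb H Y) (NC \<alpha> x)"
proof -
  have "FOb H Y \<in> Functors (FCod (NDom \<alpha>)) X" using is_functor.FOb_Ob[OF H] by simp
  then show ?thesis
    using assms by (simp add: whisker_left_NC whisker_right_NC is_nt_precomp_nt Functors_iff nt_simps)
qed

text \<open>
  The typing part of a pseudo-natural transformation \<open>W \<rightarrow> Cat(E, \<X>)\<close>, without its axioms. Separating the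
  two lets each axiom be stated below as an equivalence, which is used in one direction to construct
  \<open>\<Psi>(\<theta>)\<close> and in the other to verify that \<open>\<Phi>(F)\<close> is a pseudo-natural transformation.
\<close>

locale transformation_frame = weight K E W
  for K :: "('c, 'f, 't) two_cat" and E :: "('c, 'f, 't, 'eo, 'ea) cat_psf" and W :: "('c, 'f, 't, 'wo, 'wa) cat_psf" +
  fixes \<X> :: "('x, 'y) cat"
    and \<theta> :: "('c, 'f, 'wo, 'wa, ('eo, 'ea, 'x, 'y) fnct, ('eo, 'ea, 'x, 'y) nt) pnat"
  assumes X: "category \<X>"
    and frame_ob: "C \<in> Ob0 K \<Longrightarrow> TOb \<theta> C \<in> Functors (P0 W C) (FunCat (P0 E C) \<X>)"
    and frame_cell: "f \<in> Ar1 K \<Longrightarrow> TCell \<theta> f \<in> Hom (FunCat (P0 W (Cod1 K f)) (FunCat (P0 E (Dom1 K f)) \<X>))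
        (TOb \<theta> (Dom1 K f) \<circ>\<^sub>F P1 W f) (precomp \<X> (P1 E f) \<circ>\<^sub>F TOb \<theta> (Cod1 K f))"
begin

lemma TOb_functor: "C \<in> Ob0 K \<Longrightarrow> is_functor (TOb \<theta> C)"
  and TOb_dom: "C \<in> Ob0 K \<Longrightarrow> FDom (TOb \<theta> C) = P0 W C"
  and TOb_cod: "C \<in> Ob0 K \<Longrightarrow> FCod (TOb \<theta> C) = FunCat (P0 E C) \<X>"
  using frame_ob by (simp_all add: Functors_iff)

lemma TObY_functor: "C \<in> Ob0 K \<Longrightarrow> Y \<in> Ob (P0 W C) \<Longrightarrow> is_functor (FOb (TOb \<theta> C) Y)"
  and TObY_dom: "C \<in> Ob0 K \<Longrightarrow> Y \<in> Ob (P0 W C) \<Longrightarrow> FDom (FOb (TOb \<theta> C) Y) = P0 E C"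
  and TObY_cod: "C \<in> Ob0 K \<Longrightarrow> Y \<in> Ob (P0 W C) \<Longrightarrow> FCod (FOb (TOb \<theta> C) Y) = \<X>"
  using is_functor.FOb_Ob[OF TOb_functor TOb_cod, of C Y] by (simp_all add: Functors_iff TOb_dom)

lemma TObv_nt: "C \<in> Ob0 K \<Longrightarrow> v \<in> Ar (P0 W C) \<Longrightarrow> is_nt (FAr (TOb \<theta> C) v)"
  and TObv_dom: "C \<in> Ob0 K \<Longrightarrow> v \<in> Ar (P0 W C) \<Longrightarrow> NDom (FAr (TOb \<theta> C) v) = FOb (TOb \<theta> C) (Src (P0 W C) v)"
  and TObv_cod: "C \<in> Ob0 K \<Longrightarrow> v \<in> Ar (P0 W C) \<Longrightarrow> NCod (FAr (TOb \<theta> C) v) = FOb (TOb \<theta> C) (Tgt (P0 W C) v)"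
  using is_functor.FAr_Ar[OF TOb_functor TOb_cod, of C v] is_functor.Src_FAr[OF TOb_functor TOb_cod, of C v]
    is_functor.Tgt_FAr[OF TOb_functor TOb_cod, of C v] by (simp_all add: FunCat_Ar TOb_dom)

lemma TCell_nt: "f \<in> Ar1 K \<Longrightarrow> is_nt (TCell \<theta> f)"
  and TCell_dom: "f \<in> Ar1 K \<Longrightarrow> NDom (TCell \<theta> f) = TOb \<theta> (Dom1 K f) \<circ>\<^sub>F P1 W f"
  and TCell_cod: "f \<in> Ar1 K \<Longrightarrow> NCod (TCell \<theta> f) = precomp \<X> (P1 E f) \<circ>\<^sub>F TOb \<theta> (Cod1 K f)"
  using frame_cell by (simp_all add: Hom_iff FunCat_Ar)

lemmas frame_simps = simps X TOb_functor TOb_dom TOb_cod TObY_functor TObY_dom TObY_cod TObv_nt TObv_dom TObv_cod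
  TCell_nt TCell_dom TCell_cod

lemma TCellY_nt: "f \<in> Ar1 K \<Longrightarrow> Y \<in> Ob (P0 W (Cod1 K f)) \<Longrightarrow> is_nt (NC (TCell \<theta> f) Y)"
  and TCellY_dom: "f \<in> Ar1 K \<Longrightarrow> Y \<in> Ob (P0 W (Cod1 K f)) \<Longrightarrow>
     NDom (NC (TCell \<theta> f) Y) = FOb (TOb \<theta> (Dom1 K f)) (FOb (P1 W f) Y)"
  and TCellY_cod: "f \<in> Ar1 K \<Longrightarrow> Y \<in> Ob (P0 W (Cod1 K f)) \<Longrightarrow>
     NCod (NC (TCell \<theta> f) Y) = FOb (TOb \<theta> (Cod1 K f)) Y \<circ>\<^sub>F P1 E f"
  using nt2_NC[OF TCell_nt, of f "P0 E (Dom1 K f)" \<X> Y] by (simp_all add: frame_simps Functors_iff)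

text \<open>
  The functors \<open>\<theta>\<^sub>C\<close> amount to a family of objects of \<open>\<X>\<close> on which arrows of \<open>E C\<close> act through \<open>T_E\<close> and
  arrows of \<open>W C\<close> through \<open>T_W\<close>; the coherence cells amount to the arrows \<open>T_cell\<close>.
\<close>

abbreviation "T_ob C Y x \<equiv> FOb (FOb (TOb \<theta> C) Y) x"
abbreviation "T_E C Y u \<equiv> FAr (FOb (TOb \<theta> C) Y) u"
abbreviation "T_W C v x \<equiv> NC (FAr (TOb \<theta> C) v) x"
abbreviation "T_cell f Y x \<equiv> NC (NC (TCell \<theta> f) Y) x"

lemma T_ob_Ob: "C \<in> Ob0 K \<Longrightarrow> Y \<in> Ob (P0 W C) \<Longrightarrow> x \<in> Ob (P0 E C) \<Longrightarrow> T_ob C Y x \<in> Ob \<X>"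
  by (simp add: functor_simps frame_simps)

lemma T_E_Ar: "C \<in> Ob0 K \<Longrightarrow> Y \<in> Ob (P0 W C) \<Longrightarrow> u \<in> Ar (P0 E C) \<Longrightarrow> T_E C Y u \<in> Ar \<X>"
  and T_E_Src: "C \<in> Ob0 K \<Longrightarrow> Y \<in> Ob (P0 W C) \<Longrightarrow> u \<in> Ar (P0 E C) \<Longrightarrow> Src \<X> (T_E C Y u) = T_ob C Y (Src (P0 E C) u)"
  and T_E_Tgt: "C \<in> Ob0 K \<Longrightarrow> Y \<in> Ob (P0 W C) \<Longrightarrow> u \<in> Ar (P0 E C) \<Longrightarrow> Tgt \<X> (T_E C Y u) = T_ob C Y (Tgt (P0 E C) u)"
  and T_E_Idt: "C \<in> Ob0 K \<Longrightarrow> Y \<in> Ob (P0 W C) \<Longrightarrow> x \<in> Ob (P0 E C) \<Longrightarrow> T_E C Y (Idt (P0 E C) x) = Idt \<X> (T_ob C Y x)"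
  and T_E_Cmp: "C \<in> Ob0 K \<Longrightarrow> Y \<in> Ob (P0 W C) \<Longrightarrow> u \<in> Ar (P0 E C) \<Longrightarrow> u' \<in> Ar (P0 E C) \<Longrightarrow>
     Src (P0 E C) u' = Tgt (P0 E C) u \<Longrightarrow> T_E C Y (u' \<cdot>\<^bsub>P0 E C\<^esub> u) = T_E C Y u' \<cdot>\<^bsub>\<X>\<^esub> T_E C Y u"
  using functor_simps[where F = "FOb (TOb \<theta> C) Y"] by (simp_all add: frame_simps)

lemma T_W_Ar: "C \<in> Ob0 K \<Longrightarrow> v \<in> Ar (P0 W C) \<Longrightarrow> x \<in> Ob (P0 E C) \<Longrightarrow> T_W C v x \<in> Ar \<X>"
  and T_W_Src: "C \<in> Ob0 K \<Longrightarrow> v \<in> Ar (P0 W C) \<Longrightarrow> x \<in> Ob (P0 E C) \<Longrightarrow> Src \<X> (T_W C v x) = T_ob C (Src (P0 W C) v) x"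
  and T_W_Tgt: "C \<in> Ob0 K \<Longrightarrow> v \<in> Ar (P0 W C) \<Longrightarrow> x \<in> Ob (P0 E C) \<Longrightarrow> Tgt \<X> (T_W C v x) = T_ob C (Tgt (P0 W C) v) x"
  using nt_simps[where \<alpha> = "FAr (TOb \<theta> C) v"] by (simp_all add: frame_simps)

lemma T_W_Idt: "C \<in> Ob0 K \<Longrightarrow> Y \<in> Ob (P0 W C) \<Longrightarrow> x \<in> Ob (P0 E C) \<Longrightarrow> T_W C (Idt (P0 W C) Y) x = Idt \<X> (T_ob C Y x)"
  using is_functor.FAr_Idt[OF TOb_functor TOb_dom, of C Y] by (simp add: frame_simps)

lemma T_W_Cmp: "C \<in> Ob0 K \<Longrightarrow> x \<in> Ob (P0 E C) \<Longrightarrow> v \<in> Ar (P0 W C) \<Longrightarrow> v' \<in> Ar (P0 W C) \<Longrightarrow>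
     Src (P0 W C) v' = Tgt (P0 W C) v \<Longrightarrow> T_W C (v' \<cdot>\<^bsub>P0 W C\<^esub> v) x = T_W C v' x \<cdot>\<^bsub>\<X>\<^esub> T_W C v x"
  using is_functor.FAr_cmp[OF TOb_functor TOb_dom, of C v v'] by (simp add: frame_simps)

lemma T_W_natural: "C \<in> Ob0 K \<Longrightarrow> v \<in> Ar (P0 W C) \<Longrightarrow> u \<in> Ar (P0 E C) \<Longrightarrow>
    Src (P0 W C) v = Y \<Longrightarrow> Tgt (P0 W C) v = Y' \<Longrightarrow> Src (P0 E C) u = x \<Longrightarrow> Tgt (P0 E C) u = x' \<Longrightarrow>
    T_W C v x' \<cdot>\<^bsub>\<X>\<^esub> T_E C Y u = T_E C Y' u \<cdot>\<^bsub>\<X>\<^esub> T_W C v x"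
  using is_nt.NC_natural[OF TObv_nt, of C v "P0 E C" \<X> u x x'] category.Src_Ob[OF W.P0_category, of C v]
  by (simp add: frame_simps)

lemma T_cell_Ar: "f \<in> Ar1 K \<Longrightarrow> Y \<in> Ob (P0 W (Cod1 K f)) \<Longrightarrow> x \<in> Ob (P0 E (Dom1 K f)) \<Longrightarrow> T_cell f Y x \<in> Ar \<X>"
  and T_cell_Src: "f \<in> Ar1 K \<Longrightarrow> Y \<in> Ob (P0 W (Cod1 K f)) \<Longrightarrow> x \<in> Ob (P0 E (Dom1 K f)) \<Longrightarrow>
     Src \<X> (T_cell f Y x) = T_ob (Dom1 K f) (FOb (P1 W f) Y) x"
  and T_cell_Tgt: "f \<in> Ar1 K \<Longrightarrow> Y \<in> Ob (P0 W (Cod1 K f)) \<Longrightarrow> x \<in> Ob (P0 E (Dom1 K f)) \<Longrightarrow>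
     Tgt \<X> (T_cell f Y x) = T_ob (Cod1 K f) Y (FOb (P1 E f) x)"
  using nt_simps[where \<alpha> = "NC (TCell \<theta> f) Y"] by (simp_all add: frame_simps TCellY_nt TCellY_dom TCellY_cod)

lemma T_cell_natural_E: "f \<in> Ar1 K \<Longrightarrow> Dom1 K f = C \<Longrightarrow> Cod1 K f = D \<Longrightarrow> Y \<in> Ob (P0 W D) \<Longrightarrow>
    u \<in> Ar (P0 E C) \<Longrightarrow> Src (P0 E C) u = x \<Longrightarrow> Tgt (P0 E C) u = x' \<Longrightarrow>
    T_cell f Y x' \<cdot>\<^bsub>\<X>\<^esub> T_E C (FOb (P1 W f) Y) u = T_E D Y (FAr (P1 E f) u) \<cdot>\<^bsub>\<X>\<^esub> T_cell f Y x"
  using is_nt.NC_natural[OF TCellY_nt, of f Y "P0 E C" \<X> u x x'] K1_simps(1)[of f] K1_simps(2)[of f]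
    category.Src_Ob[OF E.P0_category, of C u] category.Tgt_Ob[OF E.P0_category, of C u]
  by (simp add: frame_simps TCellY_dom TCellY_cod)

lemma T_cell_natural_W:
  assumes f: "f \<in> Ar1 K" "Dom1 K f = C" "Cod1 K f = D" and x: "x \<in> Ob (P0 E C)"
    and v: "v \<in> Ar (P0 W D)" "Src (P0 W D) v = Y" "Tgt (P0 W D) v = Y'"
  shows "T_cell f Y' x \<cdot>\<^bsub>\<X>\<^esub> T_W C (FAr (P1 W f) v) x = T_W D v (FOb (P1 E f) x) \<cdot>\<^bsub>\<X>\<^esub> T_cell f Y x"
proof -
  have o: "C \<in> Ob0 K" "D \<in> Ob0 K" using K1_simps f by blast+
  have Y: "Y \<in> Ob (P0 W D)" "Y' \<in> Ob (P0 W D)" using v o by (auto simp: frame_simps)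
  have va: "FAr (TOb \<theta> D) v \<in> Ar (FunCat (P0 E D) \<X>)" using v o Y by (simp add: FunCat_Ar frame_simps)
  have "NC (TCell \<theta> f) Y' \<bullet>\<^sub>N FAr (TOb \<theta> C) (FAr (P1 W f) v) = FAr (TOb \<theta> D) v \<star>\<^sub>N nt_id (P1 E f) \<bullet>\<^sub>N NC (TCell \<theta> f) Y"
    using is_nt.NC_natural[OF TCell_nt[of f], of "P0 W D" "FunCat (P0 E C) \<X>" v Y Y'] f o v Y va by (simp add: frame_simps)
  then have "NC (NC (TCell \<theta> f) Y' \<bullet>\<^sub>N FAr (TOb \<theta> C) (FAr (P1 W f) v)) x =
     NC (FAr (TOb \<theta> D) v \<star>\<^sub>N nt_id (P1 E f) \<bullet>\<^sub>N NC (TCell \<theta> f) Y) x" by simp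
  then show ?thesis using f o v Y x by (simp add: frame_simps TCellY_dom TCellY_cod TCellY_nt whisker_right_NC)
qed

lemmas t_simps = T_ob_Ob T_E_Ar T_E_Src T_E_Tgt T_E_Idt T_E_Cmp T_W_Ar T_W_Src T_W_Tgt T_W_Idt T_W_Cmp T_cell_Ar T_cell_Src T_cell_Tgt

lemma invertible_iff:
  assumes f: "f \<in> Ar1 K"
  shows "invertible (FunCat (P0 W (Cod1 K f)) (FunCat (P0 E (Dom1 K f)) \<X>)) (TCell \<theta> f) \<longleftrightarrow>
    (\<forall>Y\<in>Ob (P0 W (Cod1 K f)). \<forall>x\<in>Ob (P0 E (Dom1 K f)). invertible \<X> (T_cell f Y x))"
proof -
  have a: "TCell \<theta> f \<in> Ar (FunCat (P0 W (Cod1 K f)) (FunCat (P0 E (Dom1 K f)) \<X>))"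
    using frame_cell[OF f] by (simp add: Hom_iff)
  have b: "NC (TCell \<theta> f) Y \<in> Ar (FunCat (P0 E (Dom1 K f)) \<X>)" if "Y \<in> Ob (P0 W (Cod1 K f))" for Y
    using that f by (simp add: FunCat_Ar TCellY_nt TCellY_dom frame_simps)
  show ?thesis using invertible_FunCat_iff[OF a] invertible_FunCat_iff[OF b] by simp
qed

lemma unit_iff:
  assumes C: "C \<in> Ob0 K"
  shows "TCell \<theta> (Id1 K C) = nt_id (TOb \<theta> C) \<longleftrightarrow>
    (\<forall>Y\<in>Ob (P0 W C). \<forall>x\<in>Ob (P0 E C). T_cell (Id1 K C) Y x = Idt \<X> (T_ob C Y x))"
proof -
  have p: "precomp \<X> (id_functor (P0 E C)) = id_functor (FunCat (P0 E C) \<X>)"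
    using C by (intro functor_eqI is_functor_precomp is_functor_id)
      (auto simp: frame_simps category_FunCat fcomp_id Functors_iff FunCat_Ar whisker_right_NC is_functor_id
        is_nt_whisker_right nt_simps functor_simps intro!: nt_eqI)
  have "TCell \<theta> (Id1 K C) = nt_id (TOb \<theta> C) \<longleftrightarrow>
    (\<forall>Y\<in>Ob (P0 W C). \<forall>x\<in>Ob (P0 E C). T_cell (Id1 K C) Y x = NC (NC (nt_id (TOb \<theta> C)) Y) x)"
    using C by (intro nt2_eq_iff) (simp_all add: frame_simps is_nt_id p fcomp_id id_fcomp)
  then show ?thesis using C by (simp add: frame_simps)
qed

lemma natural_iff:
  assumes a: "\<alpha> \<in> Ar2 K" "Dom2 K \<alpha> = f" "Cod2 K \<alpha> = g" "Dom1 K f = C" "Cod1 K f = D"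
  shows "TCell \<theta> g \<bullet>\<^sub>N (nt_id (TOb \<theta> C) \<star>\<^sub>N P2 W \<alpha>) = (precomp_nt \<X> (P2 E \<alpha>) \<star>\<^sub>N nt_id (TOb \<theta> D)) \<bullet>\<^sub>N TCell \<theta> f \<longleftrightarrow>
    (\<forall>Y\<in>Ob (P0 W D). \<forall>x\<in>Ob (P0 E C).
      T_cell g Y x \<cdot>\<^bsub>\<X>\<^esub> T_W C (NC (P2 W \<alpha>) Y) x = T_E D Y (NC (P2 E \<alpha>) x) \<cdot>\<^bsub>\<X>\<^esub> T_cell f Y x)" (is "?l = ?r \<longleftrightarrow> ?R")
proof -
  have f: "f \<in> Ar1 K" "g \<in> Ar1 K" "C \<in> Ob0 K" "D \<in> Ob0 K" "Dom1 K g = C" "Cod1 K g = D"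
    using a K2_simps(1,2)[of \<alpha>] globular_Cod[of \<alpha>] K1_simps(1,2)[of f] by auto
  note s = a f frame_simps
  have 1: "is_nt (nt_id (TOb \<theta> C) \<star>\<^sub>N P2 W \<alpha>)" by (rule is_nt_whisker_left) (simp_all add: s)
  have 2: "is_nt (precomp_nt \<X> (P2 E \<alpha>) \<star>\<^sub>N nt_id (TOb \<theta> D))"
    by (rule is_nt_whisker_right) (simp_all add: s is_nt_precomp_nt)
  have "?l = ?r \<longleftrightarrow> (\<forall>Y\<in>Ob (P0 W D). \<forall>x\<in>Ob (P0 E C). NC (NC ?l Y) x = NC (NC ?r Y) x)"
    by (rule nt2_eq_iff) (simp_all add: s 1 2 is_nt_vcomp)
  moreover have "NC (NC ?l Y) x = T_cell g Y x \<cdot>\<^bsub>\<X>\<^esub> T_W C (NC (P2 W \<alpha>) Y) x"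
    if Y: "Y \<in> Ob (P0 W D)" and x: "x \<in> Ob (P0 E C)" for Y x
    using Y x nt2_vcomp[OF 1, of "P0 E C" \<X> Y x "TCell \<theta> g"] whisker_left_NC[of "TOb \<theta> C" "P2 W \<alpha>" Y]
    by (simp add: s)
  moreover have "NC (NC ?r Y) x = T_E D Y (NC (P2 E \<alpha>) x) \<cdot>\<^bsub>\<X>\<^esub> T_cell f Y x"
    if Y: "Y \<in> Ob (P0 W D)" and x: "x \<in> Ob (P0 E C)" for Y x
    using Y x nt2_vcomp[OF TCell_nt, of f "P0 E C" \<X> Y x] nt2_precomp_nt_whisker[of "TOb \<theta> D" "P2 E \<alpha>" \<X> Y x]
    by (simp add: s)
  ultimately show ?thesis by simp
qed

text \<open>
  Both sides of the axiom have the same source and target because precomposition is strictly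
  functorial in the functor precomposed with. In double components the two whiskerings of coherence
  cells become the evaluation of one at \<open>f\<^sub>! x\<close> and of the other at \<open>g\<^sup>* Y\<close>.
\<close>

lemma comp_iff:
  assumes f: "f \<in> Ar1 K" "g \<in> Ar1 K" "Dom1 K f = C" "Cod1 K f = D" "Dom1 K g = D" "Cod1 K g = D'"
  shows "TCell \<theta> (g \<odot>\<^bsub>K\<^esub> f) \<bullet>\<^sub>N (nt_id (TOb \<theta> C) \<star>\<^sub>N PC W f g) =
       (precomp_nt \<X> (PC E g f) \<star>\<^sub>N nt_id (TOb \<theta> D')) \<bullet>\<^sub>N
         ((nt_id (precomp \<X> (P1 E f)) \<star>\<^sub>N TCell \<theta> g) \<bullet>\<^sub>N (TCell \<theta> f \<star>\<^sub>N nt_id (P1 W g))) \<longleftrightarrow>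
    (\<forall>Y\<in>Ob (P0 W D'). \<forall>x\<in>Ob (P0 E C).
      T_cell (g \<odot>\<^bsub>K\<^esub> f) Y x \<cdot>\<^bsub>\<X>\<^esub> T_W C (NC (PC W f g) Y) x =
      T_E D' Y (NC (PC E g f) x) \<cdot>\<^bsub>\<X>\<^esub> (T_cell g Y (FOb (P1 E f) x) \<cdot>\<^bsub>\<X>\<^esub> T_cell f (FOb (P1 W g) Y) x))" (is "?l = ?r \<longleftrightarrow> ?R")
proof -
  have o: "C \<in> Ob0 K" "D \<in> Ob0 K" "D' \<in> Ob0 K" using f K1_simps(1,2)[of f] K1_simps(1,2)[of g] by auto
  note s = f o frame_simps
  have pp: "precomp \<X> (P1 E f) \<circ>\<^sub>F precomp \<X> (P1 E g) = precomp \<X> (P1 E g \<circ>\<^sub>F P1 E f)"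
  proof (rule functor_eqI)
    fix \<sigma> assume "\<sigma> \<in> Ar (FDom (precomp \<X> (P1 E g \<circ>\<^sub>F P1 E f)))"
    then have t: "\<sigma> \<in> Ar (FunCat (P0 E D') \<X>)" "is_nt \<sigma>" "FDom (NDom \<sigma>) = P0 E D'" "FCod (NDom \<sigma>) = \<X>"
      by (simp_all add: s FunCat_Ar)
    have t': "\<sigma> \<star>\<^sub>N nt_id (P1 E g) \<in> Ar (FunCat (P0 E D) \<X>)" using t by (simp add: FunCat_Ar is_nt_whisker_right s)
    have "(\<sigma> \<star>\<^sub>N nt_id (P1 E g)) \<star>\<^sub>N nt_id (P1 E f) = \<sigma> \<star>\<^sub>N nt_id (P1 E g \<circ>\<^sub>F P1 E f)"
      by (rule nt_eqI)
       (use t in \<open>simp_all add: s is_nt_whisker_right is_functor_fcomp whisker_right_NC fcomp_assoc nt_simps\<close>)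
    then show "FAr (precomp \<X> (P1 E f) \<circ>\<^sub>F precomp \<X> (P1 E g)) \<sigma> = FAr (precomp \<X> (P1 E g \<circ>\<^sub>F P1 E f)) \<sigma>"
      using t t' by (simp add: s)
  next
    fix H assume "H \<in> Ob (FDom (precomp \<X> (P1 E g \<circ>\<^sub>F P1 E f)))"
    then show "FOb (precomp \<X> (P1 E f) \<circ>\<^sub>F precomp \<X> (P1 E g)) H = FOb (precomp \<X> (P1 E g \<circ>\<^sub>F P1 E f)) H"
      by (simp add: s Functors_iff is_functor_fcomp fcomp_assoc)
  qed (simp_all add: s is_functor_fcomp is_functor_precomp)
  have 1: "is_nt (nt_id (TOb \<theta> C) \<star>\<^sub>N PC W f g)"
    by (rule is_nt_whisker_left) (use W.PC_dom[of g f] in \<open>simp_all add: s\<close>)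
  have 2: "is_nt (precomp_nt \<X> (PC E g f) \<star>\<^sub>N nt_id (TOb \<theta> D'))"
    by (rule is_nt_whisker_right) (simp_all add: s is_nt_precomp_nt)
  have 3: "is_nt (nt_id (precomp \<X> (P1 E f)) \<star>\<^sub>N TCell \<theta> g)"
    by (rule is_nt_whisker_left) (simp_all add: s is_functor_precomp)
  have 4: "is_nt (TCell \<theta> f \<star>\<^sub>N nt_id (P1 W g))"
    by (rule is_nt_whisker_right) (simp_all add: s)
  have A: "NDom (nt_id (precomp \<X> (P1 E f)) \<star>\<^sub>N TCell \<theta> g) = NCod (TCell \<theta> f \<star>\<^sub>N nt_id (P1 W g))"
    by (simp add: s fcomp_assoc is_functor_precomp)
  have 34: "is_nt ((nt_id (precomp \<X> (P1 E f)) \<star>\<^sub>N TCell \<theta> g) \<bullet>\<^sub>N (TCell \<theta> f \<star>\<^sub>N nt_id (P1 W g)))"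
    by (rule is_nt_vcomp[OF 4 3 A])
  have B: "NDom (precomp_nt \<X> (PC E g f) \<star>\<^sub>N nt_id (TOb \<theta> D')) =
     precomp \<X> (P1 E f) \<circ>\<^sub>F (precomp \<X> (P1 E g) \<circ>\<^sub>F TOb \<theta> D')"
    using fcomp_assoc[of "TOb \<theta> D'" "precomp \<X> (P1 E g)" "precomp \<X> (P1 E f)"] by (simp add: s pp is_functor_precomp)
  have "?l = ?r \<longleftrightarrow> (\<forall>Y\<in>Ob (P0 W D'). \<forall>x\<in>Ob (P0 E C). NC (NC ?l Y) x = NC (NC ?r Y) x)"
  proof (rule nt2_eq_iff)
    show "is_nt ?l" by (rule is_nt_vcomp[OF 1]) (simp_all add: s)
    show "is_nt ?r" by (rule is_nt_vcomp[OF 34 2]) (subst B, simp add: s)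
  qed (simp_all add: s fcomp_assoc)
  moreover have "NC (NC ?l Y) x = T_cell (g \<odot>\<^bsub>K\<^esub> f) Y x \<cdot>\<^bsub>\<X>\<^esub> T_W C (NC (PC W f g) Y) x"
    if Y: "Y \<in> Ob (P0 W D')" and x: "x \<in> Ob (P0 E C)" for Y x
    using Y x nt2_vcomp[OF 1, of "P0 E C" \<X> Y x "TCell \<theta> (g \<odot>\<^bsub>K\<^esub> f)"] whisker_left_NC[of "TOb \<theta> C" "PC W f g" Y]
    by (simp add: s)
  moreover have "NC (NC ?r Y) x = T_E D' Y (NC (PC E g f) x) \<cdot>\<^bsub>\<X>\<^esub> (T_cell g Y (FOb (P1 E f) x) \<cdot>\<^bsub>\<X>\<^esub> T_cell f (FOb (P1 W g) Y) x)"
    if Y: "Y \<in> Ob (P0 W D')" and x: "x \<in> Ob (P0 E C)" for Y x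
    using Y x nt2_vcomp[OF 34, of "P0 E C" \<X> Y x "precomp_nt \<X> (PC E g f) \<star>\<^sub>N nt_id (TOb \<theta> D')"]
      nt2_vcomp[OF 4, of "P0 E C" \<X> Y x "nt_id (precomp \<X> (P1 E f)) \<star>\<^sub>N TCell \<theta> g"]
      nt2_precomp_nt_whisker[of "TOb \<theta> D'" "PC E g f" \<X> Y x]
      nt2_whisker_precomp[OF TCell_nt[of g], of "P0 E D" \<X> Y "P1 E f" x]
      whisker_right_NC[of "P1 W g" "TCell \<theta> f" Y]
    by (simp add: s)
  ultimately show ?thesis by simp
qed

lemma is_pnat_iff:
  "pnat_into \<X> \<theta> \<longleftrightarrow>
    TOb \<theta> \<in> extensional (Ob0 K) \<and> TCell \<theta> \<in> extensional (Ar1 K) \<and>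
    (\<forall>f\<in>Ar1 K. \<forall>Y\<in>Ob (P0 W (Cod1 K f)). \<forall>x\<in>Ob (P0 E (Dom1 K f)). invertible \<X> (T_cell f Y x)) \<and>
    (\<forall>\<alpha>\<in>Ar2 K. \<forall>Y\<in>Ob (P0 W (Cod1 K (Dom2 K \<alpha>))). \<forall>x\<in>Ob (P0 E (Dom1 K (Dom2 K \<alpha>))).
      T_cell (Cod2 K \<alpha>) Y x \<cdot>\<^bsub>\<X>\<^esub> T_W (Dom1 K (Dom2 K \<alpha>)) (NC (P2 W \<alpha>) Y) x =
      T_E (Cod1 K (Dom2 K \<alpha>)) Y (NC (P2 E \<alpha>) x) \<cdot>\<^bsub>\<X>\<^esub> T_cell (Dom2 K \<alpha>) Y x) \<and>
    (\<forall>C\<in>Ob0 K. \<forall>Y\<in>Ob (P0 W C). \<forall>x\<in>Ob (P0 E C). T_cell (Id1 K C) Y x = Idt \<X> (T_ob C Y x)) \<and>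
    (\<forall>f\<in>Ar1 K. \<forall>g\<in>Ar1 K. Dom1 K g = Cod1 K f \<longrightarrow>
      (\<forall>Y\<in>Ob (P0 W (Cod1 K g)). \<forall>x\<in>Ob (P0 E (Dom1 K f)).
        T_cell (g \<odot>\<^bsub>K\<^esub> f) Y x \<cdot>\<^bsub>\<X>\<^esub> T_W (Dom1 K f) (NC (PC W f g) Y) x =
        T_E (Cod1 K g) Y (NC (PC E g f) x) \<cdot>\<^bsub>\<X>\<^esub> (T_cell g Y (FOb (P1 E f) x) \<cdot>\<^bsub>\<X>\<^esub> T_cell f (FOb (P1 W g) Y) x)))"
proof -
  have "pnat_into \<X> \<theta> \<longleftrightarrow>
    TOb \<theta> \<in> extensional (Ob0 K) \<and> TCell \<theta> \<in> extensional (Ar1 K) \<and>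
    (\<forall>f\<in>Ar1 K. invertible (FunCat (P0 W (Cod1 K f)) (FunCat (P0 E (Dom1 K f)) \<X>)) (TCell \<theta> f)) \<and>
    (\<forall>\<alpha>\<in>Ar2 K. TCell \<theta> (Cod2 K \<alpha>) \<bullet>\<^sub>N (nt_id (TOb \<theta> (Dom1 K (Dom2 K \<alpha>))) \<star>\<^sub>N P2 W \<alpha>) =
      (precomp_nt \<X> (P2 E \<alpha>) \<star>\<^sub>N nt_id (TOb \<theta> (Cod1 K (Dom2 K \<alpha>)))) \<bullet>\<^sub>N TCell \<theta> (Dom2 K \<alpha>)) \<and>
    (\<forall>C\<in>Ob0 K. TCell \<theta> (Id1 K C) = nt_id (TOb \<theta> C)) \<and>
    (\<forall>f\<in>Ar1 K. \<forall>g\<in>Ar1 K. Dom1 K g = Cod1 K f \<longrightarrow>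
      TCell \<theta> (g \<odot>\<^bsub>K\<^esub> f) \<bullet>\<^sub>N (nt_id (TOb \<theta> (Dom1 K f)) \<star>\<^sub>N PC W f g) =
       (precomp_nt \<X> (PC E g f) \<star>\<^sub>N nt_id (TOb \<theta> (Cod1 K g))) \<bullet>\<^sub>N
         ((nt_id (precomp \<X> (P1 E f)) \<star>\<^sub>N TCell \<theta> g) \<bullet>\<^sub>N (TCell \<theta> f \<star>\<^sub>N nt_id (P1 W g))))" (is "?L \<longleftrightarrow> ?R")
  proof
    assume ?L
    then interpret p: is_pnat "op1 K" W "CatInto E \<X>" \<theta> .
    have "invertible (FunCat (P0 W (Cod1 K f)) (FunCat (P0 E (Dom1 K f)) \<X>)) (TCell \<theta> f)" if "f \<in> Ar1 K" for f
      using p.cell[of f "Cod1 K f" "Dom1 K f"] that by (simp add: Hom1_iff)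
    moreover have "TCell \<theta> (Cod2 K \<alpha>) \<bullet>\<^sub>N (nt_id (TOb \<theta> (Dom1 K (Dom2 K \<alpha>))) \<star>\<^sub>N P2 W \<alpha>) =
      (precomp_nt \<X> (P2 E \<alpha>) \<star>\<^sub>N nt_id (TOb \<theta> (Cod1 K (Dom2 K \<alpha>)))) \<bullet>\<^sub>N TCell \<theta> (Dom2 K \<alpha>)" if "\<alpha> \<in> Ar2 K" for \<alpha>
      using p.natural[of "Dom2 K \<alpha>" _ _ \<alpha> "Cod2 K \<alpha>"] that by (simp add: Hom1_iff Hom2_iff K2_simps)
    moreover have "TCell \<theta> (g \<odot>\<^bsub>K\<^esub> f) \<bullet>\<^sub>N (nt_id (TOb \<theta> (Dom1 K f)) \<star>\<^sub>N PC W f g) =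
       (precomp_nt \<X> (PC E g f) \<star>\<^sub>N nt_id (TOb \<theta> (Cod1 K g))) \<bullet>\<^sub>N
         ((nt_id (precomp \<X> (P1 E f)) \<star>\<^sub>N TCell \<theta> g) \<bullet>\<^sub>N (TCell \<theta> f \<star>\<^sub>N nt_id (P1 W g)))"
      if "f \<in> Ar1 K" "g \<in> Ar1 K" "Dom1 K g = Cod1 K f" for f g
      using p.comp[of g _ _ f] that by (simp add: Hom1_iff)
    ultimately show ?R using p.ob_ext p.cell_ext p.unit by simp
  next
    assume ?R
    then show ?L using frame_ob frame_cell
      by (intro is_pnat.intro) (auto simp: Hom1_iff Hom2_iff)
  qed
  then show ?thesis
    by (simp add: invertible_iff unit_iff natural_iff[OF _ refl refl refl refl] comp_iff[OF _ _ refl refl _ refl] cong: conj_cong)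
qed

end

text \<open>
  As for transformations, the typing of a modification is separated from the compatibility with
  coherence cells.
\<close>

locale modification_frame = dom: transformation_frame K E W \<X> \<theta> + cod: transformation_frame K E W \<X> \<gamma>
  for K :: "('c, 'f, 't) two_cat" and E :: "('c, 'f, 't, 'eo, 'ea) cat_psf" and W :: "('c, 'f, 't, 'wo, 'wa) cat_psf"
    and \<X> :: "('x, 'y) cat" and \<theta> \<gamma> +
  fixes m :: "'c \<Rightarrow> ('wo, 'wa, ('eo, 'ea, 'x, 'y) fnct, ('eo, 'ea, 'x, 'y) nt) nt"
  assumes frame_modif: "C \<in> Ob0 K \<Longrightarrow> m C \<in> Hom (FunCat (P0 W C) (FunCat (P0 E C) \<X>)) (TOb \<theta> C) (TOb \<gamma> C)"
begin

abbreviation "M_at C Y x \<equiv> NC (NC (m C) Y) x"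

lemma m_nt: "C \<in> Ob0 K \<Longrightarrow> is_nt (m C)" and m_dom: "C \<in> Ob0 K \<Longrightarrow> NDom (m C) = TOb \<theta> C"
  and m_cod: "C \<in> Ob0 K \<Longrightarrow> NCod (m C) = TOb \<gamma> C"
  using frame_modif by (simp_all add: Hom_iff FunCat_Ar)

lemma mY_nt: "C \<in> Ob0 K \<Longrightarrow> Y \<in> Ob (P0 W C) \<Longrightarrow> is_nt (NC (m C) Y)"
  and mY_dom: "C \<in> Ob0 K \<Longrightarrow> Y \<in> Ob (P0 W C) \<Longrightarrow> NDom (NC (m C) Y) = FOb (TOb \<theta> C) Y"
  and mY_cod: "C \<in> Ob0 K \<Longrightarrow> Y \<in> Ob (P0 W C) \<Longrightarrow> NCod (NC (m C) Y) = FOb (TOb \<gamma> C) Y"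
  using nt2_NC[OF m_nt, of C "P0 E C" \<X> Y] by (simp_all add: m_dom m_cod dom.TOb_dom dom.TOb_cod)

lemma M_at_Ar: "C \<in> Ob0 K \<Longrightarrow> Y \<in> Ob (P0 W C) \<Longrightarrow> x \<in> Ob (P0 E C) \<Longrightarrow> M_at C Y x \<in> Ar \<X>"
  and M_at_Src: "C \<in> Ob0 K \<Longrightarrow> Y \<in> Ob (P0 W C) \<Longrightarrow> x \<in> Ob (P0 E C) \<Longrightarrow> Src \<X> (M_at C Y x) = dom.T_ob C Y x"
  and M_at_Tgt: "C \<in> Ob0 K \<Longrightarrow> Y \<in> Ob (P0 W C) \<Longrightarrow> x \<in> Ob (P0 E C) \<Longrightarrow> Tgt \<X> (M_at C Y x) = cod.T_ob C Y x"
  using nt_simps[where \<alpha> = "NC (m C) Y"] by (simp_all add: mY_nt mY_dom mY_cod dom.frame_simps)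

lemma M_at_natural_E: "C \<in> Ob0 K \<Longrightarrow> Y \<in> Ob (P0 W C) \<Longrightarrow> u \<in> Ar (P0 E C) \<Longrightarrow> Src (P0 E C) u = x \<Longrightarrow> Tgt (P0 E C) u = x' \<Longrightarrow>
   M_at C Y x' \<cdot>\<^bsub>\<X>\<^esub> dom.T_E C Y u = cod.T_E C Y u \<cdot>\<^bsub>\<X>\<^esub> M_at C Y x"
  using is_nt.NC_natural[OF mY_nt, of C Y "P0 E C" \<X> u x x'] by (simp add: mY_dom mY_cod dom.frame_simps)

lemma M_at_natural_W:
  assumes C: "C \<in> Ob0 K" and v: "v \<in> Ar (P0 W C)" "Src (P0 W C) v = Y" "Tgt (P0 W C) v = Y'" and x: "x \<in> Ob (P0 E C)"
  shows "M_at C Y' x \<cdot>\<^bsub>\<X>\<^esub> dom.T_W C v x = cod.T_W C v x \<cdot>\<^bsub>\<X>\<^esub> M_at C Y x"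
proof -
  have Y: "Y \<in> Ob (P0 W C)" "Y' \<in> Ob (P0 W C)" using v C by (auto simp: dom.frame_simps)
  have "NC (NC (m C) Y' \<bullet>\<^sub>N FAr (TOb \<theta> C) v) x = NC (FAr (TOb \<gamma> C) v \<bullet>\<^sub>N NC (m C) Y) x"
    using is_nt.NC_natural[OF m_nt, of C "P0 W C" "FunCat (P0 E C) \<X>" v Y Y'] C v by (simp add: m_dom m_cod dom.frame_simps)
  then show ?thesis using C v Y x by (simp add: dom.frame_simps mY_dom)
qed

lemma modification_iff:
  assumes f: "f \<in> Ar1 K" "Dom1 K f = C" "Cod1 K f = D"
  shows "(nt_id (precomp \<X> (P1 E f)) \<star>\<^sub>N m D) \<bullet>\<^sub>N TCell \<theta> f = TCell \<gamma> f \<bullet>\<^sub>N (m C \<star>\<^sub>N nt_id (P1 W f)) \<longleftrightarrow>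
   (\<forall>Y\<in>Ob (P0 W D). \<forall>x\<in>Ob (P0 E C).
     M_at D Y (FOb (P1 E f) x) \<cdot>\<^bsub>\<X>\<^esub> dom.T_cell f Y x = cod.T_cell f Y x \<cdot>\<^bsub>\<X>\<^esub> M_at C (FOb (P1 W f) Y) x)" (is "?l = ?r \<longleftrightarrow> ?R")
proof -
  have o: "C \<in> Ob0 K" "D \<in> Ob0 K" using f dom.K1_simps(1,2)[of f] by auto
  note s = f o dom.frame_simps cod.frame_simps m_nt m_dom m_cod
  have 1: "is_nt (nt_id (precomp \<X> (P1 E f)) \<star>\<^sub>N m D)"
    by (rule is_nt_whisker_left) (simp_all add: s is_functor_precomp)
  have 2: "is_nt (m C \<star>\<^sub>N nt_id (P1 W f))"
    by (rule is_nt_whisker_right) (simp_all add: s)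
  have "?l = ?r \<longleftrightarrow> (\<forall>Y\<in>Ob (P0 W D). \<forall>x\<in>Ob (P0 E C). NC (NC ?l Y) x = NC (NC ?r Y) x)"
    by (rule nt2_eq_iff) (simp_all add: s 1 2 is_nt_vcomp)
  moreover have "NC (NC ?l Y) x = M_at D Y (FOb (P1 E f) x) \<cdot>\<^bsub>\<X>\<^esub> dom.T_cell f Y x"
    if Y: "Y \<in> Ob (P0 W D)" and x: "x \<in> Ob (P0 E C)" for Y x
    using Y x nt2_vcomp[OF dom.TCell_nt, of f "P0 E C" \<X> Y x]
      nt2_whisker_precomp[OF m_nt[of D], of "P0 E D" \<X> Y "P1 E f" x] by (simp add: s)
  moreover have "NC (NC ?r Y) x = cod.T_cell f Y x \<cdot>\<^bsub>\<X>\<^esub> M_at C (FOb (P1 W f) Y) x"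
    if Y: "Y \<in> Ob (P0 W D)" and x: "x \<in> Ob (P0 E C)" for Y x
    using Y x nt2_vcomp[OF 2, of "P0 E C" \<X> Y x "TCell \<gamma> f"] whisker_right_NC[of "P1 W f" "m C" Y]
    by (simp add: s)
  ultimately show ?thesis by simp
qed

end

section \<open>Pseudo-natural transformations and modifications form a category\<close>

lemma PsHom_sel [simp]: "Ob (PsHom K W V) = {\<theta>. is_pnat K W V \<theta>}" "Ar (PsHom K W V) = {m. is_modif K W V m}"
  "Src (PsHom K W V) = MDom" "Tgt (PsHom K W V) = MCod"
  "Idt (PsHom K W V) \<theta> = \<lparr>MDom = \<theta>, MCod = \<theta>, MC = (\<lambda>A\<in>Ob0 K. nt_id (TOb \<theta> A))\<rparr>"
  "n \<cdot>\<^bsub>PsHom K W V\<^esub> m = \<lparr>MDom = MDom m, MCod = MCod n, MC = (\<lambda>A\<in>Ob0 K. MC n A \<bullet>\<^sub>N MC m A)\<rparr>"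
  by (simp_all add: PsHom_def)

lemma modif_eqI:
  fixes m n :: "('c, 'f, 'o, 'a, 'p, 'b) modif"
  assumes "is_modif K W V m" "is_modif K W V n" "MDom m = MDom n" "MCod m = MCod n"
    and "\<And>C. C \<in> Ob0 K \<Longrightarrow> MC m C = MC n C"
  shows "m = n"
proof -
  have "MC m = MC n" using is_modif.ext[OF assms(1)] is_modif.ext[OF assms(2)] assms(5) by (metis extensionalityI)
  then show ?thesis using assms(3,4) by simp
qed

context weight
begin

text \<open>
  Coherence cells of a transformation on \<open>op1 K\<close> are indexed by arrows with reversed ends, so that the
  cell of \<open>f : C \<rightarrow> D\<close> is a transformation between functors on \<open>W D\<close>.
\<close>

lemma pnat_frame:
  assumes X: "category \<X>" and p: "pnat_into \<X> \<theta>"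
  shows "transformation_frame K E W \<X> \<theta>"
proof -
  interpret p: is_pnat "op1 K" W "CatInto E \<X>" \<theta> by (rule p)
  show ?thesis
  proof (intro transformation_frame.intro transformation_frame_axioms.intro weight_axioms X)
    show "TOb \<theta> C \<in> Functors (P0 W C) (FunCat (P0 E C) \<X>)" if "C \<in> Ob0 K" for C
      using p.ob that by simp
    show "TCell \<theta> f \<in> Hom (FunCat (P0 W (Cod1 K f)) (FunCat (P0 E (Dom1 K f)) \<X>))
        (TOb \<theta> (Dom1 K f) \<circ>\<^sub>F P1 W f) (precomp \<X> (P1 E f) \<circ>\<^sub>F TOb \<theta> (Cod1 K f))" if "f \<in> Ar1 K" for f
      using p.cell[of f "Cod1 K f" "Dom1 K f"] that by (simp add: Hom1_iff)
  qed
qed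

lemma is_modif_iff:
  assumes X: "category \<X>"
  shows "modif_into \<X> m \<longleftrightarrow>
    pnat_into \<X> (MDom m) \<and> pnat_into \<X> (MCod m) \<and> MC m \<in> extensional (Ob0 K) \<and>
    (\<forall>C\<in>Ob0 K. MC m C \<in> Hom (FunCat (P0 W C) (FunCat (P0 E C) \<X>)) (TOb (MDom m) C) (TOb (MCod m) C)) \<and>
    (\<forall>f\<in>Ar1 K. \<forall>Y\<in>Ob (P0 W (Cod1 K f)). \<forall>x\<in>Ob (P0 E (Dom1 K f)).
      NC (NC (MC m (Cod1 K f)) Y) (FOb (P1 E f) x) \<cdot>\<^bsub>\<X>\<^esub> NC (NC (TCell (MDom m) f) Y) x =
      NC (NC (TCell (MCod m) f) Y) x \<cdot>\<^bsub>\<X>\<^esub> NC (NC (MC m (Dom1 K f)) (FOb (P1 W f) Y)) x)" (is "?L \<longleftrightarrow> ?R")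
proof -
  have frame: "modification_frame K E W \<X> (MDom m) (MCod m) (MC m)"
    if "pnat_into \<X> (MDom m)" "pnat_into \<X> (MCod m)"
      "\<And>C. C \<in> Ob0 K \<Longrightarrow> MC m C \<in> Hom (FunCat (P0 W C) (FunCat (P0 E C) \<X>)) (TOb (MDom m) C) (TOb (MCod m) C)"
    using that pnat_frame[OF X] by (intro modification_frame.intro modification_frame_axioms.intro)
  show ?thesis
  proof
    assume ?L
    then interpret m: is_modif "op1 K" W "CatInto E \<X>" m .
    have *: "\<And>C. C \<in> Ob0 K \<Longrightarrow> MC m C \<in> Hom (FunCat (P0 W C) (FunCat (P0 E C) \<X>)) (TOb (MDom m) C) (TOb (MCod m) C)"
      using m.comp by simp
    interpret modification_frame K E W \<X> "MDom m" "MCod m" "MC m" by (rule frame[OF m.dom m.cod *])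
    show ?R using m.dom m.cod m.ext * m.natural[of _ "Cod1 K _" "Dom1 K _"] modification_iff[OF _ refl refl]
      by (simp add: Hom1_iff)
  next
    assume R: ?R
    then interpret modification_frame K E W \<X> "MDom m" "MCod m" "MC m" by (intro frame) auto
    show ?L using R modification_iff[OF _ refl refl] by (intro is_modif.intro) (auto simp: Hom1_iff)
  qed
qed

lemma modif_frame:
  assumes X: "category \<X>" and m: "modif_into \<X> m"
  shows "modification_frame K E W \<X> (MDom m) (MCod m) (MC m)"
  using m[unfolded is_modif_iff[OF X]] pnat_frame[OF X]
  by (intro modification_frame.intro modification_frame_axioms.intro) auto

lemma modif_id:
  assumes X: "category \<X>" and p: "pnat_into \<X> \<theta>"
  shows "modif_into \<X> \<lparr>MDom = \<theta>, MCod = \<theta>, MC = (\<lambda>A\<in>Ob0 K. nt_id (TOb \<theta> A))\<rparr>"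
proof -
  interpret transformation_frame K E W \<X> \<theta> by (rule pnat_frame[OF X p])
  show ?thesis unfolding is_modif_iff[OF X]
    by (simp add: p Hom_iff FunCat_Ar is_nt_id frame_simps t_simps)
qed

text \<open>
  In double components, the compatibility squares of \<open>m\<close> and \<open>n\<close> are pasted side by side.
\<close>

lemma modif_comp:
  assumes X: "category \<X>" and m: "modif_into \<X> m" and n: "modif_into \<X> n"
    and mn: "MDom n = MCod m"
  shows "modif_into \<X> \<lparr>MDom = MDom m, MCod = MCod n, MC = (\<lambda>A\<in>Ob0 K. MC n A \<bullet>\<^sub>N MC m A)\<rparr>"
proof -
  interpret m: modification_frame K E W \<X> "MDom m" "MCod m" "MC m" by (rule modif_frame[OF X m])
  interpret n: modification_frame K E W \<X> "MCod m" "MCod n" "MC n" using modif_frame[OF X n] mn by simp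
  note M = m[unfolded is_modif_iff[OF X]] n[unfolded is_modif_iff[OF X]]
  note s = m.dom.frame_simps n.cod.frame_simps m.cod.frame_simps m.m_nt m.m_dom m.m_cod n.m_nt n.m_dom n.m_cod
    m.M_at_Ar m.M_at_Src m.M_at_Tgt n.M_at_Ar n.M_at_Src n.M_at_Tgt m.dom.t_simps m.cod.t_simps n.cod.t_simps
    nt2_vcomp[where B = "P0 E _" and X = \<X>]
  have "NC (NC (MC n (Cod1 K f) \<bullet>\<^sub>N MC m (Cod1 K f)) Y) (FOb (P1 E f) x) \<cdot>\<^bsub>\<X>\<^esub> m.dom.T_cell f Y x =
    n.cod.T_cell f Y x \<cdot>\<^bsub>\<X>\<^esub> NC (NC (MC n (Dom1 K f) \<bullet>\<^sub>N MC m (Dom1 K f)) (FOb (P1 W f) Y)) x"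
    if f: "f \<in> Ar1 K" and Y: "Y \<in> Ob (P0 W (Cod1 K f))" and x: "x \<in> Ob (P0 E (Dom1 K f))" for f Y x
  proof -
    let ?Y = "FOb (P1 W f) Y" let ?x = "FOb (P1 E f) x"
    have o: "Dom1 K f \<in> Ob0 K" "Cod1 K f \<in> Ob0 K" using f by (simp_all add: s)
    have 1: "m.M_at (Cod1 K f) Y ?x \<cdot>\<^bsub>\<X>\<^esub> m.dom.T_cell f Y x = m.cod.T_cell f Y x \<cdot>\<^bsub>\<X>\<^esub> m.M_at (Dom1 K f) ?Y x"
      using M f Y x by auto
    have 2: "n.M_at (Cod1 K f) Y ?x \<cdot>\<^bsub>\<X>\<^esub> m.cod.T_cell f Y x = n.cod.T_cell f Y x \<cdot>\<^bsub>\<X>\<^esub> n.M_at (Dom1 K f) ?Y x"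
      using M f Y x mn by auto
    have "n.M_at (Cod1 K f) Y ?x \<cdot>\<^bsub>\<X>\<^esub> (m.cod.T_cell f Y x \<cdot>\<^bsub>\<X>\<^esub> m.M_at (Dom1 K f) ?Y x) =
      n.cod.T_cell f Y x \<cdot>\<^bsub>\<X>\<^esub> (n.M_at (Dom1 K f) ?Y x \<cdot>\<^bsub>\<X>\<^esub> m.M_at (Dom1 K f) ?Y x)"
      by (rule category.extend_square[OF X 2]) (use f Y x o in \<open>simp_all add: s\<close>)
    moreover have "NC (NC (MC n (Cod1 K f) \<bullet>\<^sub>N MC m (Cod1 K f)) Y) ?x = n.M_at (Cod1 K f) Y ?x \<cdot>\<^bsub>\<X>\<^esub> m.M_at (Cod1 K f) Y ?x"
      by (rule nt2_vcomp[where B = "P0 E (Cod1 K f)"]) (use f Y x o in \<open>simp_all add: s\<close>)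
    moreover have "NC (NC (MC n (Dom1 K f) \<bullet>\<^sub>N MC m (Dom1 K f)) ?Y) x = n.M_at (Dom1 K f) ?Y x \<cdot>\<^bsub>\<X>\<^esub> m.M_at (Dom1 K f) ?Y x"
      by (rule nt2_vcomp[where B = "P0 E (Dom1 K f)"]) (use f Y x o in \<open>simp_all add: s\<close>)
    ultimately show ?thesis using 1 f Y x o by (simp add: s)
  qed
  then show ?thesis unfolding is_modif_iff[OF X] using M mn
    by (simp add: Hom_iff FunCat_Ar is_nt_vcomp s)
qed

lemma modif_MC:
  assumes X: "category \<X>" and m: "modif_into \<X> m" and C: "C \<in> Ob0 K"
  shows "is_nt (MC m C)" "NDom (MC m C) = TOb (MDom m) C" "NCod (MC m C) = TOb (MCod m) C"
proof -
  interpret modification_frame K E W \<X> "MDom m" "MCod m" "MC m" by (rule modif_frame[OF X m])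
  show "is_nt (MC m C)" "NDom (MC m C) = TOb (MDom m) C" "NCod (MC m C) = TOb (MCod m) C"
    using C by (simp_all add: m_nt m_dom m_cod)
qed

lemma category_PsHom:
  assumes X: "category \<X>" shows "category (Cocones \<X>)"
proof (rule categoryI, simp_all only: PsHom_sel mem_Collect_eq op1_sel modif.select_convs)
  fix m assume m: "modif_into \<X> m"
  then have p: "pnat_into \<X> (MDom m)" "pnat_into \<X> (MCod m)"
    by (auto simp: is_modif_def)
  then show "pnat_into \<X> (MDom m)" "pnat_into \<X> (MCod m)" .
  interpret m: modification_frame K E W \<X> "MDom m" "MCod m" "MC m" by (rule modif_frame[OF X m])
  show "\<lparr>MDom = MDom m, MCod = MCod m, MC = (\<lambda>A\<in>Ob0 K. MC m A \<bullet>\<^sub>N restrict (\<lambda>A. nt_id (TOb (MDom m) A)) (Ob0 K) A)\<rparr> = m"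
    using modif_comp[OF X modif_id[OF X p(1)] m] m
    by (intro modif_eqI[where K = "op1 K" and W = W and V = "CatInto E \<X>"])
     (auto simp: m.m_nt m.m_dom nt_vcomp_id)
  show "\<lparr>MDom = MDom m, MCod = MCod m, MC = (\<lambda>A\<in>Ob0 K. restrict (\<lambda>A. nt_id (TOb (MCod m) A)) (Ob0 K) A \<bullet>\<^sub>N MC m A)\<rparr> = m"
    using modif_comp[OF X m modif_id[OF X p(2)]] m
    by (intro modif_eqI[where K = "op1 K" and W = W and V = "CatInto E \<X>"])
     (auto simp: m.m_nt m.m_cod nt_id_vcomp)
next
  fix l m n
  assume "modif_into \<X> l" "modif_into \<X> m"
    "modif_into \<X> n" "MDom m = MCod l" "MDom n = MCod m"
  then show "\<lparr>MDom = MDom l, MCod = MCod n,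
      MC = \<lambda>A\<in>Ob0 K. restrict (\<lambda>A. MC n A \<bullet>\<^sub>N MC m A) (Ob0 K) A \<bullet>\<^sub>N MC l A\<rparr> =
    \<lparr>MDom = MDom l, MCod = MCod n,
      MC = \<lambda>A\<in>Ob0 K. MC n A \<bullet>\<^sub>N restrict (\<lambda>A. MC m A \<bullet>\<^sub>N MC l A) (Ob0 K) A\<rparr>"
    by (auto simp: restrict_def modif_MC[OF X] nt_vcomp_assoc)
qed (use X modif_id modif_comp in auto)

end

section \<open>The functor \<open>\<Phi>\<close>\<close>

text \<open>
  Naturality of a transformation into a functor category splits into naturality in each of the two
  variables: in \<open>x\<close> because each value is a natural transformation, in \<open>Y\<close> because the transformation is.
\<close>

lemma is_nt2I:
  assumes \<sigma>: "\<sigma> = \<lparr>NDom = F, NCod = G, NC = (\<lambda>Y\<in>Ob A. \<lparr>NDom = FOb F Y, NCod = FOb G Y, NC = (\<lambda>x\<in>Ob B. t Y x)\<rparr>)\<rparr>"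
    and F: "F \<in> Functors A (FunCat B X)" and G: "G \<in> Functors A (FunCat B X)"
    and t: "\<And>Y x. Y \<in> Ob A \<Longrightarrow> x \<in> Ob B \<Longrightarrow> t Y x \<in> Ar X \<and> Src X (t Y x) = FOb (FOb F Y) x \<and> Tgt X (t Y x) = FOb (FOb G Y) x"
    and x: "\<And>Y u. Y \<in> Ob A \<Longrightarrow> u \<in> Ar B \<Longrightarrow>
      t Y (Tgt B u) \<cdot>\<^bsub>X\<^esub> FAr (FOb F Y) u = FAr (FOb G Y) u \<cdot>\<^bsub>X\<^esub> t Y (Src B u)"
    and Y: "\<And>v x. v \<in> Ar A \<Longrightarrow> x \<in> Ob B \<Longrightarrow>
      t (Tgt A v) x \<cdot>\<^bsub>X\<^esub> NC (FAr F v) x = NC (FAr G v) x \<cdot>\<^bsub>X\<^esub> t (Src A v) x"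
  shows "is_nt \<sigma>"
proof (rule is_ntI[of _ F G A "FunCat B X"])
  have FG: "is_functor F" "FDom F = A" "FCod F = FunCat B X" "is_functor G" "FDom G = A" "FCod G = FunCat B X"
    using F G by (simp_all add: Functors_iff)
  have A: "category A" using FG is_functor.dom by blast
  have o: "FOb F Y \<in> Functors B X" "FOb G Y \<in> Functors B X" if "Y \<in> Ob A" for Y
    using that is_functor.FOb_Ob[OF FG(1,3)] is_functor.FOb_Ob[OF FG(4,6)] FG by auto
  have 1: "is_nt (NC \<sigma> Y)" "NDom (NC \<sigma> Y) = FOb F Y" "NCod (NC \<sigma> Y) = FOb G Y" if Y: "Y \<in> Ob A" for Y
  proof -
    show "is_nt (NC \<sigma> Y)"
    proof (rule is_ntI[of _ "FOb F Y" "FOb G Y" B X])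
      have "category B" using o[OF Y] by (auto simp: Functors_iff dest: is_functor.dom)
      then show "NC (NC \<sigma> Y) (Tgt B u) \<cdot>\<^bsub>X\<^esub> FAr (FOb F Y) u = FAr (FOb G Y) u \<cdot>\<^bsub>X\<^esub> NC (NC \<sigma> Y) (Src B u)"
        if "u \<in> Ar B" for u using that Y x[OF Y that] by (simp add: \<sigma> category_simps)
    qed (use Y o t in \<open>auto simp: \<sigma>\<close>)
    show "NDom (NC \<sigma> Y) = FOb F Y" "NCod (NC \<sigma> Y) = FOb G Y" using Y by (auto simp: \<sigma>)
  qed
  show "NC \<sigma> Y \<in> Ar (FunCat B X) \<and> Src (FunCat B X) (NC \<sigma> Y) = FOb F Y \<and> Tgt (FunCat B X) (NC \<sigma> Y) = FOb G Y"
    if "Y \<in> Ob A" for Y using that 1 o by (simp add: FunCat_Ar Functors_iff)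
  show "NC \<sigma> (Tgt A v) \<cdot>\<^bsub>FunCat B X\<^esub> FAr F v = FAr G v \<cdot>\<^bsub>FunCat B X\<^esub> NC \<sigma> (Src A v)" if v: "v \<in> Ar A" for v
  proof -
    note e = category_simps(1,2)[OF A v]
    have Fv: "is_nt (FAr F v)" "NDom (FAr F v) = FOb F (Src A v)" "NCod (FAr F v) = FOb F (Tgt A v)"
      using is_functor.FAr_Ar[OF FG(1,3), of v] is_functor.Src_FAr[OF FG(1,3), of v] is_functor.Tgt_FAr[OF FG(1,3), of v] v FG
      by (auto simp: FunCat_Ar)
    have Gv: "is_nt (FAr G v)" "NDom (FAr G v) = FOb G (Src A v)" "NCod (FAr G v) = FOb G (Tgt A v)"
      using is_functor.FAr_Ar[OF FG(4,6), of v] is_functor.Src_FAr[OF FG(4,6), of v] is_functor.Tgt_FAr[OF FG(4,6), of v] v FG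
      by (auto simp: FunCat_Ar)
    have s: "NC (NC \<sigma> Y) x = t Y x" if "Y \<in> Ob A" "x \<in> Ob B" for Y x using that by (simp add: \<sigma>)
    show ?thesis
      using e o[of "Src A v"] o[of "Tgt A v"] Fv Gv 1
      by (simp, intro nt_eqI) (auto simp: is_nt_vcomp Functors_iff s Y[OF v])
  qed
qed (use F G in \<open>auto simp: \<sigma>\<close>)

context weight
begin

text \<open>
  The arrows \<open>(1, u, 1)\<close>, \<open>(1, 1, v)\<close> and \<open>(f, 1, 1)\<close> generate \<open>\<Delta>(E, W)\<close>. The composition laws below are the
  exact counterparts of the axioms on the double components of a pseudo-natural transformation.
\<close>

definition E_arrow :: "'c \<Rightarrow> 'wo \<Rightarrow> 'ea \<Rightarrow> ('c, 'f, 'eo, 'ea, 'wo, 'wa) dar" where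
  "E_arrow C Y u = ((C, Src (P0 E C) u, Y), (Id1 K C, u, Idt (P0 W C) Y), (C, Tgt (P0 E C) u, Y))"

definition W_arrow :: "'c \<Rightarrow> 'eo \<Rightarrow> 'wa \<Rightarrow> ('c, 'f, 'eo, 'ea, 'wo, 'wa) dar" where
  "W_arrow C x v = ((C, x, Src (P0 W C) v), (Id1 K C, Idt (P0 E C) x, v), (C, x, Tgt (P0 W C) v))"

definition base_arrow :: "'f \<Rightarrow> 'eo \<Rightarrow> 'wo \<Rightarrow> ('c, 'f, 'eo, 'ea, 'wo, 'wa) dar" where
  "base_arrow f x Y = ((Dom1 K f, x, FOb (P1 W f) Y),
      (f, Idt (P0 E (Cod1 K f)) (FOb (P1 E f) x), Idt (P0 W (Dom1 K f)) (FOb (P1 W f) Y)),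
      (Cod1 K f, FOb (P1 E f) x, Y))"

lemmas arr_defs = E_arrow_def W_arrow_def base_arrow_def

lemma arr_ends:
  "fst (E_arrow C Y u) = (C, Src (P0 E C) u, Y)" "snd (snd (E_arrow C Y u)) = (C, Tgt (P0 E C) u, Y)"
  "fst (W_arrow C x v) = (C, x, Src (P0 W C) v)" "snd (snd (W_arrow C x v)) = (C, x, Tgt (P0 W C) v)"
  "fst (base_arrow f x Y) = (Dom1 K f, x, FOb (P1 W f) Y)" "snd (snd (base_arrow f x Y)) = (Cod1 K f, FOb (P1 E f) x, Y)"
  by (simp_all add: arr_defs)

lemma E_arrow_ar: "C \<in> Ob0 K \<Longrightarrow> Y \<in> Ob (P0 W C) \<Longrightarrow> u \<in> Ar (P0 E C) \<Longrightarrow> E_arrow C Y u \<in> DAr"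
  and W_arrow_ar: "C \<in> Ob0 K \<Longrightarrow> x \<in> Ob (P0 E C) \<Longrightarrow> v \<in> Ar (P0 W C) \<Longrightarrow> W_arrow C x v \<in> DAr"
  and base_arrow_ar: "f \<in> Ar1 K \<Longrightarrow> x \<in> Ob (P0 E (Dom1 K f)) \<Longrightarrow> Y \<in> Ob (P0 W (Cod1 K f)) \<Longrightarrow> base_arrow f x Y \<in> DAr"
  by (simp_all add: arr_defs delta_ar_iff simps)

lemma base_arrow_cartesian: "f \<in> Ar1 K \<Longrightarrow> x \<in> Ob (P0 E (Dom1 K f)) \<Longrightarrow> Y \<in> Ob (P0 W (Cod1 K f)) \<Longrightarrow> cartesian K E W (base_arrow f x Y)"
  using base_arrow_ar[of f x Y] by (simp add: cartesian_iff base_arrow_def simps category.invertible_Idt)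

lemma E_arrow_Idt: "C \<in> Ob0 K \<Longrightarrow> Y \<in> Ob (P0 W C) \<Longrightarrow> x \<in> Ob (P0 E C) \<Longrightarrow> E_arrow C Y (Idt (P0 E C) x) = DId (C, x, Y)"
  and W_arrow_Idt: "C \<in> Ob0 K \<Longrightarrow> Y \<in> Ob (P0 W C) \<Longrightarrow> x \<in> Ob (P0 E C) \<Longrightarrow> W_arrow C x (Idt (P0 W C) Y) = DId (C, x, Y)"
  and base_arrow_Id: "C \<in> Ob0 K \<Longrightarrow> Y \<in> Ob (P0 W C) \<Longrightarrow> x \<in> Ob (P0 E C) \<Longrightarrow> base_arrow (Id1 K C) x Y = DId (C, x, Y)"
  by (simp_all add: arr_defs delta_id_eq simps)

lemma E_arrow_E_arrow: "C \<in> Ob0 K \<Longrightarrow> Y \<in> Ob (P0 W C) \<Longrightarrow> u \<in> Ar (P0 E C) \<Longrightarrow> u' \<in> Ar (P0 E C) \<Longrightarrow> Src (P0 E C) u' = Tgt (P0 E C) u \<Longrightarrow>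
    DComp (E_arrow C Y u') (E_arrow C Y u) = E_arrow C Y (u' \<cdot>\<^bsub>P0 E C\<^esub> u)"
  by (simp add: arr_defs delta_comp_eq simps category.Inv_Idt)

lemma W_arrow_W_arrow: "C \<in> Ob0 K \<Longrightarrow> x \<in> Ob (P0 E C) \<Longrightarrow> v \<in> Ar (P0 W C) \<Longrightarrow> v' \<in> Ar (P0 W C) \<Longrightarrow> Src (P0 W C) v' = Tgt (P0 W C) v \<Longrightarrow>
    DComp (W_arrow C x v') (W_arrow C x v) = W_arrow C x (v' \<cdot>\<^bsub>P0 W C\<^esub> v)"
  by (simp add: arr_defs delta_comp_eq simps category.Inv_Idt)

lemma E_arrow_W_arrow: "C \<in> Ob0 K \<Longrightarrow> u \<in> Ar (P0 E C) \<Longrightarrow> v \<in> Ar (P0 W C) \<Longrightarrow>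
    DComp (W_arrow C (Tgt (P0 E C) u) v) (E_arrow C (Src (P0 W C) v) u) =
    DComp (E_arrow C (Tgt (P0 W C) v) u) (W_arrow C (Src (P0 E C) u) v)"
  by (simp add: arr_defs delta_comp_eq simps category.Inv_Idt)

lemma base_arrow_E_arrow: "f \<in> Ar1 K \<Longrightarrow> u \<in> Ar (P0 E (Dom1 K f)) \<Longrightarrow> Y \<in> Ob (P0 W (Cod1 K f)) \<Longrightarrow>
    DComp (base_arrow f (Tgt (P0 E (Dom1 K f)) u) Y) (E_arrow (Dom1 K f) (FOb (P1 W f) Y) u) =
    DComp (E_arrow (Cod1 K f) Y (FAr (P1 E f) u)) (base_arrow f (Src (P0 E (Dom1 K f)) u) Y)"
  by (simp add: arr_defs delta_comp_eq simps category.Inv_Idt)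

lemma base_arrow_W_arrow: "f \<in> Ar1 K \<Longrightarrow> v \<in> Ar (P0 W (Cod1 K f)) \<Longrightarrow> x \<in> Ob (P0 E (Dom1 K f)) \<Longrightarrow>
    DComp (base_arrow f x (Tgt (P0 W (Cod1 K f)) v)) (W_arrow (Dom1 K f) x (FAr (P1 W f) v)) =
    DComp (W_arrow (Cod1 K f) (FOb (P1 E f) x) v) (base_arrow f x (Src (P0 W (Cod1 K f)) v))"
  by (simp add: arr_defs delta_comp_eq simps category.Inv_Idt)

text \<open>
  The two composites are in general different arrows of \<open>\<Delta>(E, W)\<close>, joined by \<open>\<alpha>\<close>; passing to connected
  components identifies them, which yields naturality of the coherence cells with respect to 2-cells.
\<close>

lemma base_arrow_cell:
  assumes a: "\<alpha> \<in> Ar2 K" and x: "x \<in> Ob (P0 E (Dom1 K (Dom2 K \<alpha>)))" and Y: "Y \<in> Ob (P0 W (Cod1 K (Dom2 K \<alpha>)))"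
  shows "(DComp (E_arrow (Cod1 K (Dom2 K \<alpha>)) Y (NC (P2 E \<alpha>) x)) (base_arrow (Dom2 K \<alpha>) x Y), \<alpha>,
     DComp (base_arrow (Cod2 K \<alpha>) x Y) (W_arrow (Dom1 K (Dom2 K \<alpha>)) x (NC (P2 W \<alpha>) Y))) \<in> DCell"
  using assms by (simp add: arr_defs delta_comp_eq simps category.Inv_Idt delta_cell_iff delta_ar_iff)

text \<open>
  In the composite on the right, the inverse comparison cell of \<open>E\<close> produced by the composition of base
  arrows is cancelled by the comparison cell in front.
\<close>

lemma base_arrow_comp:
  assumes f: "f \<in> Ar1 K" "g \<in> Ar1 K" "Dom1 K g = Cod1 K f" and x: "x \<in> Ob (P0 E (Dom1 K f))" and Y: "Y \<in> Ob (P0 W (Cod1 K g))"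
  shows "DComp (base_arrow (g \<odot>\<^bsub>K\<^esub> f) x Y) (W_arrow (Dom1 K f) x (NC (PC W f g) Y)) =
    DComp (E_arrow (Cod1 K g) Y (NC (PC E g f) x))
      (DComp (base_arrow g (FOb (P1 E f) x) Y) (base_arrow f x (FOb (P1 W g) Y)))"
  using assms by (simp add: arr_defs delta_comp_eq simps category.Inv_Idt)

text \<open>
  This factorization is why \<open>\<Phi>\<close> loses no information: a functor on \<open>E \<star> W\<close> is determined by its values
  on the three kinds of generators, and these are the double components of \<open>\<Phi>(F)\<close>.
\<close>

lemma delta_ar_factor:
  assumes "((C, x, Y), (f, u, v), (D, A, B)) \<in> DAr"
  shows "((C, x, Y), (f, u, v), (D, A, B)) = DComp (E_arrow D B u) (DComp (base_arrow f x B) (W_arrow C x v))"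
  using assms by (simp add: arr_defs delta_comp_eq delta_ar_iff simps category.Inv_Idt)

end

locale star_functor = weight K E W
  for K :: "('c, 'f, 't) two_cat" and E :: "('c, 'f, 't, 'eo, 'ea) cat_psf" and W :: "('c, 'f, 't, 'wo, 'wa) cat_psf" +
  fixes \<X> :: "('x, 'y) cat" and F :: "(('c, 'eo, 'wo) dob, ('c, 'f, 'eo, 'ea, 'wo, 'wa) sar, 'x, 'y) fnct"
  assumes F: "F \<in> Functors ST \<X>"
begin

lemma F_simps: "is_functor F" "FDom F = ST" "FCod F = \<X>" and F_X: "category \<X>"
  using F is_functor.cod by (auto simp: Functors_iff)

abbreviation "F_loc a \<equiv> FAr F (loc a)"

lemma F_loc_simps: "a \<in> DAr \<Longrightarrow> F_loc a \<in> Ar \<X>"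
  "a \<in> DAr \<Longrightarrow> Src \<X> (F_loc a) = FOb F (fst a)" "a \<in> DAr \<Longrightarrow> Tgt \<X> (F_loc a) = FOb F (snd (snd a))"
  using functor_simps[where F = F] star_ar_simps F_simps by simp_all

lemma FOb_simps: "C \<in> Ob0 K \<Longrightarrow> x \<in> Ob (P0 E C) \<Longrightarrow> Y \<in> Ob (P0 W C) \<Longrightarrow> FOb F (C, x, Y) \<in> Ob \<X>"
  using is_functor.FOb_Ob[of F \<X> "(C, x, Y)"] F_simps by (simp add: Star_Ob delta_ob_iff)

lemma F_loc_comp: "a \<in> DAr \<Longrightarrow> b \<in> DAr \<Longrightarrow> fst b = snd (snd a) \<Longrightarrow>
    F_loc b \<cdot>\<^bsub>\<X>\<^esub> F_loc a = F_loc (DComp b a)"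
  using star_ar_comp[of a b] is_functor.FAr_cmp[of F ST "loc a" "loc b"] star_ar_simps F_simps by simp

lemma F_loc_id: "C \<in> Ob0 K \<Longrightarrow> x \<in> Ob (P0 E C) \<Longrightarrow> Y \<in> Ob (P0 W C) \<Longrightarrow> F_loc (DId (C, x, Y)) = Idt \<X> (FOb F (C, x, Y))"
  using star_ar_id[of "(C, x, Y)"] is_functor.FAr_Idt[of F ST "(C, x, Y)"] F_simps by (simp add: Star_Ob delta_ob_iff)

lemma F_loc_cell: "(a, \<alpha>, b) \<in> DCell \<Longrightarrow> F_loc a = F_loc b"
  using star_ar_cell by simp

lemma F_loc_invertible: "cartesian K E W a \<Longrightarrow> invertible \<X> (F_loc a)"
  using is_functor.FAr_invertible[of F "loc a"] star_ar_invertible F_simps by simp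

lemmas s_simps = simps F_X FOb_simps F_loc_simps arr_ends E_arrow_ar W_arrow_ar base_arrow_ar F_loc_id E_arrow_Idt W_arrow_Idt base_arrow_Id

lemma phi_fun_sel: "FDom (phi_fun K E W F C Y) = P0 E C" "FCod (phi_fun K E W F C Y) = \<X>"
  "x \<in> Ob (P0 E C) \<Longrightarrow> FOb (phi_fun K E W F C Y) x = FOb F (C, x, Y)"
  "u \<in> Ar (P0 E C) \<Longrightarrow> FAr (phi_fun K E W F C Y) u = F_loc (E_arrow C Y u)"
  by (simp_all add: phi_fun_def F_simps E_arrow_def)

lemma phi_fun_functor:
  assumes C: "C \<in> Ob0 K" and Y: "Y \<in> Ob (P0 W C)" shows "is_functor (phi_fun K E W F C Y)"
proof (rule is_functorI[OF phi_fun_sel(1,2)])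
  show "FOb (phi_fun K E W F C Y) \<in> extensional (Ob (P0 E C))" "FAr (phi_fun K E W F C Y) \<in> extensional (Ar (P0 E C))"
    by (simp_all add: phi_fun_def)
qed (use C Y in \<open>simp_all add: phi_fun_sel s_simps F_loc_comp E_arrow_E_arrow\<close>)

lemma phi_comp_sel: "FDom (phi_comp K E W F C) = P0 W C" "FCod (phi_comp K E W F C) = FunCat (P0 E C) \<X>"
  "Y \<in> Ob (P0 W C) \<Longrightarrow> FOb (phi_comp K E W F C) Y = phi_fun K E W F C Y"
  "v \<in> Ar (P0 W C) \<Longrightarrow> NDom (FAr (phi_comp K E W F C) v) = phi_fun K E W F C (Src (P0 W C) v)"
  "v \<in> Ar (P0 W C) \<Longrightarrow> NCod (FAr (phi_comp K E W F C) v) = phi_fun K E W F C (Tgt (P0 W C) v)"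
  "v \<in> Ar (P0 W C) \<Longrightarrow> x \<in> Ob (P0 E C) \<Longrightarrow> NC (FAr (phi_comp K E W F C) v) x = F_loc (W_arrow C x v)"
  "v \<in> Ar (P0 W C) \<Longrightarrow> NC (FAr (phi_comp K E W F C) v) \<in> extensional (Ob (P0 E C))"
  by (simp_all add: phi_comp_def F_simps W_arrow_def)

lemma phi_comp_nt:
  assumes C: "C \<in> Ob0 K" and v: "v \<in> Ar (P0 W C)" shows "is_nt (FAr (phi_comp K E W F C) v)"
proof (rule is_ntI[OF phi_comp_sel(4)[OF v] phi_comp_sel(5)[OF v], of "P0 E C" \<X>])
  show "NC (FAr (phi_comp K E W F C) v) (Tgt (P0 E C) u) \<cdot>\<^bsub>\<X>\<^esub> FAr (phi_fun K E W F C (Src (P0 W C) v)) u =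
    FAr (phi_fun K E W F C (Tgt (P0 W C) v)) u \<cdot>\<^bsub>\<X>\<^esub> NC (FAr (phi_comp K E W F C) v) (Src (P0 E C) u)"
    if "u \<in> Ar (P0 E C)" for u
    using that C v by (simp add: phi_comp_sel phi_fun_sel s_simps F_loc_comp E_arrow_W_arrow)
qed (use C v in \<open>simp_all add: phi_comp_sel phi_fun_sel phi_fun_functor Functors_iff s_simps\<close>)

lemma phi_comp_functor:
  assumes C: "C \<in> Ob0 K" shows "is_functor (phi_comp K E W F C)"
proof (rule is_functorI[OF phi_comp_sel(1,2)])
  show "FOb (phi_comp K E W F C) \<in> extensional (Ob (P0 W C))" "FAr (phi_comp K E W F C) \<in> extensional (Ar (P0 W C))"
    by (simp_all add: phi_comp_def)
  note s = C phi_comp_sel phi_comp_nt phi_fun_sel phi_fun_functor s_simps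
  show "FAr (phi_comp K E W F C) (Idt (P0 W C) Y) = Idt (FunCat (P0 E C) \<X>) (FOb (phi_comp K E W F C) Y)"
    if "Y \<in> Ob (P0 W C)" for Y
    using that by (intro nt_eqI) (simp_all add: s is_nt_id)
  show "FAr (phi_comp K E W F C) (v' \<cdot>\<^bsub>P0 W C\<^esub> v) =
     FAr (phi_comp K E W F C) v' \<cdot>\<^bsub>FunCat (P0 E C) \<X>\<^esub> FAr (phi_comp K E W F C) v"
    if "v \<in> Ar (P0 W C)" "v' \<in> Ar (P0 W C)" "Src (P0 W C) v' = Tgt (P0 W C) v" for v v'
    using that by (simp, intro nt_eqI) (simp_all add: s is_nt_vcomp F_loc_comp W_arrow_W_arrow)
qed (use C in \<open>simp_all add: phi_comp_sel phi_comp_nt phi_fun_sel phi_fun_functor Functors_iff FunCat_Ar category_FunCat s_simps\<close>)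

lemma phi_cell_sel:
  assumes f: "f \<in> Ar1 K"
  shows "NDom (phi_cell K E W F f) = phi_comp K E W F (Dom1 K f) \<circ>\<^sub>F P1 W f"
    "NCod (phi_cell K E W F f) = precomp \<X> (P1 E f) \<circ>\<^sub>F phi_comp K E W F (Cod1 K f)"
    "Y \<in> Ob (P0 W (Cod1 K f)) \<Longrightarrow> x \<in> Ob (P0 E (Dom1 K f)) \<Longrightarrow> NC (NC (phi_cell K E W F f) Y) x = F_loc (base_arrow f x Y)"
  by (simp_all add: phi_cell_def Let_def F_simps base_arrow_def)

lemma phi_cell_nt:
  assumes f: "f \<in> Ar1 K" shows "is_nt (phi_cell K E W F f)"
proof -
  note s = f phi_comp_sel phi_comp_nt phi_comp_functor phi_fun_sel phi_fun_functor s_simps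
  show ?thesis
  proof (rule is_nt2I)
    show "phi_cell K E W F f = \<lparr>NDom = phi_comp K E W F (Dom1 K f) \<circ>\<^sub>F P1 W f,
        NCod = precomp \<X> (P1 E f) \<circ>\<^sub>F phi_comp K E W F (Cod1 K f),
        NC = (\<lambda>Y\<in>Ob (P0 W (Cod1 K f)). \<lparr>NDom = FOb (phi_comp K E W F (Dom1 K f) \<circ>\<^sub>F P1 W f) Y,
         NCod = FOb (precomp \<X> (P1 E f) \<circ>\<^sub>F phi_comp K E W F (Cod1 K f)) Y,
         NC = (\<lambda>x\<in>Ob (P0 E (Dom1 K f)). F_loc (base_arrow f x Y))\<rparr>)\<rparr>"
      by (simp add: phi_cell_def Let_def F_simps base_arrow_def)
    show "phi_comp K E W F (Dom1 K f) \<circ>\<^sub>F P1 W f \<in> Functors (P0 W (Cod1 K f)) (FunCat (P0 E (Dom1 K f)) \<X>)"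
      "precomp \<X> (P1 E f) \<circ>\<^sub>F phi_comp K E W F (Cod1 K f) \<in> Functors (P0 W (Cod1 K f)) (FunCat (P0 E (Dom1 K f)) \<X>)"
      by (simp_all add: Functors_iff is_functor_fcomp is_functor_precomp s)
    have a: "FAr (phi_comp K E W F (Cod1 K f)) v \<in> Ar (FunCat (P0 E (Cod1 K f)) \<X>)" if "v \<in> Ar (P0 W (Cod1 K f))" for v
      using that by (simp add: FunCat_Ar s)
    show "F_loc (base_arrow f x (Tgt (P0 W (Cod1 K f)) v)) \<cdot>\<^bsub>\<X>\<^esub> NC (FAr (phi_comp K E W F (Dom1 K f) \<circ>\<^sub>F P1 W f) v) x =
       NC (FAr (precomp \<X> (P1 E f) \<circ>\<^sub>F phi_comp K E W F (Cod1 K f)) v) x \<cdot>\<^bsub>\<X>\<^esub> F_loc (base_arrow f x (Src (P0 W (Cod1 K f)) v))"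
      if "v \<in> Ar (P0 W (Cod1 K f))" "x \<in> Ob (P0 E (Dom1 K f))" for v x
      using that a by (simp add: s whisker_right_NC F_loc_comp base_arrow_W_arrow)
  qed (simp_all add: s Functors_iff F_loc_comp base_arrow_E_arrow)
qed

lemma phi_ob_sel: "C \<in> Ob0 K \<Longrightarrow> TOb (phi_ob K E W F) C = phi_comp K E W F C"
  "f \<in> Ar1 K \<Longrightarrow> TCell (phi_ob K E W F) f = phi_cell K E W F f"
  by (simp_all add: phi_ob_def)

sublocale phi: transformation_frame K E W \<X> "phi_ob K E W F"
proof (intro transformation_frame.intro transformation_frame_axioms.intro weight_axioms)
  show "category \<X>" by (rule F_X)
  show "TOb (phi_ob K E W F) C \<in> Functors (P0 W C) (FunCat (P0 E C) \<X>)" if "C \<in> Ob0 K" for C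
    using that by (simp add: phi_ob_sel Functors_iff phi_comp_functor phi_comp_sel)
  show "TCell (phi_ob K E W F) f \<in> Hom (FunCat (P0 W (Cod1 K f)) (FunCat (P0 E (Dom1 K f)) \<X>))
        (TOb (phi_ob K E W F) (Dom1 K f) \<circ>\<^sub>F P1 W f) (precomp \<X> (P1 E f) \<circ>\<^sub>F TOb (phi_ob K E W F) (Cod1 K f))"
    if "f \<in> Ar1 K" for f
    using that by (simp add: phi_ob_sel Hom_iff FunCat_Ar phi_cell_nt phi_cell_sel phi_comp_sel simps)
qed

lemma phi_T_ob: "C \<in> Ob0 K \<Longrightarrow> Y \<in> Ob (P0 W C) \<Longrightarrow> x \<in> Ob (P0 E C) \<Longrightarrow> phi.T_ob C Y x = FOb F (C, x, Y)"
  and phi_T_E: "C \<in> Ob0 K \<Longrightarrow> Y \<in> Ob (P0 W C) \<Longrightarrow> u \<in> Ar (P0 E C) \<Longrightarrow> phi.T_E C Y u = F_loc (E_arrow C Y u)"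
  and phi_T_W: "C \<in> Ob0 K \<Longrightarrow> v \<in> Ar (P0 W C) \<Longrightarrow> x \<in> Ob (P0 E C) \<Longrightarrow> phi.T_W C v x = F_loc (W_arrow C x v)"
  and phi_T_cell: "f \<in> Ar1 K \<Longrightarrow> Y \<in> Ob (P0 W (Cod1 K f)) \<Longrightarrow> x \<in> Ob (P0 E (Dom1 K f)) \<Longrightarrow> phi.T_cell f Y x = F_loc (base_arrow f x Y)"
  by (simp_all add: phi_ob_sel phi_comp_sel phi_fun_sel phi_cell_sel)

text \<open>
  The axioms for \<open>\<Phi>(F)\<close> are the images under \<open>F\<close> of the relations between the generators:
  \<open>base_arrow_cell\<close> for 2-cells, \<open>base_arrow_Id\<close> for units, \<open>base_arrow_comp\<close> for composites. The coherence
  cells are invertible because base arrows are cartesian and hence inverted in \<open>E \<star> W\<close>.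
\<close>

lemma phi_pnat: "pnat_into \<X> (phi_ob K E W F)"
proof -
  note s = s_simps phi_T_ob phi_T_E phi_T_W phi_T_cell
  have "phi.T_cell (Cod2 K \<alpha>) Y x \<cdot>\<^bsub>\<X>\<^esub> phi.T_W (Dom1 K (Dom2 K \<alpha>)) (NC (P2 W \<alpha>) Y) x =
      phi.T_E (Cod1 K (Dom2 K \<alpha>)) Y (NC (P2 E \<alpha>) x) \<cdot>\<^bsub>\<X>\<^esub> phi.T_cell (Dom2 K \<alpha>) Y x"
    if "\<alpha> \<in> Ar2 K" "Y \<in> Ob (P0 W (Cod1 K (Dom2 K \<alpha>)))" "x \<in> Ob (P0 E (Dom1 K (Dom2 K \<alpha>)))" for \<alpha> Y x
    using that F_loc_cell[OF base_arrow_cell[OF that(1,3,2)]] by (simp add: s F_loc_comp)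
  moreover have "phi.T_cell (g \<odot>\<^bsub>K\<^esub> f) Y x \<cdot>\<^bsub>\<X>\<^esub> phi.T_W (Dom1 K f) (NC (PC W f g) Y) x =
      phi.T_E (Cod1 K g) Y (NC (PC E g f) x) \<cdot>\<^bsub>\<X>\<^esub> (phi.T_cell g Y (FOb (P1 E f) x) \<cdot>\<^bsub>\<X>\<^esub> phi.T_cell f (FOb (P1 W g) Y) x)"
    if "f \<in> Ar1 K" "g \<in> Ar1 K" "Dom1 K g = Cod1 K f" "Y \<in> Ob (P0 W (Cod1 K g))" "x \<in> Ob (P0 E (Dom1 K f))" for f g Y x
  proof -
    let ?c = "DComp (base_arrow g (FOb (P1 E f) x) Y) (base_arrow f x (FOb (P1 W g) Y))"
    have c: "F_loc (base_arrow g (FOb (P1 E f) x) Y) \<cdot>\<^bsub>\<X>\<^esub> F_loc (base_arrow f x (FOb (P1 W g) Y)) = F_loc ?c"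
      using that by (intro F_loc_comp) (simp_all add: s)
    have d: "?c \<in> DAr" "snd (snd ?c) = (Cod1 K g, FOb (P1 E g) (FOb (P1 E f) x), Y)"
      using that base_arrow_ar[of f x "FOb (P1 W g) Y"] base_arrow_ar[of g "FOb (P1 E f) x" Y] by (auto simp: base_arrow_def s intro: delta_comp_ar) (simp add: delta_comp_eq)
    show ?thesis
      using that base_arrow_comp[OF that(1,2,3,5,4)] d by (simp add: s c) (simp add: s F_loc_comp)
  qed
  moreover have "TOb (phi_ob K E W F) \<in> extensional (Ob0 K)" "TCell (phi_ob K E W F) \<in> extensional (Ar1 K)"
    by (simp_all add: phi_ob_def)
  ultimately show ?thesis
    unfolding phi.is_pnat_iff by (simp add: s F_loc_invertible base_arrow_cartesian)
qed

end

lemma (in weight) star_functorI: "F \<in> Functors ST \<X> \<Longrightarrow> star_functor K E W \<X> F"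
  by (intro star_functor.intro star_functor_axioms.intro weight_axioms)

locale star_transformation = weight K E W
  for K :: "('c, 'f, 't) two_cat" and E :: "('c, 'f, 't, 'eo, 'ea) cat_psf" and W :: "('c, 'f, 't, 'wo, 'wa) cat_psf" +
  fixes \<X> :: "('x, 'y) cat" and \<alpha> :: "(('c, 'eo, 'wo) dob, ('c, 'f, 'eo, 'ea, 'wo, 'wa) sar, 'x, 'y) nt"
  assumes nt: "\<alpha> \<in> Ar (FunCat ST \<X>)"
begin

sublocale dom: star_functor K E W \<X> "NDom \<alpha>"
  using nt by (intro star_functorI) (auto simp: FunCat_Ar Functors_iff nt_simps)

sublocale cod: star_functor K E W \<X> "NCod \<alpha>"
  using nt by (intro star_functorI) (auto simp: FunCat_Ar Functors_iff nt_simps)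

lemma \<alpha>_Ar: "C \<in> Ob0 K \<Longrightarrow> x \<in> Ob (P0 E C) \<Longrightarrow> Y \<in> Ob (P0 W C) \<Longrightarrow> NC \<alpha> (C, x, Y) \<in> Ar \<X>"
  "C \<in> Ob0 K \<Longrightarrow> x \<in> Ob (P0 E C) \<Longrightarrow> Y \<in> Ob (P0 W C) \<Longrightarrow> Src \<X> (NC \<alpha> (C, x, Y)) = FOb (NDom \<alpha>) (C, x, Y)"
  "C \<in> Ob0 K \<Longrightarrow> x \<in> Ob (P0 E C) \<Longrightarrow> Y \<in> Ob (P0 W C) \<Longrightarrow> Tgt \<X> (NC \<alpha> (C, x, Y)) = FOb (NCod \<alpha>) (C, x, Y)"
  using nt is_nt.NC_Ar[of \<alpha> \<X> "(C, x, Y)"] is_nt.Src_NC[of \<alpha> \<X> "(C, x, Y)"] is_nt.Tgt_NC[of \<alpha> \<X> "(C, x, Y)"]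
  by (simp_all add: FunCat_Ar Star_Ob delta_ob_iff)

lemma \<alpha>_natural: "a \<in> DAr \<Longrightarrow> fst a = P \<Longrightarrow> snd (snd a) = Q \<Longrightarrow>
    NC \<alpha> Q \<cdot>\<^bsub>\<X>\<^esub> dom.F_loc a = cod.F_loc a \<cdot>\<^bsub>\<X>\<^esub> NC \<alpha> P"
  using is_nt.NC_natural[of \<alpha> ST \<X> "loc a" P Q] nt star_ar_simps[of a] by (simp add: FunCat_Ar)

lemmas a_simps = dom.s_simps cod.s_simps \<alpha>_Ar dom.phi_T_ob dom.phi_T_E dom.phi_T_W dom.phi_T_cell
  cod.phi_T_ob cod.phi_T_E cod.phi_T_W cod.phi_T_cell

lemma phi_ar_sel: "MDom (phi_ar K E W \<alpha>) = phi_ob K E W (NDom \<alpha>)" "MCod (phi_ar K E W \<alpha>) = phi_ob K E W (NCod \<alpha>)"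
  "C \<in> Ob0 K \<Longrightarrow> NDom (MC (phi_ar K E W \<alpha>) C) = phi_comp K E W (NDom \<alpha>) C"
  "C \<in> Ob0 K \<Longrightarrow> NCod (MC (phi_ar K E W \<alpha>) C) = phi_comp K E W (NCod \<alpha>) C"
  "C \<in> Ob0 K \<Longrightarrow> Y \<in> Ob (P0 W C) \<Longrightarrow> x \<in> Ob (P0 E C) \<Longrightarrow> NC (NC (MC (phi_ar K E W \<alpha>) C) Y) x = NC \<alpha> (C, x, Y)"
  by (simp_all add: phi_ar_def)

lemma phi_ar_nt:
  assumes C: "C \<in> Ob0 K" shows "is_nt (MC (phi_ar K E W \<alpha>) C)"
proof (rule is_nt2I)
  show "MC (phi_ar K E W \<alpha>) C = \<lparr>NDom = TOb (phi_ob K E W (NDom \<alpha>)) C, NCod = TOb (phi_ob K E W (NCod \<alpha>)) C,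
     NC = (\<lambda>Y\<in>Ob (P0 W C). \<lparr>NDom = FOb (TOb (phi_ob K E W (NDom \<alpha>)) C) Y, NCod = FOb (TOb (phi_ob K E W (NCod \<alpha>)) C) Y,
       NC = (\<lambda>x\<in>Ob (P0 E C). NC \<alpha> (C, x, Y))\<rparr>)\<rparr>"
    using C by (auto simp: phi_ar_def dom.phi_ob_sel cod.phi_ob_sel dom.phi_comp_sel cod.phi_comp_sel restrict_def)
  show "TOb (phi_ob K E W (NDom \<alpha>)) C \<in> Functors (P0 W C) (FunCat (P0 E C) \<X>)"
    "TOb (phi_ob K E W (NCod \<alpha>)) C \<in> Functors (P0 W C) (FunCat (P0 E C) \<X>)"
    using C by (simp_all add: dom.phi.frame_ob cod.phi.frame_ob)
qed (simp_all add: C a_simps \<alpha>_natural)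

lemma phi_ar_modif: "modif_into \<X> (phi_ar K E W \<alpha>)"
proof -
  have "MC (phi_ar K E W \<alpha>) \<in> extensional (Ob0 K)" by (simp add: phi_ar_def)
  then show ?thesis
    unfolding is_modif_iff[OF dom.F_X]
    by (simp add: phi_ar_sel dom.phi_pnat cod.phi_pnat Hom_iff FunCat_Ar phi_ar_nt dom.phi_ob_sel cod.phi_ob_sel dom.phi_comp_sel)
      (simp add: a_simps phi_ar_sel dom.phi_cell_sel cod.phi_cell_sel \<alpha>_natural)
qed

end

context weight
begin

lemma star_transformationI: "\<alpha> \<in> Ar (FunCat ST \<X>) \<Longrightarrow> star_transformation K E W \<X> \<alpha>"
  by (intro star_transformation.intro star_transformation_axioms.intro weight_axioms)

lemma Phi_functor:
  assumes X: "category \<X>"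
  shows "Phi K E W \<X> \<in> Functors (FunCat ST \<X>) (Cocones \<X>)"
proof -
  have sel: "FDom (Phi K E W \<X>) = FunCat ST \<X>" "FCod (Phi K E W \<X>) = Cocones \<X>"
     "F \<in> Functors ST \<X> \<Longrightarrow> FOb (Phi K E W \<X>) F = phi_ob K E W F"
     "\<alpha> \<in> Ar (FunCat ST \<X>) \<Longrightarrow> FAr (Phi K E W \<X>) \<alpha> = phi_ar K E W \<alpha>" for F \<alpha>
    by (simp_all add: Phi_def)
  have "is_functor (Phi K E W \<X>)"
  proof (rule is_functorI[OF sel(1,2)])
    show "FOb (Phi K E W \<X>) \<in> extensional (Ob (FunCat ST \<X>))" "FAr (Phi K E W \<X>) \<in> extensional (Ar (FunCat ST \<X>))"
      by (simp_all add: Phi_def)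
    show "category (FunCat ST \<X>)" "category (Cocones \<X>)"
      by (simp_all add: category_FunCat category_PsHom X)
    show "FOb (Phi K E W \<X>) F \<in> Ob (Cocones \<X>)" if "F \<in> Ob (FunCat ST \<X>)" for F
      using that star_functor.phi_pnat[OF star_functorI] by (simp add: sel)
    show "FAr (Phi K E W \<X>) \<alpha> \<in> Ar (Cocones \<X>) \<and>
         Src (Cocones \<X>) (FAr (Phi K E W \<X>) \<alpha>) = FOb (Phi K E W \<X>) (Src (FunCat ST \<X>) \<alpha>) \<and>
         Tgt (Cocones \<X>) (FAr (Phi K E W \<X>) \<alpha>) = FOb (Phi K E W \<X>) (Tgt (FunCat ST \<X>) \<alpha>)"
      if a: "\<alpha> \<in> Ar (FunCat ST \<X>)" for \<alpha>
    proof -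
      interpret star_transformation K E W \<X> \<alpha> by (rule star_transformationI[OF a])
      show ?thesis using a dom.F cod.F by (simp add: sel phi_ar_sel phi_ar_modif)
    qed
    show "FAr (Phi K E W \<X>) (Idt (FunCat ST \<X>) F) = Idt (Cocones \<X>) (FOb (Phi K E W \<X>) F)"
      if F: "F \<in> Ob (FunCat ST \<X>)" for F
    proof -
      have a: "nt_id F \<in> Ar (FunCat ST \<X>)" using F by (simp add: FunCat_Ar Functors_iff is_nt_id)
      interpret a: star_transformation K E W \<X> "nt_id F" by (rule star_transformationI[OF a])
      interpret star_functor K E W \<X> F using F by (intro star_functorI) simp
      have "phi_ar K E W (nt_id F) = \<lparr>MDom = phi_ob K E W F, MCod = phi_ob K E W F, MC = (\<lambda>C\<in>Ob0 K. nt_id (TOb (phi_ob K E W F) C))\<rparr>"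
        using a.phi_ar_modif modif_id[OF X phi_pnat]
      proof (rule modif_eqI)
        fix C assume "C \<in> Ob0 (op1 K)"
        then have C: "C \<in> Ob0 K" by simp
        have "MC (phi_ar K E W (nt_id F)) C = nt_id (TOb (phi_ob K E W F) C) \<longleftrightarrow>
          (\<forall>Y\<in>Ob (P0 W C). \<forall>x\<in>Ob (P0 E C). NC (NC (MC (phi_ar K E W (nt_id F)) C) Y) x = NC (NC (nt_id (TOb (phi_ob K E W F) C)) Y) x)"
          using C a.phi_ar_nt[OF C] phi.TOb_functor[OF C]
          by (intro nt2_eq_iff) (simp_all add: a.phi_ar_sel phi_ob_sel phi_comp_sel is_nt_id)
        then show "MC (phi_ar K E W (nt_id F)) C =
            MC \<lparr>MDom = phi_ob K E W F, MCod = phi_ob K E W F, MC = \<lambda>C\<in>Ob0 K. nt_id (TOb (phi_ob K E W F) C)\<rparr> C"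
          using C by (simp add: a.phi_ar_sel phi_ob_sel phi_comp_sel phi_fun_sel F_simps Star_Ob delta_ob_iff)
      qed (simp_all add: a.phi_ar_sel)
      then show ?thesis using F a by (simp add: sel)
    qed
    show "FAr (Phi K E W \<X>) (\<beta> \<cdot>\<^bsub>FunCat ST \<X>\<^esub> \<alpha>) = FAr (Phi K E W \<X>) \<beta> \<cdot>\<^bsub>Cocones \<X>\<^esub> FAr (Phi K E W \<X>) \<alpha>"
      if a: "\<alpha> \<in> Ar (FunCat ST \<X>)" and b: "\<beta> \<in> Ar (FunCat ST \<X>)" and ab: "Src (FunCat ST \<X>) \<beta> = Tgt (FunCat ST \<X>) \<alpha>" for \<alpha> \<beta>
    proof -
      have e: "NDom \<beta> = NCod \<alpha>" using ab by simp
      have ba: "\<beta> \<bullet>\<^sub>N \<alpha> \<in> Ar (FunCat ST \<X>)" using a b e by (simp add: FunCat_Ar is_nt_vcomp)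
      interpret a: star_transformation K E W \<X> \<alpha> by (rule star_transformationI[OF a])
      interpret b: star_transformation K E W \<X> \<beta> by (rule star_transformationI[OF b])
      interpret ba: star_transformation K E W \<X> "\<beta> \<bullet>\<^sub>N \<alpha>" by (rule star_transformationI[OF ba])
      have m: "MDom (phi_ar K E W \<beta>) = MCod (phi_ar K E W \<alpha>)" by (simp add: a.phi_ar_sel b.phi_ar_sel e)
      let ?c = "\<lambda>C. MC (phi_ar K E W \<beta>) C \<bullet>\<^sub>N MC (phi_ar K E W \<alpha>) C"
      have "phi_ar K E W (\<beta> \<bullet>\<^sub>N \<alpha>) = \<lparr>MDom = MDom (phi_ar K E W \<alpha>), MCod = MCod (phi_ar K E W \<beta>), MC = (\<lambda>C\<in>Ob0 K. ?c C)\<rparr>"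
        using ba.phi_ar_modif modif_comp[OF X a.phi_ar_modif b.phi_ar_modif m]
      proof (rule modif_eqI)
        fix C assume "C \<in> Ob0 (op1 K)"
        then have C: "C \<in> Ob0 K" by simp
        have "MC (phi_ar K E W (\<beta> \<bullet>\<^sub>N \<alpha>)) C = ?c C \<longleftrightarrow>
          (\<forall>Y\<in>Ob (P0 W C). \<forall>x\<in>Ob (P0 E C). NC (NC (MC (phi_ar K E W (\<beta> \<bullet>\<^sub>N \<alpha>)) C) Y) x = NC (NC (?c C) Y) x)"
          using C a.phi_ar_nt[OF C] b.phi_ar_nt[OF C] ba.phi_ar_nt[OF C]
          by (intro nt2_eq_iff) (simp_all add: a.phi_ar_sel b.phi_ar_sel ba.phi_ar_sel a.dom.phi_comp_sel is_nt_vcomp e)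
        moreover have "NC (NC (?c C) Y) x = NC \<beta> (C, x, Y) \<cdot>\<^bsub>\<X>\<^esub> NC \<alpha> (C, x, Y)" if "Y \<in> Ob (P0 W C)" "x \<in> Ob (P0 E C)" for Y x
          using that C nt2_vcomp[OF a.phi_ar_nt[OF C], of "P0 E C" \<X> Y x "MC (phi_ar K E W \<beta>) C"]
          by (simp add: a.phi_ar_sel b.phi_ar_sel a.dom.phi_comp_sel)
        ultimately show "MC (phi_ar K E W (\<beta> \<bullet>\<^sub>N \<alpha>)) C =
            MC \<lparr>MDom = MDom (phi_ar K E W \<alpha>), MCod = MCod (phi_ar K E W \<beta>), MC = \<lambda>C\<in>Ob0 K. ?c C\<rparr> C"
          using C a by (simp add: ba.phi_ar_sel Star_Ob delta_ob_iff FunCat_Ar)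
      qed (simp_all add: a.phi_ar_sel b.phi_ar_sel ba.phi_ar_sel)
      then show ?thesis using a b ba by (simp add: sel)
    qed
  qed
  then show ?thesis by (simp add: Functors_iff sel)
qed

end

section \<open>The functor \<open>\<Psi>\<close>\<close>

text \<open>
  From an arbitrary pseudo-natural transformation \<open>\<theta>\<close>, the functor \<open>\<Psi>(\<theta>)\<close> is obtained by verifying that
  its defining formula on arrows of \<open>\<Delta>(E, W)\<close> is functorial, constant along 2-cells and invertible on
  cartesian arrows.
\<close>

locale cocone = transformation_frame K E W \<X> \<theta>
  for K :: "('c, 'f, 't) two_cat" and E :: "('c, 'f, 't, 'eo, 'ea) cat_psf" and W :: "('c, 'f, 't, 'wo, 'wa) cat_psf"
    and \<X> :: "('x, 'y) cat" and \<theta> +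
  assumes pnat: "pnat_into \<X> \<theta>"
begin

lemma T_cell_invertible: "f \<in> Ar1 K \<Longrightarrow> Y \<in> Ob (P0 W (Cod1 K f)) \<Longrightarrow> x \<in> Ob (P0 E (Dom1 K f)) \<Longrightarrow> invertible \<X> (T_cell f Y x)"
  and T_cell_cell: "\<alpha> \<in> Ar2 K \<Longrightarrow> Dom1 K (Dom2 K \<alpha>) = C \<Longrightarrow> Cod1 K (Dom2 K \<alpha>) = D \<Longrightarrow> Y \<in> Ob (P0 W D) \<Longrightarrow> x \<in> Ob (P0 E C) \<Longrightarrow>
      T_E D Y (NC (P2 E \<alpha>) x) \<cdot>\<^bsub>\<X>\<^esub> T_cell (Dom2 K \<alpha>) Y x = T_cell (Cod2 K \<alpha>) Y x \<cdot>\<^bsub>\<X>\<^esub> T_W C (NC (P2 W \<alpha>) Y) x"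
  and T_cell_Id: "C \<in> Ob0 K \<Longrightarrow> Y \<in> Ob (P0 W C) \<Longrightarrow> x \<in> Ob (P0 E C) \<Longrightarrow> T_cell (Id1 K C) Y x = Idt \<X> (T_ob C Y x)"
  and T_cell_comp: "f \<in> Ar1 K \<Longrightarrow> g \<in> Ar1 K \<Longrightarrow> Dom1 K g = Cod1 K f \<Longrightarrow> Dom1 K f = C \<Longrightarrow> Cod1 K g = D \<Longrightarrow>
      Y \<in> Ob (P0 W D) \<Longrightarrow> x \<in> Ob (P0 E C) \<Longrightarrow>
        T_cell (g \<odot>\<^bsub>K\<^esub> f) Y x \<cdot>\<^bsub>\<X>\<^esub> T_W C (NC (PC W f g) Y) x =
        T_E D Y (NC (PC E g f) x) \<cdot>\<^bsub>\<X>\<^esub> (T_cell g Y (FOb (P1 E f) x) \<cdot>\<^bsub>\<X>\<^esub> T_cell f (FOb (P1 W g) Y) x)"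
  using pnat[unfolded is_pnat_iff] by auto

lemmas c_simps = frame_simps t_simps T_cell_Id

lemma psi_gen_ar_eq: "psi_gen_ar \<X> \<theta> ((C, x, Y), (f, u, v), (D, A, B)) = T_E D B u \<cdot>\<^bsub>\<X>\<^esub> (T_cell f B x \<cdot>\<^bsub>\<X>\<^esub> T_W C v x)"
  by (simp add: psi_gen_ar_def)

lemma psi_gen_ob_eq: "psi_gen_ob \<theta> (C, x, Y) = T_ob C Y x"
  by (simp add: psi_gen_ob_def)

text \<open>
  The composition axiom trades the coherence cell of \<open>g \<circ> f\<close>, preceded by a comparison cell of \<open>W\<close>, for
  the cells of \<open>f\<close> and \<open>g\<close> followed by a comparison cell of \<open>E\<close>. The latter cancels against its inverse in
  the composite of triples, and naturality of the cells sorts the remaining factors.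
\<close>

lemma psi_gen_comp:
  assumes "((C, x, Y), (f, u, v), (D, A, B)) \<in> DAr" "((D, A, B), (g, p, q), (D', A', B')) \<in> DAr"
  shows "psi_gen_ar \<X> \<theta> (DComp ((D, A, B), (g, p, q), (D', A', B')) ((C, x, Y), (f, u, v), (D, A, B))) =
    psi_gen_ar \<X> \<theta> ((D, A, B), (g, p, q), (D', A', B')) \<cdot>\<^bsub>\<X>\<^esub> psi_gen_ar \<X> \<theta> ((C, x, Y), (f, u, v), (D, A, B))"
proof -
  note t = assms[unfolded delta_ar_iff]
  let ?E = "P0 E D'" let ?gu = "FAr (P1 E g) u" let ?i = "Inv ?E (NC (PC E g f) x)"
  let ?fq = "T_W C (FAr (P1 W f) q) x" let ?v = "T_W C v x" let ?fx = "FOb (P1 E f) x" let ?gB = "FOb (P1 W g) B'"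
  have i: "?i \<in> Ar ?E" "Src ?E ?i = FOb (P1 E (g \<odot>\<^bsub>K\<^esub> f)) x" "Tgt ?E ?i = FOb (P1 E g) ?fx"
    using t by (simp_all add: simps)
  have 1: "T_cell (g \<odot>\<^bsub>K\<^esub> f) B' x \<cdot>\<^bsub>\<X>\<^esub> (T_W C (NC (PC W f g) B') x \<cdot>\<^bsub>\<X>\<^esub> (?fq \<cdot>\<^bsub>\<X>\<^esub> ?v)) =
      T_E D' B' (NC (PC E g f) x) \<cdot>\<^bsub>\<X>\<^esub> ((T_cell g B' ?fx \<cdot>\<^bsub>\<X>\<^esub> T_cell f ?gB x) \<cdot>\<^bsub>\<X>\<^esub> (?fq \<cdot>\<^bsub>\<X>\<^esub> ?v))"
    by (rule category.extend_square[OF X T_cell_comp]) (use t in \<open>simp_all add: c_simps\<close>)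
  have 2: "T_cell f ?gB x \<cdot>\<^bsub>\<X>\<^esub> (?fq \<cdot>\<^bsub>\<X>\<^esub> ?v) = T_W D q ?fx \<cdot>\<^bsub>\<X>\<^esub> (T_cell f B x \<cdot>\<^bsub>\<X>\<^esub> ?v)"
    by (rule category.extend_square[OF X T_cell_natural_W]) (use t in \<open>simp_all add: c_simps\<close>)
  have "T_E D' B' ?i \<cdot>\<^bsub>\<X>\<^esub> T_E D' B' (NC (PC E g f) x) = T_E D' B' (?i \<cdot>\<^bsub>?E\<^esub> NC (PC E g f) x)"
    using t i by (simp add: c_simps del: category.Inv_cmp)
  also have "\<dots> = Idt \<X> (T_ob D' B' (FOb (P1 E g) ?fx))" using t by (simp add: c_simps)
  finally have "T_E D' B' ?i \<cdot>\<^bsub>\<X>\<^esub> (T_E D' B' (NC (PC E g f) x) \<cdot>\<^bsub>\<X>\<^esub> k) = k"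
    if "k \<in> Ar \<X>" "Tgt \<X> k = T_ob D' B' (FOb (P1 E g) ?fx)" for k
    using that t i category.cmp_assoc[OF X, of k "T_E D' B' (NC (PC E g f) x)" "T_E D' B' ?i"] by (simp add: c_simps)
  note 3 = this
  have 4: "T_E D' B' ?gu \<cdot>\<^bsub>\<X>\<^esub> (T_cell g B' ?fx \<cdot>\<^bsub>\<X>\<^esub> (T_W D q ?fx \<cdot>\<^bsub>\<X>\<^esub> (T_cell f B x \<cdot>\<^bsub>\<X>\<^esub> ?v))) =
     T_cell g B' A \<cdot>\<^bsub>\<X>\<^esub> (T_E D ?gB u \<cdot>\<^bsub>\<X>\<^esub> (T_W D q ?fx \<cdot>\<^bsub>\<X>\<^esub> (T_cell f B x \<cdot>\<^bsub>\<X>\<^esub> ?v)))"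
    by (rule category.extend_square[OF X T_cell_natural_E[symmetric]]) (use t in \<open>simp_all add: c_simps\<close>)
  have 5: "T_E D ?gB u \<cdot>\<^bsub>\<X>\<^esub> (T_W D q ?fx \<cdot>\<^bsub>\<X>\<^esub> (T_cell f B x \<cdot>\<^bsub>\<X>\<^esub> ?v)) = T_W D q A \<cdot>\<^bsub>\<X>\<^esub> (T_E D B u \<cdot>\<^bsub>\<X>\<^esub> (T_cell f B x \<cdot>\<^bsub>\<X>\<^esub> ?v))"
    by (rule category.extend_square[OF X T_W_natural[symmetric]]) (use t in \<open>simp_all add: c_simps\<close>)
  show ?thesis
    using t i 1 2 4 5 by (simp add: delta_comp_eq psi_gen_ar_eq c_simps 3)
qed

lemma psi_gen_typed:
  assumes "((C, x, Y), (f, u, v), (D, A, B)) \<in> DAr"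
  shows "psi_gen_ar \<X> \<theta> ((C, x, Y), (f, u, v), (D, A, B)) \<in> Ar \<X>"
    "Src \<X> (psi_gen_ar \<X> \<theta> ((C, x, Y), (f, u, v), (D, A, B))) = T_ob C Y x"
    "Tgt \<X> (psi_gen_ar \<X> \<theta> ((C, x, Y), (f, u, v), (D, A, B))) = T_ob D B A"
  using assms by (simp_all add: delta_ar_iff psi_gen_ar_eq c_simps)

text \<open>
  With 2-cells of \<open>\<Delta>(E, W)\<close> as defined, this is exactly the axiom of naturality of \<open>\<theta>\<close> in 2-cells.
\<close>

lemma psi_gen_cell:
  assumes "(a, \<alpha>, b) \<in> DCell" shows "psi_gen_ar \<X> \<theta> a = psi_gen_ar \<X> \<theta> b"
proof -
  obtain C x Y D A B p v where a: "\<alpha> \<in> Ar2 K"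
    "a = ((C, x, Y), (Dom2 K \<alpha>, p \<cdot>\<^bsub>P0 E D\<^esub> NC (P2 E \<alpha>) x, v), (D, A, B))"
    "b = ((C, x, Y), (Cod2 K \<alpha>, p, NC (P2 W \<alpha>) B \<cdot>\<^bsub>P0 W C\<^esub> v), (D, A, B))"
    and t: "((C, x, Y), (Dom2 K \<alpha>, p \<cdot>\<^bsub>P0 E D\<^esub> NC (P2 E \<alpha>) x, v), (D, A, B)) \<in> DAr"
    "((C, x, Y), (Cod2 K \<alpha>, p, NC (P2 W \<alpha>) B \<cdot>\<^bsub>P0 W C\<^esub> v), (D, A, B)) \<in> DAr"
    by (rule delta_cellE[OF assms]) auto
  have p: "p \<in> Ar (P0 E D)" "Src (P0 E D) p = FOb (P1 E (Cod2 K \<alpha>)) x" and v: "v \<in> Ar (P0 W C)" "Tgt (P0 W C) v = FOb (P1 W (Dom2 K \<alpha>)) B"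
    using t by (auto simp: delta_ar_iff)
  note t' = a(1) t[unfolded delta_ar_iff]
  have "T_E D B (NC (P2 E \<alpha>) x) \<cdot>\<^bsub>\<X>\<^esub> (T_cell (Dom2 K \<alpha>) B x \<cdot>\<^bsub>\<X>\<^esub> T_W C v x) =
     T_cell (Cod2 K \<alpha>) B x \<cdot>\<^bsub>\<X>\<^esub> (T_W C (NC (P2 W \<alpha>) B) x \<cdot>\<^bsub>\<X>\<^esub> T_W C v x)"
    by (rule category.extend_square[OF X T_cell_cell]) (use t' p v in \<open>simp_all add: c_simps\<close>)
  then show ?thesis using t' p v by (simp add: a psi_gen_ar_eq c_simps)
qed

lemma psi_gen_invertible:
  assumes "cartesian K E W a" shows "invertible \<X> (psi_gen_ar \<X> \<theta> a)"
proof -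
  obtain C x Y f u v D A B where a: "a = ((C, x, Y), (f, u, v), (D, A, B))" by (cases a) auto
  have t: "((C, x, Y), (f, u, v), (D, A, B)) \<in> DAr" and i: "invertible (P0 E D) u" "invertible (P0 W C) v"
    using assms by (simp_all add: a cartesian_iff)
  note t' = t[unfolded delta_ar_iff]
  have "invertible \<X> (T_E D B u)"
    using t' i is_functor.FAr_invertible[OF TObY_functor, of D B u] by (simp add: frame_simps)
  moreover have "invertible (FunCat (P0 E C) \<X>) (FAr (TOb \<theta> C) v)"
    using t' i is_functor.FAr_invertible[OF TOb_functor, of C v] by (simp add: frame_simps)
  then have "invertible \<X> (T_W C v x)"
    using t' invertible_FunCat_iff[of "FAr (TOb \<theta> C) v" "P0 E C" \<X>] by (simp add: invertible_Ar)
  moreover have "invertible \<X> (T_cell f B x)" using t' by (simp add: T_cell_invertible)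
  ultimately show ?thesis
    unfolding a psi_gen_ar_eq using t' by (intro category.invertible_cmp[OF X]) (simp_all add: c_simps)
qed

lemma psi_ob_facts:
  shows psi_ob_functor: "psi_ob K E W \<X> \<theta> \<in> Functors ST \<X>"
    and psi_ob_FOb: "P \<in> DOb \<Longrightarrow> FOb (psi_ob K E W \<X> \<theta>) P = psi_gen_ob \<theta> P"
    and psi_ob_FAr: "a \<in> DAr \<Longrightarrow> FAr (psi_ob K E W \<X> \<theta>) (loc a) = psi_gen_ar \<X> \<theta> a"
proof -
  let ?P = "\<lambda>H. H \<in> Functors ST \<X> \<and> (\<forall>P \<in> DOb. FOb H P = psi_gen_ob \<theta> P) \<and>
     (\<forall>a \<in> DAr. FAr H (loc a) = psi_gen_ar \<X> \<theta> a)"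
  have "\<exists>H\<in>Functors ST \<X>. (\<forall>P\<in>DOb. FOb H P = psi_gen_ob \<theta> P) \<and> (\<forall>a\<in>DAr. FAr H (loc a) = psi_gen_ar \<X> \<theta> a)"
  proof (rule Star_functor_exists[OF X])
    show "psi_gen_ob \<theta> P \<in> Ob \<X>" if "P \<in> DOb" for P
      using that by (cases P) (simp add: psi_gen_ob_eq delta_ob_iff c_simps)
    show "psi_gen_ar \<X> \<theta> a \<in> Ar \<X> \<and> Src \<X> (psi_gen_ar \<X> \<theta> a) = psi_gen_ob \<theta> (fst a) \<and>
        Tgt \<X> (psi_gen_ar \<X> \<theta> a) = psi_gen_ob \<theta> (snd (snd a))" if "a \<in> DAr" for a
      by (rule delta_arE[OF that]) (simp add: psi_gen_typed psi_gen_ob_eq)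
    show "psi_gen_ar \<X> \<theta> (DId P) = Idt \<X> (psi_gen_ob \<theta> P)" if "P \<in> DOb" for P
      using that by (cases P) (simp add: psi_gen_ob_eq psi_gen_ar_eq delta_id_eq delta_ob_iff c_simps)
    show "psi_gen_ar \<X> \<theta> (DComp b a) = psi_gen_ar \<X> \<theta> b \<cdot>\<^bsub>\<X>\<^esub> psi_gen_ar \<X> \<theta> a"
      if a: "a \<in> DAr" and b: "b \<in> DAr" and ab: "fst b = snd (snd a)" for a b
      by (rule delta_arE[OF a], rule delta_arE[OF b]) (use ab in \<open>simp add: psi_gen_comp\<close>)
  qed (auto intro: psi_gen_cell psi_gen_invertible)
  then obtain H where H: "?P H" by blast
  have "?P (THE H. ?P H)"
  proof (rule theI[of ?P, OF H])
    fix G assume "?P G" then show "G = H" using H by (intro Star_functor_eqI) auto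
  qed
  then have "?P (psi_ob K E W \<X> \<theta>)" unfolding psi_ob_def .
  then show "psi_ob K E W \<X> \<theta> \<in> Functors ST \<X>"
    "P \<in> DOb \<Longrightarrow> FOb (psi_ob K E W \<X> \<theta>) P = psi_gen_ob \<theta> P"
    "a \<in> DAr \<Longrightarrow> FAr (psi_ob K E W \<X> \<theta>) (loc a) = psi_gen_ar \<X> \<theta> a" by auto
qed

sublocale psi: star_functor K E W \<X> "psi_ob K E W \<X> \<theta>"
  by (rule star_functorI[OF psi_ob_functor])

lemma psi_T_ob: "C \<in> Ob0 K \<Longrightarrow> x \<in> Ob (P0 E C) \<Longrightarrow> Y \<in> Ob (P0 W C) \<Longrightarrow> FOb (psi_ob K E W \<X> \<theta>) (C, x, Y) = T_ob C Y x"
  by (simp add: psi_ob_FOb psi_gen_ob_eq delta_ob_iff)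

lemma psi_E_arrow: "C \<in> Ob0 K \<Longrightarrow> Y \<in> Ob (P0 W C) \<Longrightarrow> u \<in> Ar (P0 E C) \<Longrightarrow> psi.F_loc (E_arrow C Y u) = T_E C Y u"
  and psi_W_arrow: "C \<in> Ob0 K \<Longrightarrow> x \<in> Ob (P0 E C) \<Longrightarrow> v \<in> Ar (P0 W C) \<Longrightarrow> psi.F_loc (W_arrow C x v) = T_W C v x"
  and psi_base_arrow: "f \<in> Ar1 K \<Longrightarrow> x \<in> Ob (P0 E (Dom1 K f)) \<Longrightarrow> Y \<in> Ob (P0 W (Cod1 K f)) \<Longrightarrow> psi.F_loc (base_arrow f x Y) = T_cell f Y x"
  by (simp_all add: psi_ob_FAr E_arrow_ar W_arrow_ar base_arrow_ar, simp_all add: arr_defs psi_gen_ar_eq c_simps)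

lemma phi_psi_TOb:
  assumes C: "C \<in> Ob0 K" shows "phi_comp K E W (psi_ob K E W \<X> \<theta>) C = TOb \<theta> C"
proof (rule functor_eqI)
  note s = C psi.phi_comp_sel psi.phi_comp_functor psi.phi_comp_nt psi.phi_fun_sel psi.phi_fun_functor psi_T_ob psi_E_arrow psi_W_arrow c_simps
  have Y_eq: "phi_fun K E W (psi_ob K E W \<X> \<theta>) C Y = FOb (TOb \<theta> C) Y" if "Y \<in> Ob (P0 W C)" for Y
    by (rule functor_eqI) (use that in \<open>simp_all add: s\<close>)
  show "FOb (phi_comp K E W (psi_ob K E W \<X> \<theta>) C) Y = FOb (TOb \<theta> C) Y" if "Y \<in> Ob (FDom (TOb \<theta> C))" for Y
    using that Y_eq by (simp add: s)
  show "FAr (phi_comp K E W (psi_ob K E W \<X> \<theta>) C) v = FAr (TOb \<theta> C) v" if "v \<in> Ar (FDom (TOb \<theta> C))" for v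
    by (rule nt_eqI) (use that in \<open>simp_all add: s Y_eq\<close>)
qed (simp_all add: psi.phi_comp_functor psi.phi_comp_sel frame_simps C)

text \<open>
  On each kind of generator, two of the three factors in the formula for \<open>\<Psi>(\<theta>)\<close> are identities, by
  functoriality and by the unit axiom, and the third is the corresponding double component of \<open>\<theta>\<close>.
\<close>

lemma phi_psi: "phi_ob K E W (psi_ob K E W \<X> \<theta>) = \<theta>"
proof -
  have ext: "TOb \<theta> \<in> extensional (Ob0 K)" "TCell \<theta> \<in> extensional (Ar1 K)"
    using pnat[unfolded is_pnat_iff] by auto
  have "TOb (phi_ob K E W (psi_ob K E W \<X> \<theta>)) = TOb \<theta>"
    by (rule extensionalityI[OF _ ext(1)]) (simp_all add: phi_ob_def phi_psi_TOb)
  moreover have "phi_cell K E W (psi_ob K E W \<X> \<theta>) f = TCell \<theta> f" if f: "f \<in> Ar1 K" for f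
  proof -
    have "phi_cell K E W (psi_ob K E W \<X> \<theta>) f = TCell \<theta> f \<longleftrightarrow> (\<forall>Y\<in>Ob (P0 W (Cod1 K f)). \<forall>x\<in>Ob (P0 E (Dom1 K f)).
      NC (NC (phi_cell K E W (psi_ob K E W \<X> \<theta>) f) Y) x = T_cell f Y x)"
      by (rule nt2_eq_iff) (use f in \<open>simp_all add: psi.phi_cell_nt psi.phi_cell_sel phi_psi_TOb frame_simps\<close>)
    then show ?thesis using f by (simp add: psi.phi_cell_sel psi_base_arrow)
  qed
  then have "TCell (phi_ob K E W (psi_ob K E W \<X> \<theta>)) = TCell \<theta>"
    by (intro extensionalityI[OF _ ext(2)]) (simp_all add: phi_ob_def)
  ultimately show ?thesis by simp
qed

end

lemma (in weight) coconeI: "category \<X> \<Longrightarrow> pnat_into \<X> \<theta> \<Longrightarrow> cocone K E W \<X> \<theta>"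
  by (intro cocone.intro cocone_axioms.intro pnat_frame)

text \<open>
  By the factorization of arrows of \<open>\<Delta>(E, W)\<close>, the functor \<open>F\<close> satisfies the formula that characterizes
  \<open>\<Psi>(\<Phi>(F))\<close>.
\<close>

lemma (in star_functor) psi_phi: "psi_ob K E W \<X> (phi_ob K E W F) = F"
proof -
  interpret p: cocone K E W \<X> "phi_ob K E W F" by (rule coconeI[OF F_X phi_pnat])
  note s = s_simps phi_T_ob phi_T_E phi_T_W phi_T_cell
  show ?thesis
  proof (rule Star_functor_eqI[OF p.psi_ob_functor F])
    fix P assume "P \<in> DOb"
    then show "FOb (psi_ob K E W \<X> (phi_ob K E W F)) P = FOb F P"
      by (cases P) (simp add: p.psi_T_ob delta_ob_iff s)
  next
    fix a assume a: "a \<in> DAr"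
    then obtain C x Y f u v D A B where e: "a = ((C, x, Y), (f, u, v), (D, A, B))"
      and t: "((C, x, Y), (f, u, v), (D, A, B)) \<in> DAr" by (rule delta_arE)
    note t' = t[unfolded delta_ar_iff]
    let ?c = "DComp (base_arrow f x B) (W_arrow C x v)"
    have ar: "base_arrow f x B \<in> DAr" "W_arrow C x v \<in> DAr" using t' by (simp_all add: s)
    have "?c \<in> DAr" "snd (snd ?c) = (D, FOb (P1 E f) x, B)"
      using ar t' delta_comp_ar by (simp_all add: arr_defs) (simp add: delta_comp_eq)
    then have "F_loc (DComp (E_arrow D B u) ?c) = F_loc (E_arrow D B u) \<cdot>\<^bsub>\<X>\<^esub> (F_loc (base_arrow f x B) \<cdot>\<^bsub>\<X>\<^esub> F_loc (W_arrow C x v))"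
      using t' ar by (simp add: F_loc_comp s)
    then have "F_loc a = psi_gen_ar \<X> (phi_ob K E W F) a"
      using t' unfolding e p.psi_gen_ar_eq delta_ar_factor[OF t, symmetric] by (simp add: s)
    then show "FAr (psi_ob K E W \<X> (phi_ob K E W F)) (loc a) = FAr F (loc a)"
      using a by (simp add: p.psi_ob_FAr)
  qed
qed

locale cocone_modification = weight K E W
  for K :: "('c, 'f, 't) two_cat" and E :: "('c, 'f, 't, 'eo, 'ea) cat_psf" and W :: "('c, 'f, 't, 'wo, 'wa) cat_psf" +
  fixes \<X> :: "('x, 'y) cat"
    and m :: "('c, 'f, 'wo, 'wa, ('eo, 'ea, 'x, 'y) fnct, ('eo, 'ea, 'x, 'y) nt) modif"
  assumes X: "category \<X>" and modif: "modif_into \<X> m"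
begin

sublocale modification_frame K E W \<X> "MDom m" "MCod m" "MC m"
  by (rule modif_frame[OF X modif])

sublocale dom: cocone K E W \<X> "MDom m"
  using modif by (intro coconeI X) (auto simp: is_modif_def)

sublocale cod: cocone K E W \<X> "MCod m"
  using modif by (intro coconeI X) (auto simp: is_modif_def)

lemma M_at_cell: "f \<in> Ar1 K \<Longrightarrow> Dom1 K f = C \<Longrightarrow> Cod1 K f = D \<Longrightarrow> Y \<in> Ob (P0 W D) \<Longrightarrow> x \<in> Ob (P0 E C) \<Longrightarrow>
    M_at D Y (FOb (P1 E f) x) \<cdot>\<^bsub>\<X>\<^esub> dom.T_cell f Y x = cod.T_cell f Y x \<cdot>\<^bsub>\<X>\<^esub> M_at C (FOb (P1 W f) Y) x"
  using modif[unfolded is_modif_iff[OF X]] by auto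

lemma psi_ar_sel: "NDom (psi_ar K E W \<X> m) = psi_ob K E W \<X> (MDom m)" "NCod (psi_ar K E W \<X> m) = psi_ob K E W \<X> (MCod m)"
  "C \<in> Ob0 K \<Longrightarrow> x \<in> Ob (P0 E C) \<Longrightarrow> Y \<in> Ob (P0 W C) \<Longrightarrow> NC (psi_ar K E W \<X> m) (C, x, Y) = M_at C Y x"
  by (simp_all add: psi_ar_def delta_ob_iff)

lemmas m_simps = dom.c_simps cod.c_simps M_at_Ar M_at_Src M_at_Tgt

text \<open>
  By \<open>Star_natural\<close> it suffices to consider the arrows of \<open>\<Delta>(E, W)\<close>, on which the component of \<open>m\<close> is moved
  past the three factors in turn.
\<close>

lemma psi_ar_nt: "is_nt (psi_ar K E W \<X> m)"
proof (rule is_ntI[OF psi_ar_sel(1,2) dom.psi_ob_functor cod.psi_ob_functor])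
  show "NC (psi_ar K E W \<X> m) \<in> extensional (Ob ST)"
    by (simp add: psi_ar_def Star_Ob)
  have typed: "NC (psi_ar K E W \<X> m) P \<in> Ar \<X> \<and> Src \<X> (NC (psi_ar K E W \<X> m) P) = FOb (psi_ob K E W \<X> (MDom m)) P \<and>
      Tgt \<X> (NC (psi_ar K E W \<X> m) P) = FOb (psi_ob K E W \<X> (MCod m)) P" if "P \<in> DOb" for P
    using that by (cases P) (simp add: delta_ob_iff psi_ar_sel dom.psi_T_ob cod.psi_T_ob m_simps)
  then show "NC (psi_ar K E W \<X> m) P \<in> Ar \<X> \<and> Src \<X> (NC (psi_ar K E W \<X> m) P) = FOb (psi_ob K E W \<X> (MDom m)) P \<and>
      Tgt \<X> (NC (psi_ar K E W \<X> m) P) = FOb (psi_ob K E W \<X> (MCod m)) P" if "P \<in> Ob ST" for P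
    using that by (simp add: Star_Ob)
  show "NC (psi_ar K E W \<X> m) (Tgt ST c) \<cdot>\<^bsub>\<X>\<^esub> FAr (psi_ob K E W \<X> (MDom m)) c =
      FAr (psi_ob K E W \<X> (MCod m)) c \<cdot>\<^bsub>\<X>\<^esub> NC (psi_ar K E W \<X> m) (Src ST c)" if "c \<in> Ar ST" for c
  proof (rule Star_natural[OF dom.psi_ob_functor cod.psi_ob_functor typed _ that])
    fix a assume a: "a \<in> DAr"
    then obtain C x Y f u v D A B where e: "a = ((C, x, Y), (f, u, v), (D, A, B))"
      and t: "((C, x, Y), (f, u, v), (D, A, B)) \<in> DAr" by (rule delta_arE)
    note t' = t[unfolded delta_ar_iff]
    let ?fx = "FOb (P1 E f) x" let ?fB = "FOb (P1 W f) B"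
    have 1: "M_at D B A \<cdot>\<^bsub>\<X>\<^esub> (dom.T_E D B u \<cdot>\<^bsub>\<X>\<^esub> (dom.T_cell f B x \<cdot>\<^bsub>\<X>\<^esub> dom.T_W C v x)) =
      cod.T_E D B u \<cdot>\<^bsub>\<X>\<^esub> (M_at D B ?fx \<cdot>\<^bsub>\<X>\<^esub> (dom.T_cell f B x \<cdot>\<^bsub>\<X>\<^esub> dom.T_W C v x))"
      by (rule category.extend_square[OF X M_at_natural_E]) (use t' in \<open>simp_all add: m_simps\<close>)
    have 2: "M_at D B ?fx \<cdot>\<^bsub>\<X>\<^esub> (dom.T_cell f B x \<cdot>\<^bsub>\<X>\<^esub> dom.T_W C v x) = cod.T_cell f B x \<cdot>\<^bsub>\<X>\<^esub> (M_at C ?fB x \<cdot>\<^bsub>\<X>\<^esub> dom.T_W C v x)"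
      by (rule category.extend_square[OF X M_at_cell]) (use t' in \<open>simp_all add: m_simps\<close>)
    have 3: "M_at C ?fB x \<cdot>\<^bsub>\<X>\<^esub> dom.T_W C v x = cod.T_W C v x \<cdot>\<^bsub>\<X>\<^esub> M_at C Y x"
      by (rule M_at_natural_W) (use t' in simp_all)
    show "NC (psi_ar K E W \<X> m) (snd (snd a)) \<cdot>\<^bsub>\<X>\<^esub> FAr (psi_ob K E W \<X> (MDom m)) (loc a) =
        FAr (psi_ob K E W \<X> (MCod m)) (loc a) \<cdot>\<^bsub>\<X>\<^esub> NC (psi_ar K E W \<X> m) (fst a)"
      using a t' 1 2 3 by (simp add: dom.psi_ob_FAr cod.psi_ob_FAr)
        (simp add: e dom.psi_gen_ar_eq cod.psi_gen_ar_eq psi_ar_sel m_simps)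
  qed
qed

lemma phi_psi_ar: "phi_ar K E W (psi_ar K E W \<X> m) = m"
proof -
  have a: "psi_ar K E W \<X> m \<in> Ar (FunCat ST \<X>)"
    using psi_ar_nt dom.psi_ob_functor by (simp add: FunCat_Ar psi_ar_sel Functors_iff)
  interpret a: star_transformation K E W \<X> "psi_ar K E W \<X> m" by (rule star_transformationI[OF a])
  show ?thesis
  proof (rule modif_eqI[OF a.phi_ar_modif modif])
    fix C assume "C \<in> Ob0 (op1 K)"
    then have C: "C \<in> Ob0 K" by simp
    have "MC (phi_ar K E W (psi_ar K E W \<X> m)) C = MC m C \<longleftrightarrow>
      (\<forall>Y\<in>Ob (P0 W C). \<forall>x\<in>Ob (P0 E C). NC (NC (MC (phi_ar K E W (psi_ar K E W \<X> m)) C) Y) x = M_at C Y x)"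
      by (rule nt2_eq_iff) (use C in \<open>simp_all add: a.phi_ar_nt a.phi_ar_sel psi_ar_sel dom.phi_psi_TOb cod.phi_psi_TOb
         m_nt m_dom m_cod dom.frame_simps\<close>)
    then show "MC (phi_ar K E W (psi_ar K E W \<X> m)) C = MC m C" using C by (simp add: a.phi_ar_sel psi_ar_sel)
  qed (simp_all add: a.phi_ar_sel psi_ar_sel dom.phi_psi cod.phi_psi)
qed

end

lemma (in weight) cocone_modificationI: "category \<X> \<Longrightarrow> modif_into \<X> m \<Longrightarrow> cocone_modification K E W \<X> m"
  by (intro cocone_modification.intro cocone_modification_axioms.intro weight_axioms)

lemma (in star_transformation) psi_phi_ar: "psi_ar K E W \<X> (phi_ar K E W \<alpha>) = \<alpha>"
proof -
  interpret m: cocone_modification K E W \<X> "phi_ar K E W \<alpha>"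
    by (rule cocone_modificationI[OF dom.F_X phi_ar_modif])
  show ?thesis
  proof (rule nt_eqI[OF m.psi_ar_nt])
    show "is_nt \<alpha>" using nt by (simp add: FunCat_Ar)
    show "NC (psi_ar K E W \<X> (phi_ar K E W \<alpha>)) P = NC \<alpha> P" if "P \<in> Ob (FDom (NDom \<alpha>))" for P
      using that nt by (cases P) (simp add: FunCat_Ar Star_Ob delta_ob_iff m.psi_ar_sel phi_ar_sel)
  qed (simp_all add: m.psi_ar_sel phi_ar_sel dom.psi_phi cod.psi_phi)
qed

context weight
begin

lemma Psi_functor:
  assumes X: "category \<X>"
  shows "Psi K E W \<X> \<in> Functors (Cocones \<X>) (FunCat ST \<X>)"
proof -
  let ?P = "Cocones \<X>"
  have sel: "FDom (Psi K E W \<X>) = ?P" "FCod (Psi K E W \<X>) = FunCat ST \<X>"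
     "pnat_into \<X> \<theta> \<Longrightarrow> FOb (Psi K E W \<X>) \<theta> = psi_ob K E W \<X> \<theta>"
     "modif_into \<X> m \<Longrightarrow> FAr (Psi K E W \<X>) m = psi_ar K E W \<X> m" for \<theta> m
    by (simp_all add: Psi_def)
  have "is_functor (Psi K E W \<X>)"
  proof (rule is_functorI[OF sel(1,2)])
    show "FOb (Psi K E W \<X>) \<in> extensional (Ob ?P)" "FAr (Psi K E W \<X>) \<in> extensional (Ar ?P)"
      by (simp_all add: Psi_def)
    show "category (FunCat ST \<X>)" "category ?P" by (simp_all add: category_FunCat category_PsHom X)
    show "FOb (Psi K E W \<X>) \<theta> \<in> Ob (FunCat ST \<X>)" if "\<theta> \<in> Ob ?P" for \<theta>
      using that cocone.psi_ob_functor[OF coconeI[OF X]] by (simp add: sel)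
    show "FAr (Psi K E W \<X>) m \<in> Ar (FunCat ST \<X>) \<and>
         Src (FunCat ST \<X>) (FAr (Psi K E W \<X>) m) = FOb (Psi K E W \<X>) (Src ?P m) \<and>
         Tgt (FunCat ST \<X>) (FAr (Psi K E W \<X>) m) = FOb (Psi K E W \<X>) (Tgt ?P m)" if "m \<in> Ar ?P" for m
    proof -
      have m: "modif_into \<X> m" using that by simp
      interpret cocone_modification K E W \<X> m by (rule cocone_modificationI[OF X m])
      show ?thesis using m dom.pnat cod.pnat psi_ar_nt dom.psi_ob_functor by (simp add: sel psi_ar_sel FunCat_Ar Functors_iff)
    qed
    show "FAr (Psi K E W \<X>) (Idt ?P \<theta>) = Idt (FunCat ST \<X>) (FOb (Psi K E W \<X>) \<theta>)" if "\<theta> \<in> Ob ?P" for \<theta>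
    proof -
      have p: "pnat_into \<X> \<theta>" using that by simp
      interpret cocone K E W \<X> \<theta> by (rule coconeI[OF X p])
      let ?m = "\<lparr>MDom = \<theta>, MCod = \<theta>, MC = (\<lambda>A\<in>Ob0 K. nt_id (TOb \<theta> A))\<rparr>"
      have m: "modif_into \<X> ?m" by (rule modif_id[OF X p])
      interpret m: cocone_modification K E W \<X> ?m by (rule cocone_modificationI[OF X m])
      have "psi_ar K E W \<X> ?m = nt_id (psi_ob K E W \<X> \<theta>)"
      proof (rule nt_eqI[OF m.psi_ar_nt])
        show "is_nt (nt_id (psi_ob K E W \<X> \<theta>))" using psi.F_simps by (simp add: is_nt_id)
        show "NC (psi_ar K E W \<X> ?m) P = NC (nt_id (psi_ob K E W \<X> \<theta>)) P"
          if "P \<in> Ob (FDom (NDom (nt_id (psi_ob K E W \<X> \<theta>))))" for P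
          using that by (cases P) (simp add: psi.F_simps Star_Ob delta_ob_iff m.psi_ar_sel psi_T_ob c_simps)
      qed (simp_all add: m.psi_ar_sel)
      then show ?thesis using p m by (simp add: sel)
    qed
    show "FAr (Psi K E W \<X>) (n \<cdot>\<^bsub>?P\<^esub> m) = FAr (Psi K E W \<X>) n \<cdot>\<^bsub>FunCat ST \<X>\<^esub> FAr (Psi K E W \<X>) m"
      if "m \<in> Ar ?P" "n \<in> Ar ?P" "Src ?P n = Tgt ?P m" for m n
    proof -
      have m: "modif_into \<X> m" and n: "modif_into \<X> n" and mn: "MDom n = MCod m"
        using that by simp_all
      let ?c = "\<lparr>MDom = MDom m, MCod = MCod n, MC = (\<lambda>A\<in>Ob0 K. MC n A \<bullet>\<^sub>N MC m A)\<rparr>"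
      have c: "modif_into \<X> ?c" by (rule modif_comp[OF X m n mn])
      interpret m: cocone_modification K E W \<X> m by (rule cocone_modificationI[OF X m])
      interpret n: cocone_modification K E W \<X> n by (rule cocone_modificationI[OF X n])
      interpret c: cocone_modification K E W \<X> ?c by (rule cocone_modificationI[OF X c])
      have "psi_ar K E W \<X> ?c = psi_ar K E W \<X> n \<bullet>\<^sub>N psi_ar K E W \<X> m"
      proof (rule nt_eqI[OF c.psi_ar_nt])
        show "is_nt (psi_ar K E W \<X> n \<bullet>\<^sub>N psi_ar K E W \<X> m)"
          by (rule is_nt_vcomp[OF m.psi_ar_nt n.psi_ar_nt]) (simp add: m.psi_ar_sel n.psi_ar_sel mn)
        fix P assume "P \<in> Ob (FDom (NDom (psi_ar K E W \<X> n \<bullet>\<^sub>N psi_ar K E W \<X> m)))"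
        then obtain C x Y where P: "P = (C, x, Y)" and o: "C \<in> Ob0 K" "x \<in> Ob (P0 E C)" "Y \<in> Ob (P0 W C)"
          using m.dom.psi.F_simps by (cases P) (auto simp: m.psi_ar_sel Star_Ob delta_ob_iff)
        then show "NC (psi_ar K E W \<X> ?c) P = NC (psi_ar K E W \<X> n \<bullet>\<^sub>N psi_ar K E W \<X> m) P"
          using nt2_vcomp[OF m.m_nt[of C], of "P0 E C" \<X> Y x "MC n C"] m.dom.psi.F_simps
          by (simp add: m.psi_ar_sel n.psi_ar_sel c.psi_ar_sel Star_Ob delta_ob_iff m.m_dom m.dom.frame_simps)
      qed (simp_all add: m.psi_ar_sel n.psi_ar_sel c.psi_ar_sel)
      then show ?thesis using m n c by (simp add: sel)
    qed
  qed
  then show ?thesis by (simp add: Functors_iff sel)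
qed

lemma Phi_Psi_inverse:
  assumes X: "category \<X>"
  shows "mutually_inverse (FunCat ST \<X>) (Cocones \<X>) (Phi K E W \<X>) (Psi K E W \<X>)"
proof -
  let ?P = "Cocones \<X>"
  note P = Phi_functor[OF X] note Q = Psi_functor[OF X]
  have "Psi K E W \<X> \<circ>\<^sub>F Phi K E W \<X> = id_functor (FunCat ST \<X>)"
  proof (rule functor_eqI)
    fix F assume "F \<in> Ob (FDom (id_functor (FunCat ST \<X>)))"
    then have F: "F \<in> Functors ST \<X>" by simp
    interpret star_functor K E W \<X> F by (rule star_functorI[OF F])
    show "FOb (Psi K E W \<X> \<circ>\<^sub>F Phi K E W \<X>) F = FOb (id_functor (FunCat ST \<X>)) F"
      using F phi_pnat psi_phi by (simp add: Phi_def Psi_def)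
  next
    fix \<alpha> assume "\<alpha> \<in> Ar (FDom (id_functor (FunCat ST \<X>)))"
    then have a: "\<alpha> \<in> Ar (FunCat ST \<X>)" by simp
    interpret star_transformation K E W \<X> \<alpha> by (rule star_transformationI[OF a])
    show "FAr (Psi K E W \<X> \<circ>\<^sub>F Phi K E W \<X>) \<alpha> = FAr (id_functor (FunCat ST \<X>)) \<alpha>"
      using a phi_ar_modif psi_phi_ar by (simp add: Phi_def Psi_def)
  qed (use P Q in \<open>simp_all add: Functors_iff is_functor_fcomp is_functor_id category_FunCat\<close>)
  moreover have "Phi K E W \<X> \<circ>\<^sub>F Psi K E W \<X> = id_functor ?P"
  proof (rule functor_eqI)
    fix \<theta> assume "\<theta> \<in> Ob (FDom (id_functor ?P))"
    then have p: "pnat_into \<X> \<theta>" by simp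
    interpret cocone K E W \<X> \<theta> by (rule coconeI[OF X p])
    show "FOb (Phi K E W \<X> \<circ>\<^sub>F Psi K E W \<X>) \<theta> = FOb (id_functor ?P) \<theta>"
      using p psi_ob_functor phi_psi by (simp add: Phi_def Psi_def)
  next
    fix m assume "m \<in> Ar (FDom (id_functor ?P))"
    then have m: "modif_into \<X> m" by simp
    interpret cocone_modification K E W \<X> m by (rule cocone_modificationI[OF X m])
    have "psi_ar K E W \<X> m \<in> Ar (FunCat ST \<X>)"
      using psi_ar_nt dom.psi_ob_functor by (simp add: FunCat_Ar psi_ar_sel Functors_iff)
    then show "FAr (Phi K E W \<X> \<circ>\<^sub>F Psi K E W \<X>) m = FAr (id_functor ?P) m"
      using m phi_psi_ar by (simp add: Phi_def Psi_def)
  qed (use P Q category_PsHom[OF X] in \<open>simp_all add: Functors_iff is_functor_fcomp is_functor_id\<close>)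
  ultimately show ?thesis using P Q by (simp add: mutually_inverse_def)
qed

end

section \<open>The universal property of the pseudo-colimit\<close>

lemma postcomp_sel [simp]: "FDom (postcomp A F) = FunCat A (FDom F)" "FCod (postcomp A F) = FunCat A (FCod F)"
  "H \<in> Functors A (FDom F) \<Longrightarrow> FOb (postcomp A F) H = F \<circ>\<^sub>F H"
  "\<sigma> \<in> Ar (FunCat A (FDom F)) \<Longrightarrow> FAr (postcomp A F) \<sigma> = nt_id F \<star>\<^sub>N \<sigma>"
  by (auto simp: postcomp_def)

lemma is_functor_postcomp:
  assumes F: "is_functor F" shows "is_functor (postcomp A F)"
proof (rule is_functorI[OF refl refl])
  show "FAr (postcomp A F) (Idt (FDom (postcomp A F)) H) = Idt (FCod (postcomp A F)) (FOb (postcomp A F) H)"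
    if "H \<in> Ob (FDom (postcomp A F))" for H
    using that F by (simp add: Functors_iff FunCat_Ar is_nt_id, intro nt_eqI)
      (auto simp: is_nt_id is_nt_whisker_left is_functor_fcomp whisker_left_NC functor_simps)
  show "FAr (postcomp A F) (\<tau> \<cdot>\<^bsub>FDom (postcomp A F)\<^esub> \<sigma>) =
      FAr (postcomp A F) \<tau> \<cdot>\<^bsub>FCod (postcomp A F)\<^esub> FAr (postcomp A F) \<sigma>"
    if "\<sigma> \<in> Ar (FDom (postcomp A F))" "\<tau> \<in> Ar (FDom (postcomp A F))"
      "Src (FDom (postcomp A F)) \<tau> = Tgt (FDom (postcomp A F)) \<sigma>" for \<sigma> \<tau>
  proof -
    have "\<tau> \<bullet>\<^sub>N \<sigma> \<in> Ar (FunCat A (FDom F))" using that by (simp add: FunCat_Ar is_nt_vcomp)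
    then show ?thesis using that F
      by (simp, intro nt_eqI)
       (auto simp: FunCat_Ar is_nt_vcomp is_nt_whisker_left whisker_left_NC functor_simps nt_simps)
  qed
qed (auto simp: category_FunCat postcomp_def F FunCat_Ar is_nt_whisker_left Functors_iff is_functor_fcomp nt_simps)

lemma postcomp_nt_sel [simp]: "NDom (postcomp_nt A \<alpha>) = postcomp A (NDom \<alpha>)" "NCod (postcomp_nt A \<alpha>) = postcomp A (NCod \<alpha>)"
  "H \<in> Functors A (FDom (NDom \<alpha>)) \<Longrightarrow> NC (postcomp_nt A \<alpha>) H = \<alpha> \<star>\<^sub>N nt_id H"
  by (simp_all add: postcomp_nt_def)

lemma is_nt_postcomp_nt:
  assumes a: "is_nt \<alpha>" shows "is_nt (postcomp_nt A \<alpha>)"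
proof (rule is_ntI[of _ "postcomp A (NDom \<alpha>)" "postcomp A (NCod \<alpha>)" "FunCat A (FDom (NDom \<alpha>))" "FunCat A (FCod (NDom \<alpha>))"])
  fix \<sigma> assume "\<sigma> \<in> Ar (FunCat A (FDom (NDom \<alpha>)))"
  then have s: "is_nt \<sigma>" "FDom (NDom \<sigma>) = A" "FCod (NDom \<sigma>) = FDom (NDom \<alpha>)"
    "\<sigma> \<in> Ar (FunCat A (FDom (NDom \<alpha>)))" by (simp_all add: FunCat_Ar)
  have "(\<alpha> \<star>\<^sub>N nt_id (NCod \<sigma>)) \<bullet>\<^sub>N (nt_id (NDom \<alpha>) \<star>\<^sub>N \<sigma>) = (nt_id (NCod \<alpha>) \<star>\<^sub>N \<sigma>) \<bullet>\<^sub>N (\<alpha> \<star>\<^sub>N nt_id (NDom \<sigma>))"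
  proof (rule nt_eqI)
    fix x assume "x \<in> Ob (FDom (NDom ((nt_id (NCod \<alpha>) \<star>\<^sub>N \<sigma>) \<bullet>\<^sub>N (\<alpha> \<star>\<^sub>N nt_id (NDom \<sigma>)))))"
    then have x: "x \<in> Ob A" using s by simp
    have "NC \<alpha> (FOb (NCod \<sigma>) x) \<cdot>\<^bsub>FCod (NDom \<alpha>)\<^esub> FAr (NDom \<alpha>) (NC \<sigma> x) =
        FAr (NCod \<alpha>) (NC \<sigma> x) \<cdot>\<^bsub>FCod (NDom \<alpha>)\<^esub> NC \<alpha> (FOb (NDom \<sigma>) x)"
      by (rule is_nt.NC_natural[OF a refl refl]) (use s x in \<open>simp_all add: nt_simps\<close>)
    then show "NC ((\<alpha> \<star>\<^sub>N nt_id (NCod \<sigma>)) \<bullet>\<^sub>N (nt_id (NDom \<alpha>) \<star>\<^sub>N \<sigma>)) x =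
        NC ((nt_id (NCod \<alpha>) \<star>\<^sub>N \<sigma>) \<bullet>\<^sub>N (\<alpha> \<star>\<^sub>N nt_id (NDom \<sigma>))) x"
      using x a s by (simp add: whisker_left_NC whisker_right_NC nt_simps)
  qed (use a s in \<open>simp_all add: is_nt_vcomp is_nt_whisker_left is_nt_whisker_right nt_simps\<close>)
  then show "NC (postcomp_nt A \<alpha>) (Tgt (FunCat A (FDom (NDom \<alpha>))) \<sigma>) \<cdot>\<^bsub>FunCat A (FCod (NDom \<alpha>))\<^esub>
      FAr (postcomp A (NDom \<alpha>)) \<sigma> =
      FAr (postcomp A (NCod \<alpha>)) \<sigma> \<cdot>\<^bsub>FunCat A (FCod (NDom \<alpha>))\<^esub>
      NC (postcomp_nt A \<alpha>) (Src (FunCat A (FDom (NDom \<alpha>))) \<sigma>)"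
    using a s by (simp add: nt_simps Functors_iff)
qed (use a in \<open>simp_all add: Functors_iff nt_simps is_functor_postcomp FunCat_Ar is_nt_whisker_right\<close>, simp add: postcomp_nt_def)

text \<open>
  Applying \<open>F\<close> to a cocone precomposes and postcomposes its values; the two operations commute strictly.
\<close>

lemma postcomp_precomp:
  assumes F: "is_functor F" and G: "is_functor G"
  shows "postcomp (FDom G) F \<circ>\<^sub>F precomp (FDom F) G = precomp (FCod F) G \<circ>\<^sub>F postcomp (FCod G) F"
proof (rule functor_eqI)
  fix \<sigma> assume "\<sigma> \<in> Ar (FDom (precomp (FCod F) G \<circ>\<^sub>F postcomp (FCod G) F))"
  then have s: "is_nt \<sigma>" "FDom (NDom \<sigma>) = FCod G" "FCod (NDom \<sigma>) = FDom F" "\<sigma> \<in> Ar (FunCat (FCod G) (FDom F))"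
    by (simp_all add: FunCat_Ar)
  have "nt_id F \<star>\<^sub>N (\<sigma> \<star>\<^sub>N nt_id G) = (nt_id F \<star>\<^sub>N \<sigma>) \<star>\<^sub>N nt_id G"
    by (rule nt_eqI) (use F G s in \<open>simp_all add: is_nt_whisker_left is_nt_whisker_right whisker_left_NC whisker_right_NC
        fcomp_assoc nt_simps functor_simps\<close>)
  then show "FAr (postcomp (FDom G) F \<circ>\<^sub>F precomp (FDom F) G) \<sigma> = FAr (precomp (FCod F) G \<circ>\<^sub>F postcomp (FCod G) F) \<sigma>"
    using F G s by (simp add: FunCat_Ar is_nt_whisker_left is_nt_whisker_right nt_simps)
next
  fix H assume "H \<in> Ob (FDom (precomp (FCod F) G \<circ>\<^sub>F postcomp (FCod G) F))"
  then show "FOb (postcomp (FDom G) F \<circ>\<^sub>F precomp (FDom F) G) H = FOb (precomp (FCod F) G \<circ>\<^sub>F postcomp (FCod G) F) H"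
    using F G by (simp add: Functors_iff is_functor_fcomp fcomp_assoc)
qed (use F G in \<open>simp_all add: is_functor_fcomp is_functor_postcomp is_functor_precomp\<close>)

context weight
begin

lemma id_star_functor: "star_functor K E W ST (id_functor ST)"
  by (rule star_functorI) (simp add: Functors_iff is_functor_id Star_category)

end

context star_functor
begin

interpretation I: star_functor K E W ST "id_functor ST" by (rule id_star_functor)

lemma postcomp_phi_comp:
  assumes C: "C \<in> Ob0 K"
  shows "postcomp (P0 E C) F \<circ>\<^sub>F phi_comp K E W (id_functor ST) C = phi_comp K E W F C"
proof (rule functor_eqI)
  note s = C F_simps s_simps star_ar_simps I.phi_comp_sel phi_comp_sel I.phi_comp_functor phi_comp_functor I.phi_comp_nt phi_comp_nt
    I.phi_fun_sel phi_fun_sel I.phi_fun_functor phi_fun_functor Star_Ob delta_ob_iff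
  have Y_eq: "F \<circ>\<^sub>F phi_fun K E W (id_functor ST) C Y = phi_fun K E W F C Y" if "Y \<in> Ob (P0 W C)" for Y
    by (rule functor_eqI) (use that in \<open>simp_all add: s is_functor_fcomp\<close>)
  show "FOb (postcomp (P0 E C) F \<circ>\<^sub>F phi_comp K E W (id_functor ST) C) Y = FOb (phi_comp K E W F C) Y"
    if "Y \<in> Ob (FDom (phi_comp K E W F C))" for Y
    using that by (simp add: s Functors_iff Y_eq)
  show "FAr (postcomp (P0 E C) F \<circ>\<^sub>F phi_comp K E W (id_functor ST) C) v = FAr (phi_comp K E W F C) v"
    if v: "v \<in> Ar (FDom (phi_comp K E W F C))" for v
  proof -
    have "nt_id F \<star>\<^sub>N FAr (phi_comp K E W (id_functor ST) C) v = FAr (phi_comp K E W F C) v"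
      by (rule nt_eqI) (use v in \<open>simp_all add: s is_nt_whisker_left whisker_left_NC Y_eq\<close>)
    moreover have "FAr (phi_comp K E W (id_functor ST) C) v \<in> Ar (FunCat (P0 E C) ST)"
      using v by (simp add: s FunCat_Ar)
    ultimately show ?thesis using v by (simp add: s)
  qed
qed (simp_all add: C F_simps is_functor_fcomp is_functor_postcomp phi_comp_sel I.phi_comp_sel phi_comp_functor I.phi_comp_functor)

text \<open>
  Applying \<open>F\<close> to the universal transformation gives back \<open>\<Phi>(F)\<close>, since \<open>F\<close> is composed with the
  identity functor of \<open>E \<star> W\<close>, from which the universal transformation is built.
\<close>

lemma postcomp_phi_cell:
  assumes f: "f \<in> Ar1 K"
  shows "nt_id (postcomp (P0 E (Dom1 K f)) F) \<star>\<^sub>N phi_cell K E W (id_functor ST) f = phi_cell K E W F f" (is "?l = ?r")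
proof -
  let ?C = "Dom1 K f" let ?D = "Cod1 K f"
  note s = f simps F_simps phi_cell_sel I.phi_cell_sel phi_cell_nt I.phi_cell_nt phi_comp_sel I.phi_comp_sel phi_comp_functor I.phi_comp_functor
    is_functor_postcomp is_functor_precomp
  have l: "is_nt ?l" by (rule is_nt_whisker_left) (simp_all add: s)
  have "postcomp (P0 E ?C) F \<circ>\<^sub>F (precomp ST (P1 E f) \<circ>\<^sub>F phi_comp K E W (id_functor ST) ?D) =
      (postcomp (P0 E ?C) F \<circ>\<^sub>F precomp ST (P1 E f)) \<circ>\<^sub>F phi_comp K E W (id_functor ST) ?D"
    by (rule fcomp_assoc[symmetric]) (simp_all add: s)
  also have "postcomp (P0 E ?C) F \<circ>\<^sub>F precomp ST (P1 E f) = precomp \<X> (P1 E f) \<circ>\<^sub>F postcomp (P0 E ?D) F"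
    using postcomp_precomp[of F "P1 E f"] by (simp add: s)
  also have "\<dots> \<circ>\<^sub>F phi_comp K E W (id_functor ST) ?D = precomp \<X> (P1 E f) \<circ>\<^sub>F (postcomp (P0 E ?D) F \<circ>\<^sub>F phi_comp K E W (id_functor ST) ?D)"
    by (rule fcomp_assoc) (simp_all add: s)
  finally have cod: "NCod ?l = NCod ?r" using f by (simp add: s postcomp_phi_comp)
  have "NDom ?l = (postcomp (P0 E ?C) F \<circ>\<^sub>F phi_comp K E W (id_functor ST) ?C) \<circ>\<^sub>F P1 W f"
    using fcomp_assoc[of "P1 W f" "phi_comp K E W (id_functor ST) ?C" "postcomp (P0 E ?C) F"] by (simp add: s)
  then have dom: "NDom ?l = NDom ?r" using f by (simp add: s postcomp_phi_comp)
  have "?l = ?r \<longleftrightarrow> (\<forall>Y\<in>Ob (P0 W ?D). \<forall>x\<in>Ob (P0 E ?C). NC (NC ?l Y) x = NC (NC ?r Y) x)"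
    by (rule nt2_eq_iff[OF l _ dom cod]) (simp_all add: s)
  moreover have "NC (NC ?l Y) x = NC (NC ?r Y) x" if Y: "Y \<in> Ob (P0 W ?D)" and x: "x \<in> Ob (P0 E ?C)" for Y x
  proof -
    have n: "is_nt (NC (phi_cell K E W (id_functor ST) f) Y)" "FDom (NDom (NC (phi_cell K E W (id_functor ST) f) Y)) = P0 E ?C"
       "FCod (NDom (NC (phi_cell K E W (id_functor ST) f) Y)) = ST"
      using nt2_NC[OF I.phi_cell_nt[OF f], of "P0 E ?C" ST Y] Y by (simp_all add: s)
    then have "NC (phi_cell K E W (id_functor ST) f) Y \<in> Ar (FunCat (P0 E ?C) ST)" by (simp add: FunCat_Ar)
    then show ?thesis
      using Y x n whisker_left_NC[of "postcomp (P0 E ?C) F" "phi_cell K E W (id_functor ST) f" Y]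
      by (simp add: s whisker_left_NC star_ar_simps base_arrow_ar)
  qed
  ultimately show ?thesis by simp
qed

end

context weight
begin

lemma star_cocone_pnat: "pnat_into ST (star_cocone K E W)"
  unfolding star_cocone_def by (rule star_functor.phi_pnat[OF id_star_functor])

lemma star_cocone_sel: "C \<in> Ob0 K \<Longrightarrow> TOb (star_cocone K E W) C = phi_comp K E W (id_functor ST) C"
  "f \<in> Ar1 K \<Longrightarrow> TCell (star_cocone K E W) f = phi_cell K E W (id_functor ST) f"
  by (simp_all add: star_cocone_def phi_ob_def)

text \<open>
  The comparison functor of the universal property is equal to \<open>\<Phi>\<close>, not only isomorphic to it, so its
  invertibility is that of \<open>\<Phi>\<close>.
\<close>

lemma induced_eq_Phi:
  fixes \<X> :: "('x, 'y) cat"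
  shows "induced K E W ST (star_cocone K E W) \<X> = Phi K E W \<X>"
proof -
  define ob where "ob = (\<lambda>F :: (('c, 'eo, 'wo) dob, ('c, 'f, 'eo, 'ea, 'wo, 'wa) sar, 'x, 'y) fnct.
     \<lparr>TOb = (\<lambda>C\<in>Ob0 K. postcomp (P0 E C) F \<circ>\<^sub>F TOb (star_cocone K E W) C),
      TCell = (\<lambda>f\<in>Ar1 K. nt_id (postcomp (P0 E (Dom1 K f)) F) \<star>\<^sub>N TCell (star_cocone K E W) f)\<rparr>)"
  have ob: "ob F = phi_ob K E W F" if "F \<in> Functors ST \<X>" for F
  proof -
    interpret star_functor K E W \<X> F by (rule star_functorI[OF that])
    show ?thesis by (auto simp: ob_def phi_ob_def star_cocone_sel postcomp_phi_comp postcomp_phi_cell intro!: restrict_ext)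
  qed
  have ar: "\<lparr>MDom = ob (NDom \<alpha>), MCod = ob (NCod \<alpha>),
      MC = (\<lambda>C\<in>Ob0 K. postcomp_nt (P0 E C) \<alpha> \<star>\<^sub>N nt_id (TOb (star_cocone K E W) C))\<rparr> = phi_ar K E W \<alpha>"
    if a: "\<alpha> \<in> Ar (FunCat ST \<X>)" for \<alpha>
  proof -
    interpret star_transformation K E W \<X> \<alpha> by (rule star_transformationI[OF a])
    interpret I: star_functor K E W ST "id_functor ST" by (rule id_star_functor)
    have n: "is_nt \<alpha>" using a by (simp add: FunCat_Ar)
    note s = dom.F_simps cod.F_simps dom.s_simps is_nt_postcomp_nt[OF n] I.phi_comp_functor I.phi_comp_sel I.phi_fun_sel I.phi_fun_functor
      phi_ar_sel phi_ar_nt dom.phi_comp_sel cod.phi_comp_sel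
    have "postcomp_nt (P0 E C) \<alpha> \<star>\<^sub>N nt_id (TOb (star_cocone K E W) C) = MC (phi_ar K E W \<alpha>) C" (is "?l = ?r") if C: "C \<in> Ob0 K" for C
    proof -
      have e: "TOb (star_cocone K E W) C = phi_comp K E W (id_functor ST) C" using C by (simp add: star_cocone_sel)
      have "is_nt ?l" unfolding e by (rule is_nt_whisker_right) (simp_all add: s C)
      then have "?l = ?r \<longleftrightarrow> (\<forall>Y\<in>Ob (P0 W C). \<forall>x\<in>Ob (P0 E C). NC (NC ?l Y) x = NC (NC ?r Y) x)"
        unfolding e using C by (intro nt2_eq_iff) (simp_all add: s dom.postcomp_phi_comp cod.postcomp_phi_comp)
      moreover have "NC (NC ?l Y) x = NC (NC ?r Y) x" if "Y \<in> Ob (P0 W C)" "x \<in> Ob (P0 E C)" for Y x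
        unfolding e using that C n by (simp add: s whisker_right_NC Functors_iff Star_Ob delta_ob_iff)
      ultimately show ?thesis by simp
    qed
    moreover have "MC (phi_ar K E W \<alpha>) \<in> extensional (Ob0 K)" by (simp add: phi_ar_def)
    ultimately have "(\<lambda>C\<in>Ob0 K. postcomp_nt (P0 E C) \<alpha> \<star>\<^sub>N nt_id (TOb (star_cocone K E W) C)) = MC (phi_ar K E W \<alpha>)"
      by (intro extensionalityI[of _ "Ob0 K"]) simp_all
    then show ?thesis using ob[OF dom.F] ob[OF cod.F] by (simp add: phi_ar_def)
  qed
  show ?thesis
    unfolding induced_def Phi_def Let_def ob_def[symmetric]
    using ob ar by (auto intro!: restrict_ext)
qed

end

theorem theorem3p7:
  fixes \<CC> :: "('c, 'f, 't) two_cat"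
    and E :: "('c, 'f, 't, 'eo, 'ea) cat_psf"
    and W :: "('c, 'f, 't, 'wo, 'wa) cat_psf"
    and \<X> :: "('x, 'y) cat"
  assumes "two_category \<CC>"
    and "pseudofunctor \<CC> Cat E"
    and "pseudofunctor (op1 \<CC>) Cat W"
    and "category \<X>"
  shows "mutually_inverse (FunCat (Star \<CC> E W) \<X>) (PsHom (op1 \<CC>) W (CatInto E \<X>))
           (Phi \<CC> E W \<X>) (Psi \<CC> E W \<X>) \<and>
         pseudo_colimit_at \<CC> E W (Star \<CC> E W) (star_cocone \<CC> E W) \<X>"
proof -
  interpret weight \<CC> E W
    using assms by (intro weight.intro cat_valued.intro)
  show ?thesis
    using Phi_Psi_inverse[OF assms(4)] Star_category star_cocone_pnat
    unfolding pseudo_colimit_at_def induced_eq_Phi by blast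
qed

end
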